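(* Suppose that the control algebraic Riccati equation (CARE) $$A_d^*\Pi A_d-\Pi+C_d^*C_d=(C_d^*D_d+A_d^*\Pi B_d)(I+D_d^*D_d+B_d^*\Pi B_d)^{-1}(D_d^*C_d+B_d^*\Pi A_d)$$ has a nonnegative self-adjoint solution $\Pi\in\mathbb{C}^{n\times n}$ and that the filter algebraic Riccati equation (FARE) $$A_d\tilde\Pi A_d^*-\tilde\Pi+B_dB_d^*=(B_dD_d^*+A_d\tilde\Pi C_d^* )(I+D_dD_d^*+C_d\tilde\Pi C_d^* )^{-1}(D_dB_d^*+C_d\tilde\Pi A_d^* )$$ has a nonnegative self-adjoint solution $\tilde\Pi\in\mathbb{C}^{n\times n}$. Put $$F_d:=-(I+D_d^*D_d+B_d^*\Pi B_d)^{-1}(D_d^*C_d+B_d^*\Pi A_d),\qquad A_\Pi:=A_d+B_dF_d,$$ and assume that $r(A_\Pi)<1$, where $r$ denotes the spectral radius. Then, for every $z_0\in X$, the unique optimal control $u^{\mathrm{opt}}\in \mathrm{L}^2(0,\infty;\mathbb{C}^p)$ that minimizes the cost functional $u\mapsto p(1)^{-1}J(z_0,u)$ is given by $$u^{\mathrm{opt}}(t)=\lambda_0(1)F_d\,z^{\mathrm{opt}}(1,t),$$ where $z^{\mathrm{opt}}$ is the state trajectory of the closed-loop system $$\frac{\partial z^{\mathrm{opt}}}{\partial t}(\zeta,t)=-\frac{\partial}{\partial\zeta}\big(\lambda_0(\zeta)z^{\mathrm{opt}}(\zeta,t)\big),\quad z^{\mathrm{opt}}(\zeta,0)=z_0(\zeta),\quad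 \lambda_0(0)z^{\mathrm{opt}}(0,t)=(A_d+B_dF_d)\lambda_0(1)z^{\mathrm{opt}}(1,t).$$ Moreover, this closed-loop system is exponentially stable.
   Context: Let $n,p,m\in\mathbb{N}$ with $p\le n$, $X=\mathrm{L}^2(0,1;\mathbb{C}^n)$, $\lambda_0\in \mathrm{L}^\infty(0,1;\mathbb{R}^+)$ scalar with $\lambda_0(\zeta)\ge\epsilon>0$ a.e. on $[0,1]$, $M\in \mathrm{L}^\infty(0,1;\mathbb{R}^{n\times n})$, $K,L\in\mathbb{C}^{n\times n}$ with $K$ invertible, $K_y,L_y\in\mathbb{C}^{m\times n}$. Let $P:[0,1]\to\mathbb{R}^{n\times n}$ be the unique absolutely continuous solution of $P'(\zeta)=\lambda_0(\zeta)^{-1}M(\zeta)P(\zeta)$ (a.e.), $P(0)=I$. Let $p(\zeta):=\int_0^\zeta\lambda_0(\eta)^{-1}\,\mathrm{d}\eta$ (the function $p(\cdot)$ is not to be confused with the integer $p$, the input dimension). With $\left[\begin{smallmatrix}0\\ I\end{smallmatrix}\right]\in\mathbb{C}^{n\times p}$ ($I$ the $p\times p$ identity), define $$A_d:=-K^{-1}LP(1),\quad B_d:=-K^{-1}\left[\begin{smallmatrix}0\\ I\end{smallmatrix}\right],\quad C_d:=(K_yK^{-1}L-L_y)P(1),\quad D_d:=K_yK^{-1}\left[\begin{smallmatrix}0\\ I\end{smallmatrix}\right].$$ The controlled system is $$\frac{\partial z}{\partial t}(\zeta,t)=-\frac{\partial}{\partial\zeta}(\lambda_0(\zeta)z(\zeta,t)),\quad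 z(\zeta,0)=z_0(\zeta),$$ $$B_du(t)=\lambda_0(0)z(0,t)-A_d\lambda_0(1)z(1,t),\qquad y(t)=C_d\lambda_0(1)z(1,t)+D_du(t),$$ with $z_0\in X$, input $u(t)\in\mathbb{C}^p$, output $y(t)\in\mathbb{C}^m$. The cost is $J(z_0,u)=\int_0^\infty\big[\|y(t)\|_{\mathbb{C}^m}^2+\|u(t)\|_{\mathbb{C}^p}^2\big]\,\mathrm{d}t\in[0,\infty]$, where $y$ is the output for initial state $z_0$ and input $u$. Solutions are mild solutions: $z\in C([0,\infty);X)$ such that, with $Z(t)=\int_0^tz(\cdot,s)\,\mathrm{d}s$, one has $\lambda_0Z(t)\in \mathrm{H}^1(0,1;\mathbb{C}^n)$ and $z(\cdot,t)-z_0=-\frac{\mathrm{d}}{\mathrm{d}\zeta}(\lambda_0Z(t))$ for all $t\ge0$, and boundary/output relations hold after integration in time over $[0,t]$, where $\int_0^t\lambda_0(\zeta)z(\zeta,s)\,\mathrm{d}s$ at $\zeta\in\{0,1\}$ means $(\lambda_0Z(t))(\zeta)$; correspondingly $\lambda_0(\zeta)z(\zeta,t)$ at $\zeta\in\{0,1\}$ denotes the a.e. time derivative of $(\lambda_0Z(t))(\zeta)$ (a function in $\mathrm{L}^2_{\mathrm{loc}}$ in $t$). Exponential stability of the closed-loop system means that there are $c,\omega>0$ with $\|z^{\mathrm{opt}}(\cdot,t)\|_X\le c\,e^{-\omega t}\|z_0\|_X$ for all $t\ge0$ and $z_0\in X$. *)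

theory Defs
  imports "HOL-Analysis.Analysis"
begin

subsection \<open>Complex matrices\<close>

definition cmat :: "real ^ 'n ^ 'm \<Rightarrow> complex ^ 'n ^ 'm" where
  "cmat A = (\<chi> i j. complex_of_real (A $ i $ j))"

definition adj :: "complex ^ 'n ^ 'm \<Rightarrow> complex ^ 'm ^ 'n" where
  "adj A = (\<chi> i j. cnj (A $ j $ i))"

definition nonneg_selfadjoint :: "complex ^ 'n ^ 'n \<Rightarrow> bool" where
  "nonneg_selfadjoint A \<longleftrightarrow>
     adj A = A \<and> (\<forall>x. 0 \<le> Re (\<Sum>i\<in>UNIV. cnj (x $ i) * (A *v x) $ i))"

definition spectral_radius :: "complex ^ 'n ^ 'n \<Rightarrow> real" where
  "spectral_radius A = Max (norm ` {k. \<exists>v. v \<noteq> 0 \<and> A *v v = k *s v})"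

text \<open>The block column of height n and width p whose last p rows are the identity; rows and
  columns are enumerated along the linear orders of the index types, starting from 0.\<close>

definition index_rank :: "'a::{finite, linorder} \<Rightarrow> nat" where
  "index_rank i = card {k. k < i}"

definition zero_id_block :: "complex ^ 'p::{finite, linorder} ^ 'n::{finite, linorder}" where
  "zero_id_block = (\<chi> i j.
     if index_rank i = (CARD('n) - CARD('p)) + index_rank j then 1 else 0)"

definition CARE :: "complex ^ 'n ^ 'n \<Rightarrow> complex ^ 'p ^ 'n \<Rightarrow> complex ^ 'n ^ 'm \<Rightarrow> complex ^ 'p ^ 'm
    \<Rightarrow> complex ^ 'n ^ 'n \<Rightarrow> bool" where
  "CARE A B C D X \<longleftrightarrow>
     adj A ** X ** A - X + adj C ** C
     = (adj C ** D + adj A ** X ** B) ** matrix_inv (mat 1 + adj D ** D + adj B ** X ** B)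
         ** (adj D ** C + adj B ** X ** A)"

definition FARE :: "complex ^ 'n ^ 'n \<Rightarrow> complex ^ 'p ^ 'n \<Rightarrow> complex ^ 'n ^ 'm \<Rightarrow> complex ^ 'p ^ 'm
    \<Rightarrow> complex ^ 'n ^ 'n \<Rightarrow> bool" where
  "FARE A B C D X \<longleftrightarrow>
     A ** X ** adj A - X + B ** adj B
     = (B ** adj D + A ** X ** adj C) ** matrix_inv (mat 1 + D ** adj D + C ** X ** adj C)
         ** (D ** adj B + C ** X ** adj A)"


subsection \<open>Function spaces\<close>

text \<open>Elements of \<open>L\<^sup>2\<close> and \<open>L\<^sup>\<infinity>\<close> are represented by functions; equality in these spaces is
  equality almost everywhere.\<close>

definition L2_on :: "real set \<Rightarrow> (real \<Rightarrow> 'a::euclidean_space) set" where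
  "L2_on S = {f. f \<in> borel_measurable (lebesgue_on S) \<and>
                 integrable (lebesgue_on S) (\<lambda>x. (norm (f x))\<^sup>2)}"

definition L2_norm_on :: "real set \<Rightarrow> (real \<Rightarrow> 'a::euclidean_space) \<Rightarrow> real" where
  "L2_norm_on S f = sqrt (LINT x|lebesgue_on S. (norm (f x))\<^sup>2)"

definition L2_loc :: "(real \<Rightarrow> 'a::euclidean_space) set" where
  "L2_loc = {f. \<forall>T>0. f \<in> L2_on {0..T}}"

definition Linfty_on :: "real set \<Rightarrow> (real \<Rightarrow> 'a::euclidean_space) set" where
  "Linfty_on S = {f. f \<in> borel_measurable (lebesgue_on S) \<and>
                     (\<exists>b. AE x in lebesgue_on S. norm (f x) \<le> b)}"

definition abs_continuous_on_interval ::
    "real \<Rightarrow> real \<Rightarrow> (real \<Rightarrow> 'a::real_normed_vector) \<Rightarrow> bool" where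
  "abs_continuous_on_interval a b f \<longleftrightarrow>
     (\<forall>e>0. \<exists>d>0. \<forall>D S. D division_of S \<and> S \<subseteq> {a..b} \<and> (\<Sum>k\<in>D. measure lborel k) < d \<longrightarrow>
        (\<Sum>k\<in>D. norm (f (Sup k) - f (Inf k))) < e)"

text \<open>\<open>H1_derivative f g w\<close>: the class of \<open>f\<close> lies in \<open>H\<^sup>1(0,1)\<close>, its derivative is \<open>g\<close>, and \<open>w\<close>
  is its continuous representative on \<open>[0,1]\<close>. We use that on an interval the elements of \<open>H\<^sup>1\<close>
  are the indefinite integrals of square integrable functions.\<close>

definition H1_derivative ::
    "(real \<Rightarrow> 'a::euclidean_space) \<Rightarrow> (real \<Rightarrow> 'a) \<Rightarrow> (real \<Rightarrow> 'a) \<Rightarrow> bool" where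
  "H1_derivative f g w \<longleftrightarrow>
     f \<in> L2_on {0..1} \<and> g \<in> L2_on {0..1} \<and>
     (AE \<zeta> in lebesgue_on {0..1}. f \<zeta> = w \<zeta>) \<and>
     (\<forall>\<zeta>\<in>{0..1}. w \<zeta> = w 0 + integral {0..\<zeta>} g)"


subsection \<open>Trajectories with values in \<open>X = L\<^sup>2(0,1)\<close>\<close>

text \<open>A trajectory \<open>z\<close> is a function of time with values in \<open>X\<close>; thus \<open>z t \<zeta>\<close> is the value at time
  \<open>t\<close> and position \<open>\<zeta>\<close>.\<close>

definition X_continuous :: "(real \<Rightarrow> real \<Rightarrow> 'a::euclidean_space) \<Rightarrow> bool" where
  "X_continuous z \<longleftrightarrow>
     (\<forall>t\<ge>0. z t \<in> L2_on {0..1} \<and>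
        ((\<lambda>s. L2_norm_on {0..1} (\<lambda>\<zeta>. z s \<zeta> - z t \<zeta>)) \<longlongrightarrow> 0) (at t within {0..}))"

text \<open>\<open>X_integral z t Z\<close>: the \<open>X\<close>-valued Riemann integral of \<open>z\<close> over \<open>[0,t]\<close> is (the class of) \<open>Z\<close>.
  Pointwise integration in time is avoided because the representatives \<open>z s\<close> need not be jointly
  measurable.\<close>

definition X_integral :: "(real \<Rightarrow> real \<Rightarrow> 'a::euclidean_space) \<Rightarrow> real \<Rightarrow> (real \<Rightarrow> 'a) \<Rightarrow> bool" where
  "X_integral z t Z \<longleftrightarrow>
     Z \<in> L2_on {0..1} \<and>
     (\<forall>e>0. \<exists>d>0. \<forall>D. D tagged_division_of {0..t} \<and> (\<lambda>s. ball s d) fine D \<longrightarrow>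
        L2_norm_on {0..1} (\<lambda>\<zeta>. (\<Sum>(s, k)\<in>D. measure lborel k *\<^sub>R z s \<zeta>) - Z \<zeta>) < e)"

text \<open>Mild solutions of the transport equation. Here \<open>w t\<close> is the continuous representative of
  \<open>\<lambda>\<^sub>0 Z(t)\<close>, \<open>Z(t)\<close> being the integral of \<open>z\<close> over \<open>[0,t]\<close>, so that \<open>w t 0\<close> and \<open>w t 1\<close>
  are the boundary values integrated in time.\<close>

definition transport_mild ::
    "(real \<Rightarrow> real) \<Rightarrow> (real \<Rightarrow> 'a::euclidean_space) \<Rightarrow> (real \<Rightarrow> real \<Rightarrow> 'a) \<Rightarrow> (real \<Rightarrow> real \<Rightarrow> 'a) \<Rightarrow> bool"
  where
  "transport_mild lam0 z0 z w \<longleftrightarrow>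
     X_continuous z \<and>
     (\<forall>t\<ge>0. \<exists>Z. X_integral z t Z \<and>
        H1_derivative (\<lambda>\<zeta>. lam0 \<zeta> *\<^sub>R Z \<zeta>) (\<lambda>\<zeta>. - (z t \<zeta> - z0 \<zeta>)) (w t))"

text \<open>\<open>boundary_trace w \<zeta> \<tau>\<close>: \<open>\<tau>(t)\<close> is \<open>\<lambda>\<^sub>0(\<zeta>) z(\<zeta>,t)\<close>, for \<open>\<zeta>\<close> an end point of \<open>[0,1]\<close>.\<close>

definition boundary_trace :: "(real \<Rightarrow> real \<Rightarrow> 'a::euclidean_space) \<Rightarrow> real \<Rightarrow> (real \<Rightarrow> 'a) \<Rightarrow> bool" where
  "boundary_trace w \<zeta> \<tau> \<longleftrightarrow>
     \<tau> \<in> L2_loc \<and>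
     (AE t in lebesgue_on {0..}. ((\<lambda>s. w s \<zeta>) has_vector_derivative \<tau> t) (at t))"


subsection \<open>Controlled system, cost and closed loop\<close>

definition system_solution ::
    "(real \<Rightarrow> real) \<Rightarrow> complex ^ 'n ^ 'n \<Rightarrow> complex ^ 'p ^ 'n \<Rightarrow> complex ^ 'n ^ 'm \<Rightarrow> complex ^ 'p ^ 'm
     \<Rightarrow> (real \<Rightarrow> complex ^ 'n) \<Rightarrow> (real \<Rightarrow> complex ^ 'p)
     \<Rightarrow> (real \<Rightarrow> real \<Rightarrow> complex ^ 'n) \<Rightarrow> (real \<Rightarrow> real \<Rightarrow> complex ^ 'n) \<Rightarrow> (real \<Rightarrow> complex ^ 'm) \<Rightarrow> bool"
  where
  "system_solution lam0 A B C D z0 u z w y \<longleftrightarrow>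
     u \<in> L2_loc \<and> y \<in> L2_loc \<and> transport_mild lam0 z0 z w \<and>
     (\<forall>t\<ge>0. B *v integral {0..t} u = w t 0 - A *v w t 1) \<and>
     (\<forall>t\<ge>0. integral {0..t} y = C *v w t 1 + D *v integral {0..t} u)"

text \<open>The output is determined almost everywhere by the initial state and the input.\<close>

definition system_output ::
    "(real \<Rightarrow> real) \<Rightarrow> complex ^ 'n ^ 'n \<Rightarrow> complex ^ 'p ^ 'n \<Rightarrow> complex ^ 'n ^ 'm \<Rightarrow> complex ^ 'p ^ 'm
     \<Rightarrow> (real \<Rightarrow> complex ^ 'n) \<Rightarrow> (real \<Rightarrow> complex ^ 'p) \<Rightarrow> (real \<Rightarrow> complex ^ 'm)" where
  "system_output lam0 A B C D z0 u = (SOME y. \<exists>z w. system_solution lam0 A B C D z0 u z w y)"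

definition cost_J ::
    "(real \<Rightarrow> real) \<Rightarrow> complex ^ 'n ^ 'n \<Rightarrow> complex ^ 'p ^ 'n \<Rightarrow> complex ^ 'n ^ 'm \<Rightarrow> complex ^ 'p ^ 'm
     \<Rightarrow> (real \<Rightarrow> complex ^ 'n) \<Rightarrow> (real \<Rightarrow> complex ^ 'p) \<Rightarrow> ennreal" where
  "cost_J lam0 A B C D z0 u =
     (\<integral>\<^sup>+ t. ennreal ((norm (system_output lam0 A B C D z0 u t))\<^sup>2 + (norm (u t))\<^sup>2)
        \<partial>lebesgue_on {0..})"

definition travel_time :: "(real \<Rightarrow> real) \<Rightarrow> real \<Rightarrow> real" where
  "travel_time lam0 \<zeta> = integral {0..\<zeta>} (\<lambda>\<eta>. inverse (lam0 \<eta>))"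

definition unique_L2_minimizer ::
    "((real \<Rightarrow> 'a::euclidean_space) \<Rightarrow> ennreal) \<Rightarrow> (real \<Rightarrow> 'a) \<Rightarrow> bool" where
  "unique_L2_minimizer J u \<longleftrightarrow>
     u \<in> L2_on {0..} \<and> (\<forall>v\<in>L2_on {0..}. J u \<le> J v) \<and>
     (\<forall>v\<in>L2_on {0..}. (\<forall>v'\<in>L2_on {0..}. J v \<le> J v') \<longrightarrow>
        (AE t in lebesgue_on {0..}. v t = u t))"

definition closed_loop_solution ::
    "(real \<Rightarrow> real) \<Rightarrow> complex ^ 'n ^ 'n \<Rightarrow> complex ^ 'p ^ 'n \<Rightarrow> complex ^ 'n ^ 'p
     \<Rightarrow> (real \<Rightarrow> complex ^ 'n) \<Rightarrow> (real \<Rightarrow> real \<Rightarrow> complex ^ 'n) \<Rightarrow> (real \<Rightarrow> real \<Rightarrow> complex ^ 'n) \<Rightarrow> bool"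
  where
  "closed_loop_solution lam0 A B F z0 z w \<longleftrightarrow>
     transport_mild lam0 z0 z w \<and> (\<forall>t\<ge>0. w t 0 = (A + B ** F) *v w t 1)"

definition closed_loop_exp_stable ::
    "(real \<Rightarrow> real) \<Rightarrow> complex ^ 'n ^ 'n \<Rightarrow> complex ^ 'p ^ 'n \<Rightarrow> complex ^ 'n ^ 'p \<Rightarrow> bool" where
  "closed_loop_exp_stable lam0 A B F \<longleftrightarrow>
     (\<exists>c>0. \<exists>\<omega>>0. \<forall>z0\<in>L2_on {0..1}. \<forall>z w. closed_loop_solution lam0 A B F z0 z w \<longrightarrow>
        (\<forall>t\<ge>0. L2_norm_on {0..1} (z t) \<le> c * exp (- \<omega> * t) * L2_norm_on {0..1} z0))"

end

theory Submission
  imports Defs "HOL-Computational_Algebra.Fundamental_Theorem_Algebra"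
begin

text \<open>Along its characteristics the transport equation is a pure delay. With the travel time
  \<open>p(\<zeta>)\<close> and \<open>T = p(1)\<close>, mild solutions satisfy \<open>\<lambda>\<^sub>0(\<zeta>) z(\<zeta>,t) = g(t - p(\<zeta>))\<close>, where the boundary
  condition becomes \<open>g(t) = A g(t - T) + B u(t)\<close>. Hence for almost every \<open>s \<in> [0,T)\<close> the values
  \<open>x\<^sub>k = g(s + (k-1)T)\<close> and \<open>u\<^sub>k = u(s + kT)\<close> form a trajectory of the discrete-time system
  \<open>(A,B,C,D)\<close>, and the cost is the integral over \<open>s\<close> of the discrete-time costs.

  With \<open>S = I + D\<^sup>*D + B\<^sup>*\<Pi>B\<close> and \<open>e\<^sub>k = u\<^sub>k - F x\<^sub>k\<close>, the control Riccati equation and completion of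
  squares turn the cost up to time \<open>N\<close> plus \<open>\<langle>x\<^sub>N, \<Pi>x\<^sub>N\<rangle>\<close> into
  \<open>\<langle>x\<^sub>0, \<Pi>x\<^sub>0\<rangle> + \<Sum>\<langle>e\<^sub>k, S e\<^sub>k\<rangle>\<close>. So the feedback \<open>u\<^sub>k = F x\<^sub>k\<close> is optimal as soon as finite cost implies
  \<open>x\<^sub>N \<longlonglongrightarrow> 0\<close>. Here the filter Riccati equation enters: it is the control Riccati equation of the
  dual system, and the adjoint \<open>H\<close> of its feedback makes \<open>A + HC\<close> stable, since an eigenvector of
  \<open>(A + HC)\<^sup>*\<close> with eigenvalue outside the open unit disc would be an eigenvector of \<open>A\<^sup>*\<close> in the kernel
  of \<open>B\<^sup>*\<close>, which is impossible if \<open>A + BF\<close> is stable. Now write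
  \<open>x\<^sub>k\<^sub>+\<^sub>1 = (A + HC)x\<^sub>k + (B + HD)u\<^sub>k - H y\<^sub>k\<close> with square summable \<open>u\<close> and \<open>y\<close>.\<close>

text \<open>Two obstacles shape the passage to discrete time. States are classes modulo null sets
  and \<open>z\<close> need not be jointly measurable in time and space, so nothing can be read off
  \<open>z\<close> pointwise. Uniqueness is therefore proved for the time-integrated flux
  \<open>w\<close>, which turns out to be jointly continuous, and only then transferred to
  \<open>z\<close> and to the output. The cost depends on this: \<open>cost_J\<close> evaluates an
  output picked by choice, which is identified with the constructed one only once all solutions are
  known to share \<open>w t 1\<close>. Secondly, initial state and input are replaced by Borel
  functions on the whole line, and trajectories are built to satisfy their recursion at every
  \<open>t >= 0\<close>. The discrete identities then hold for every phase \<open>s\<close>, and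
  null sets enter only in comparisons. Since \<open>S\<close> dominates the identity, the cost
  exceeds the candidate minimum by at least the energy of the control error; this one inequality
  yields both optimality and uniqueness. Eigenvalue bounds become decay of powers through an
  annihilating polynomial, whose linear factors are cancelled one by one.\<close>

section \<open>Hermitian inner product and adjoint matrices\<close>

definition cinner :: "complex ^ 'n \<Rightarrow> complex ^ 'n \<Rightarrow> complex" where
  "cinner x y = (\<Sum>i\<in>UNIV. cnj (x $ i) * y $ i)"

lemma cinner_add_left: "cinner (x + y) z = cinner x z + cinner y z"
  and cinner_add_right: "cinner z (x + y) = cinner z x + cinner z y"
  and cinner_diff_left: "cinner (x - y) z = cinner x z - cinner y z"
  and cinner_diff_right: "cinner z (x - y) = cinner z x - cinner z y"
  and cinner_minus_left: "cinner (- x) z = - cinner x z"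
  and cinner_minus_right: "cinner z (- x) = - cinner z x"
  by (auto simp: cinner_def algebra_simps sum.distrib sum_subtractf sum_negf)

lemma cinner_scale_left: "cinner (c *s x) y = cnj c * cinner x y"
  and cinner_scale_right: "cinner x (c *s y) = c * cinner x y"
  by (auto simp: cinner_def sum_distrib_left algebra_simps)

lemma cinner_self: "cinner x x = of_real ((norm x)\<^sup>2)"
proof -
  have "cnj (x $ i) * x $ i = of_real ((norm (x $ i))\<^sup>2)" for i
    by (metis complex_norm_square mult.commute)
  then have "cinner x x = of_real (\<Sum>i\<in>UNIV. (norm (x $ i))\<^sup>2)"
    by (simp add: cinner_def)
  also have "(\<Sum>i\<in>UNIV. (norm (x $ i))\<^sup>2) = (norm x)\<^sup>2"
    by (simp add: norm_vec_def L2_set_def sum_nonneg)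
  finally show ?thesis .
qed

lemma cinner_adj_left: "cinner (adj A *v x) y = cinner x (A *v y)"
  unfolding cinner_def adj_def matrix_vector_mult_def
  by (simp add: sum_distrib_left sum_distrib_right)
     (subst sum.swap, simp add: algebra_simps)

lemma adj_adj [simp]: "adj (adj A) = A"
  by (simp add: adj_def)

lemma adj_add: "adj (A + B) = adj A + adj B"
  by (simp add: adj_def vec_eq_iff)

lemma adj_diff: "adj (A - B) = adj A - adj B"
  by (simp add: adj_def vec_eq_iff)

lemma adj_mult: "adj (A ** B) = adj B ** adj A"
  by (simp add: adj_def vec_eq_iff matrix_matrix_mult_def mult.commute)

lemma adj_mat: "adj (mat c) = mat (cnj c)"
  by (simp add: adj_def vec_eq_iff mat_def)

lemma cinner_adj_right: "cinner x (adj A *v y) = cinner (A *v x) y"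
  by (metis adj_adj cinner_adj_left)

lemma nonneg_selfadjoint_iff:
  "nonneg_selfadjoint A \<longleftrightarrow> adj A = A \<and> (\<forall>x. 0 \<le> Re (cinner x (A *v x)))"
  by (simp add: nonneg_selfadjoint_def cinner_def)

lemma cmat_invertible_iff_injective:
  fixes A :: "complex ^ 'n ^ 'n"
  shows "invertible A \<longleftrightarrow> (\<forall>x. A *v x = 0 \<longrightarrow> x = 0)"
  by (simp add: invertible_left_inverse matrix_left_invertible_ker)

lemma invertible_adjI: "invertible A \<Longrightarrow> invertible (adj A)"
  unfolding invertible_def by (metis adj_mult adj_mat complex_cnj_one)

lemma invertible_adj: "invertible (adj A) \<longleftrightarrow> invertible A"
  using invertible_adjI[of A] invertible_adjI[of "adj A"] by auto

lemma uminus_matrix_vector_mult: "(- A) *v x = - (A *v (x :: complex ^ 'n))"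
  by (simp add: vec_eq_iff matrix_vector_mult_def sum_negf)

lemma matrix_vector_mult_minus: "(A :: complex ^ 'n ^ 'm) *v (- x) = - (A *v x)"
  by (simp add: vec_eq_iff matrix_vector_mult_def sum_negf)

lemma mat_vector_mult: "mat k *v (x :: complex ^ 'n) = k *s x"
  by (simp add: vec_eq_iff matrix_vector_mult_def mat_def if_distrib[of "\<lambda>a. a * b" for b] cong: if_cong)

lemma matrix_inv_mult:
  assumes "invertible A"
  shows "A ** matrix_inv A = mat 1" "matrix_inv A ** A = mat 1"
  using someI_ex[OF assms[unfolded invertible_def]] unfolding matrix_inv_def by auto

subsection \<open>Completion of squares\<close>

locale riccati =
  fixes A :: "complex ^ 'n ^ 'n" and B :: "complex ^ 'p ^ 'n"
    and C :: "complex ^ 'n ^ 'm" and D :: "complex ^ 'p ^ 'm"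
    and X :: "complex ^ 'n ^ 'n"
  assumes nonneg: "nonneg_selfadjoint X" and care: "CARE A B C D X"
begin

text \<open>Expand one step of the cost plus the next value of \<open>V\<close> as a quadratic form
  in state and control: \<open>S\<close> is its control block, \<open>N\<close> its coupling block,
  and \<open>F\<close> gives the minimizing control.\<close>

definition S where "S = mat 1 + adj D ** D + adj B ** X ** B"
definition N where "N = adj D ** C + adj B ** X ** A"
definition F where "F = - (matrix_inv S ** N)"
definition V where "V x = Re (cinner x (X *v x))"

lemma X_adj: "adj X = X" and V_nonneg: "V x \<ge> 0"
  using nonneg by (auto simp: nonneg_selfadjoint_iff V_def)

lemma S_quadratic: "Re (cinner x (S *v x)) = (norm x)\<^sup>2 + (norm (D *v x))\<^sup>2 + V (B *v x)"
proof -
  have "S *v x = x + adj D *v (D *v x) + adj B *v (X *v (B *v x))"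
    by (simp add: S_def matrix_vector_mult_add_rdistrib matrix_vector_mul_assoc matrix_mul_assoc)
  then have "cinner x (S *v x) = cinner x x + cinner (D *v x) (D *v x) + cinner (B *v x) (X *v (B *v x))"
    by (simp add: cinner_add_right cinner_adj_right)
  then show ?thesis by (simp add: cinner_self V_def)
qed

text \<open>The identity summand of \<open>S\<close> stems from the control term of the cost. It
  makes \<open>S\<close> invertible and later turns excess cost into a bound on
  \<open>v - F x\<close>.\<close>

lemma S_lower: "(norm x)\<^sup>2 \<le> Re (cinner x (S *v x))"
  using V_nonneg by (simp add: S_quadratic)

lemma S_invertible: "invertible S"
  unfolding cmat_invertible_iff_injective
proof (intro allI impI)
  fix x assume "S *v x = 0"
  then have "(norm x)\<^sup>2 \<le> 0" using S_lower[of x] by (simp add: cinner_def)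
  then show "x = 0" by simp
qed

lemma S_adj: "adj S = S"
  by (simp add: S_def adj_add adj_mult adj_mat X_adj matrix_mul_assoc)

text \<open>The normal equation of the minimization; in the completion of squares it replaces the
  inverse of \<open>S\<close>.\<close>

lemma S_F: "S *v (F *v x) = - (N *v x)"
proof -
  have "F *v x = - (matrix_inv S *v (N *v x))"
    by (simp add: F_def uminus_matrix_vector_mult matrix_vector_mul_assoc)
  then show ?thesis
    by (simp add: matrix_vector_mult_minus matrix_vector_mul_assoc matrix_mul_assoc
        matrix_inv_mult(1)[OF S_invertible])
qed

lemma adj_N: "adj N = adj C ** D + adj A ** X ** B"
  by (simp add: N_def adj_add adj_mult X_adj matrix_mul_assoc)

text \<open>The Riccati equation applied to a vector, with \<open>matrix_inv S\<close> times
  \<open>N x\<close> recognized as \<open>- F x\<close>.\<close>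

lemma quadratic_state:
  "adj A *v (X *v (A *v x)) + adj C *v (C *v x) = X *v x - adj N *v (F *v x)"
proof -
  have "adj A ** X ** A - X + adj C ** C = adj N ** matrix_inv S ** N"
    using care unfolding CARE_def adj_N unfolding S_def N_def by simp
  then have "adj A ** X ** A + adj C ** C = X + adj N ** matrix_inv S ** N"
    by (simp add: algebra_simps)
  then have "(adj A ** X ** A + adj C ** C) *v x = (X + adj N ** matrix_inv S ** N) *v x"
    by simp
  then have "adj A *v (X *v (A *v x)) + adj C *v (C *v x)
      = X *v x + adj N *v (matrix_inv S *v (N *v x))"
    by (simp add: matrix_vector_mult_add_rdistrib matrix_vector_mul_assoc matrix_mul_assoc)
  moreover have "matrix_inv S *v (N *v x) = - (F *v x)"
    by (simp add: F_def uminus_matrix_vector_mult matrix_vector_mul_assoc)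
  ultimately show ?thesis by (simp add: matrix_vector_mult_minus)
qed

lemma completion_of_squares:
  "V (A *v x + B *v v) + (norm (C *v x + D *v v))\<^sup>2 + (norm v)\<^sup>2
     = V x + Re (cinner (v - F *v x) (S *v (v - F *v x)))"
proof -
  have Sv: "S *v v = v + adj D *v (D *v v) + adj B *v (X *v (B *v v))"
    by (simp add: S_def matrix_vector_mult_add_rdistrib matrix_vector_mul_assoc matrix_mul_assoc)
  have Nx: "N *v x = adj D *v (C *v x) + adj B *v (X *v (A *v x))"
    by (simp add: N_def matrix_vector_mult_add_rdistrib matrix_vector_mul_assoc matrix_mul_assoc)
  have X2: "cinner a (X *v b) = cinner (X *v a) b" for a b
    by (metis X_adj cinner_adj_left)
  have S2: "cinner a (S *v b) = cinner (S *v a) b" for a b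
    by (metis S_adj cinner_adj_left)
  \<comment> \<open>Sorted by degree in \<open>v\<close>: the state part, to which the Riccati
    equation applies, the two cross terms, and the control part.\<close>
  have "cinner (A *v x + B *v v) (X *v (A *v x + B *v v)) + cinner (C *v x + D *v v) (C *v x + D *v v)
      + cinner v v
    = cinner x (adj A *v (X *v (A *v x)) + adj C *v (C *v x))
      + cinner (N *v x) v + cinner v (N *v x) + cinner v (S *v v)"
    by (simp add: Sv Nx cinner_add_left cinner_add_right cinner_adj_left cinner_adj_right
        matrix_vector_right_distrib X2)
  also have "\<dots> = cinner x (X *v x) - cinner (N *v x) (F *v x)
      + cinner (N *v x) v + cinner v (N *v x) + cinner v (S *v v)"
    by (simp add: quadratic_state cinner_diff_right cinner_adj_right)
  \<comment> \<open>By \<open>S_F\<close> and self-adjointness of \<open>S\<close>, the term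
    \<open>- cinner (N *v x) (F *v x)\<close> is \<open>cinner (F *v x) (S *v (F *v x))\<close>, the
    missing corner of the square.\<close>
  also have "\<dots> = cinner x (X *v x) + cinner (v - F *v x) (S *v (v - F *v x))"
  proof -
    have "cinner (F *v x) (S *v v) = - cinner (N *v x) v" "cinner (F *v x) (N *v x) = cinner (N *v x) (F *v x)"
      using S2[of "F *v x" v] S2[of "F *v x" "F *v x"] by (simp_all add: S_F cinner_minus_left cinner_minus_right)
    then show ?thesis
      by (simp add: cinner_diff_left cinner_add_right matrix_vector_mult_diff_distrib S_F)
  qed
  finally have "Re (cinner (A *v x + B *v v) (X *v (A *v x + B *v v))
      + cinner (C *v x + D *v v) (C *v x + D *v v) + cinner v v)
    = Re (cinner x (X *v x) + cinner (v - F *v x) (S *v (v - F *v x)))"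
    by simp
  then show ?thesis by (simp add: V_def cinner_self)
qed

text \<open>Telescopes the one-step identity. The control is arbitrary, so this serves both the
  lower bound and the feedback, for which the last sum vanishes.\<close>

lemma summation:
  assumes "\<And>k. x (Suc k) = A *v x k + B *v v k"
  shows "(\<Sum>k<n. (norm (C *v x k + D *v v k))\<^sup>2 + (norm (v k))\<^sup>2) + V (x n)
    = V (x 0) + (\<Sum>k<n. Re (cinner (v k - F *v x k) (S *v (v k - F *v x k))))"
proof (induction n)
  case (Suc n)
  then show ?case using completion_of_squares[of "x n" "v n"] assms[of n] by simp
qed simp

end

subsection \<open>Matrices with spectrum in the open unit disc\<close>

text \<open>Spectral radius below one without the \<open>Max\<close>, so that finiteness of the
  spectrum is needed only in the link to \<open>spectral_radius\<close>.\<close>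

definition stable_matrix :: "complex ^ 'n ^ 'n \<Rightarrow> bool" where
  "stable_matrix A \<longleftrightarrow> (\<forall>k v. v \<noteq> 0 \<longrightarrow> A *v v = k *s v \<longrightarrow> norm k < 1)"

text \<open>A square matrix and its adjoint are singular together, and the adjoint of
  \<open>A - mat k\<close> is \<open>adj A - mat (cnj k)\<close>; eigenvalues are conjugated and
  keep their modulus.\<close>

lemma stable_matrix_adj:
  fixes A :: "complex ^ 'n ^ 'n"
  assumes "stable_matrix (adj A)"
  shows "stable_matrix A"
  unfolding stable_matrix_def
proof (intro allI impI)
  fix k and v :: "complex ^ 'n"
  assume "v \<noteq> 0" "A *v v = k *s v"
  then have "(A - mat k) *v v = 0"
    by (simp add: matrix_vector_mult_diff_rdistrib mat_vector_mult)
  with \<open>v \<noteq> 0\<close> have "\<not> invertible (A - mat k)"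
    by (auto simp: cmat_invertible_iff_injective)
  then have "\<not> invertible (adj A - mat (cnj k))"
    by (metis invertible_adj adj_diff adj_mat)
  then obtain w where "w \<noteq> 0" "(adj A - mat (cnj k)) *v w = 0"
    by (auto simp: cmat_invertible_iff_injective)
  then have "w \<noteq> 0" "adj A *v w = cnj k *s w"
    by (simp_all add: matrix_vector_mult_diff_rdistrib mat_vector_mult)
  then have "norm (cnj k) < 1"
    using assms unfolding stable_matrix_def by blast
  then show "norm k < 1" by simp
qed

section \<open>Annihilating polynomials and finiteness of the spectrum\<close>

text \<open>The vector p(A) x.\<close>

definition poly_act :: "complex ^ 'n ^ 'n \<Rightarrow> complex poly \<Rightarrow> complex ^ 'n \<Rightarrow> complex ^ 'n" where
  "poly_act A p x = (\<Sum>i\<le>degree p. coeff p i *s (((*v) A ^^ i) x))"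

lemma poly_act_eq:
  assumes "degree p \<le> n"
  shows "poly_act A p x = (\<Sum>i\<le>n. coeff p i *s (((*v) A ^^ i) x))"
  unfolding poly_act_def using assms
  by (intro sum.mono_neutral_left) (auto simp: coeff_eq_0)

lemma matrix_vector_mult_sum: "(A :: complex ^ 'n ^ 'm) *v (\<Sum>i\<in>I. f i) = (\<Sum>i\<in>I. A *v f i)"
  by (induction I rule: infinite_finite_induct) (auto simp: matrix_vector_right_distrib)

text \<open>The coefficients of the product are those of \<open>q\<close> shifted by one place minus
  \<open>c\<close> times those of \<open>q\<close>; the shift pulls out one factor
  \<open>A\<close>.\<close>

lemma poly_act_linear_factor:
  "poly_act A ([:- c, 1:] * q) x = A *v poly_act A q x - c *s poly_act A q x"
proof -
  define n where "n = degree q"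
  have "degree ([:- c, 1:] * q) \<le> Suc n"
    using degree_mult_le[of "[:- c, 1:]" q] by (simp add: n_def)
  then have "poly_act A ([:- c, 1:] * q) x
      = (\<Sum>i\<le>Suc n. coeff (pCons 0 q - smult c q) i *s (((*v) A ^^ i) x))"
    by (subst poly_act_eq[of _ "Suc n"]) (simp_all add: mult_pCons_left algebra_simps)
  also have "\<dots> = (\<Sum>i\<le>Suc n. coeff (pCons 0 q) i *s (((*v) A ^^ i) x))
      - (\<Sum>i\<le>Suc n. (c * coeff q i) *s (((*v) A ^^ i) x))"
    by (simp only: coeff_diff coeff_smult vec.scale_left_diff_distrib sum_subtractf)
  also have "(\<Sum>i\<le>Suc n. coeff (pCons 0 q) i *s (((*v) A ^^ i) x)) = A *v poly_act A q x"
    unfolding poly_act_def n_def[symmetric]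
    by (subst sum.atMost_Suc_shift) (simp add: matrix_vector_mult_sum vector_scalar_commute)
  also have "(\<Sum>i\<le>Suc n. (c * coeff q i) *s (((*v) A ^^ i) x)) = c *s poly_act A q x"
    by (subst poly_act_eq[of q "Suc n"])
      (simp_all add: n_def vec.scale_sum_right vec.scale_scale)
  finally show ?thesis .
qed

lemma poly_act_eigenvector:
  assumes "A *v v = k *s v"
  shows "poly_act A p v = poly p k *s v"
proof -
  have "((*v) A ^^ i) v = k ^ i *s v" for i
    by (induction i) (simp_all add: vector_scalar_commute assms vec.scale_scale mult.commute)
  then show ?thesis
    by (simp add: poly_act_def poly_altdef vec.scale_sum_left vec.scale_scale)
qed

text \<open>A dimension count in the real vector space of matrices: among sufficiently many powers
  of \<open>A\<close> there is a linear relation, so even real coefficients suffice.\<close>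

lemma annihilating_polynomial:
  fixes A :: "complex ^ 'n ^ 'n"
  obtains p where "p \<noteq> 0" "\<And>x. poly_act A p x = 0"
proof -
  define B where "B i = (((**) A) ^^ i) (mat 1)" for i
  have B: "B i *v x = ((*v) A ^^ i) x" for i x
    by (induction i) (auto simp: B_def simp flip: matrix_vector_mul_assoc)
  \<comment> \<open>A set of powers counts a repeated power only once. If two powers coincide, their
    difference is itself the relation; otherwise the cardinality argument applies.\<close>
  have "\<exists>c :: nat \<Rightarrow> real. \<exists>n. (\<exists>i\<le>n. c i \<noteq> 0) \<and> (\<Sum>i\<le>n. c i *\<^sub>R B i) = 0"
  proof (cases "inj B")
    case True
    define n where "n = DIM(complex ^ 'n ^ 'n)"
    have "card (B ` {..n}) > n"
      using True by (subst card_image) (auto intro: inj_on_subset)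
    then have "dependent (B ` {..n})"
      unfolding n_def by (intro dependent_biggerset) simp
    then obtain u where u: "\<exists>v\<in>B ` {..n}. u v \<noteq> 0" "(\<Sum>v\<in>B ` {..n}. u v *\<^sub>R v) = 0"
      by (subst (asm) dependent_finite) auto
    have "(\<Sum>i\<le>n. u (B i) *\<^sub>R B i) = 0"
      using u(2) True by (subst (asm) sum.reindex) (auto intro: inj_on_subset)
    then show ?thesis using u(1) by (intro exI[of _ "\<lambda>i. u (B i)"] exI[of _ n]) auto
  next
    case False
    then obtain i j where ij: "i < j" "B i = B j"
      by (metis injI linorder_neqE_nat)
    have "(\<Sum>k\<le>j. ((if k = j then 1 else 0) - (if k = i then 1 else 0)) *\<^sub>R B k) = B j - B i"
      using ij by (simp add: scaleR_diff_left sum_subtractf if_distrib[of "\<lambda>c. c *\<^sub>R x" for x] cong: if_cong)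
    then show ?thesis using ij
      by (intro exI[of _ "\<lambda>k. (if k = j then 1 else 0) - (if k = i then 1 else 0)"] exI[of _ j]) auto
  qed
  then obtain c :: "nat \<Rightarrow> real" and n where c: "\<exists>i\<le>n. c i \<noteq> 0" "(\<Sum>i\<le>n. c i *\<^sub>R B i) = 0"
    by auto
  define p where "p = (\<Sum>i\<le>n. monom (complex_of_real (c i)) i)"
  have coeff: "coeff p i = (if i \<le> n then of_real (c i) else 0)" for i
    by (simp add: p_def coeff_sum if_distrib cong: if_cong)
  have "p \<noteq> 0" using c(1) coeff by (metis coeff_0 of_real_eq_0_iff)
  moreover have "poly_act A p x = 0" for x
  proof -
    have "degree p \<le> n" by (rule degree_le) (simp add: coeff)
    then have "poly_act A p x = (\<Sum>i\<le>n. of_real (c i) *s (B i *v x))"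
      by (subst poly_act_eq) (auto simp: coeff B intro!: sum.cong)
    also have "\<dots> = (\<Sum>i\<le>n. c i *\<^sub>R B i) *v x"
    proof -
      have "((\<Sum>i\<in>I. c i *\<^sub>R B i) *v x) = (\<Sum>i\<in>I. of_real (c i) *s (B i *v x))" if "finite I" for I
        using that
      proof induction
        case (insert i I)
        have "(c i *\<^sub>R B i) *v x = of_real (c i) *s (B i *v x)"
          by (simp add: vec_eq_iff matrix_vector_mult_def sum_distrib_left scaleR_conv_of_real[where 'a = complex] algebra_simps)
        then show ?case using insert by (simp add: matrix_vector_mult_add_rdistrib)
      qed simp
      then show ?thesis by simp
    qed
    finally show ?thesis using c(2) by simp
  qed
  ultimately show thesis using that by blast
qed

text \<open>On an eigenvector p(A) acts as the scalar p(k), so every eigenvalue is a root of the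
  annihilating polynomial. This is what makes the \<open>Max\<close> in
  \<open>spectral_radius\<close> an upper bound.\<close>

lemma finite_eigenvalues:
  fixes A :: "complex ^ 'n ^ 'n"
  shows "finite {k. \<exists>v. v \<noteq> 0 \<and> A *v v = k *s v}"
proof -
  obtain p where p: "p \<noteq> 0" "\<And>x. poly_act A p x = 0"
    using annihilating_polynomial[of A] by blast
  have "poly p k = 0" if "v \<noteq> 0" "A *v v = k *s v" for k v
    using p(2)[of v] poly_act_eigenvector[OF that(2), of p] that(1) by (simp add: vec.scale_eq_0_iff)
  then have "{k. \<exists>v. v \<noteq> 0 \<and> A *v v = k *s v} \<subseteq> {k. poly p k = 0}"
    by auto
  then show ?thesis using poly_roots_finite[OF p(1)] finite_subset by blast
qed

lemma stable_matrix_if_spectral_radius: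
  assumes "spectral_radius A < 1"
  shows "stable_matrix A"
  unfolding stable_matrix_def
proof (intro allI impI)
  fix k and v assume "v \<noteq> 0" "A *v v = k *s v"
  then have "norm k \<le> spectral_radius A"
    unfolding spectral_radius_def using finite_eigenvalues[of A] by (intro Max_ge) auto
  with assms show "norm k < 1" by simp
qed

lemma contraction_tendsto_zero:
  fixes a s :: "nat \<Rightarrow> real"
  assumes "0 \<le> \<rho>" "\<rho> < 1" "\<And>k. 0 \<le> a k" "\<And>k. a (Suc k) \<le> \<rho> * a k + s k" "s \<longlonglongrightarrow> 0"
  shows "a \<longlonglongrightarrow> 0"
proof (rule LIMSEQ_I)
  fix r :: real assume "r > 0"
  \<comment> \<open>Chosen so that r/2 is the fixed point of
    \<open>a \<mapsto> \<rho> * a + \<delta>\<close>.\<close>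
  define \<delta> where "\<delta> = (1 - \<rho>) * r / 2"
  have "\<delta> > 0" using \<open>r > 0\<close> assms by (simp add: \<delta>_def)
  then obtain K where K: "\<And>k. k \<ge> K \<Longrightarrow> s k < \<delta>"
    using LIMSEQ_D[OF assms(5), of \<delta>] by (auto simp: abs_less_iff)
  have bound: "a (K + j) \<le> \<rho> ^ j * a K + r / 2" for j
  proof (induction j)
    case (Suc j)
    have "a (K + Suc j) \<le> \<rho> * a (K + j) + \<delta>"
      using assms(4)[of "K + j"] K[of "K + j"] by simp
    also have "\<dots> \<le> \<rho> * (\<rho> ^ j * a K + r / 2) + \<delta>"
      using Suc assms(1) by (intro add_right_mono mult_left_mono)
    also have "\<dots> = \<rho> ^ Suc j * a K + r / 2"
      by (simp add: \<delta>_def field_simps)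
    finally show ?case .
  qed (use \<open>r > 0\<close> in simp)
  have "(\<lambda>j. \<rho> ^ j * a K) \<longlonglongrightarrow> 0"
    using assms(1,2) by (intro tendsto_mult_left_zero LIMSEQ_realpow_zero)
  then obtain J where J: "\<And>j. j \<ge> J \<Longrightarrow> \<rho> ^ j * a K < r / 2"
    using order_tendstoD(2)[of _ 0 sequentially "r / 2"] \<open>r > 0\<close>
    unfolding eventually_sequentially by (metis half_gt_zero)
  have "a n < r" if "n \<ge> K + J" for n
  proof -
    have n: "K + (n - K) = n" "n - K \<ge> J" using that by auto
    show ?thesis using bound[of "n - K", unfolded n(1)] J[OF n(2)] by simp
  qed
  then show "\<exists>no. \<forall>n\<ge>no. norm (a n - 0) < r"
    using assms(3) by auto
qed

lemma norm_vector_scale: "norm (c *s (x :: complex ^ 'n)) = norm c * norm x"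
  by (simp add: norm_vec_def norm_mult L2_set_right_distrib)

lemma measurable_matrix_vector_mult [measurable (raw)]:
  assumes "f \<in> borel_measurable M"
  shows "(\<lambda>x. (A :: complex ^ 'n ^ 'm) *v f x) \<in> borel_measurable M"
proof -
  have "(\<lambda>x. A *v x) \<in> borel_measurable borel"
    by (intro borel_measurable_continuous_onI linear_continuous_on matrix_vector_mul_bounded_linear)
  then show ?thesis using assms by (rule measurable_compose[rotated])
qed

lemma tendsto_matrix_vector_mult:
  "(f \<longlongrightarrow> l) G \<Longrightarrow> ((\<lambda>x. (A :: complex ^ 'n ^ 'm) *v f x) \<longlongrightarrow> A *v l) G"
  by (rule bounded_linear.tendsto[OF matrix_vector_mul_bounded_linear])

section \<open>Decay of the powers of a stable matrix\<close>

text \<open>The stable subspace of \<open>A\<close>; the aim is to show that it is the whole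
  space.\<close>

definition decaying :: "complex ^ 'n ^ 'n \<Rightarrow> (complex ^ 'n) set" where
  "decaying A = {x. (\<lambda>k. ((*v) A ^^ k) x) \<longlonglongrightarrow> 0}"

lemma funpow_matrix_linear:
  fixes A :: "complex ^ 'n ^ 'n"
  shows "((*v) A ^^ k) (x + y) = ((*v) A ^^ k) x + ((*v) A ^^ k) y"
    and "((*v) A ^^ k) (c *s x) = c *s ((*v) A ^^ k) x"
    and "((*v) A ^^ k) (x - y) = ((*v) A ^^ k) x - ((*v) A ^^ k) y"
    and "((*v) A ^^ k) (r *\<^sub>R x) = r *\<^sub>R ((*v) A ^^ k) x"
  by (induction k) (auto simp: matrix_vector_right_distrib vector_scalar_commute
      matrix_vector_mult_diff_distrib linear_cmul[OF matrix_vector_mul_linear])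

lemma decaying_scale: "x \<in> decaying A \<Longrightarrow> c *s x \<in> decaying A"
proof -
  assume "x \<in> decaying A"
  then have "(\<lambda>k. mat c *v ((*v) A ^^ k) x) \<longlonglongrightarrow> mat c *v 0"
    unfolding decaying_def by (intro tendsto_matrix_vector_mult) simp
  then show ?thesis by (simp add: decaying_def funpow_matrix_linear mat_vector_mult)
qed

lemma decaying_mult: "x \<in> decaying A \<Longrightarrow> A *v x \<in> decaying A"
proof -
  assume "x \<in> decaying A"
  then have "(\<lambda>k. A *v ((*v) A ^^ k) x) \<longlonglongrightarrow> A *v 0"
    unfolding decaying_def by (intro tendsto_matrix_vector_mult) simp
  then show ?thesis by (simp add: decaying_def funpow_swap1)
qed

lemma subspace_decaying: "subspace (decaying A)"
proof (rule subspaceI)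
  have "((*v) A ^^ k) 0 = 0" for k
    by (induction k) auto
  then show "0 \<in> decaying A" by (simp add: decaying_def)
  show "x + y \<in> decaying A" if "x \<in> decaying A" "y \<in> decaying A" for x y
    using that tendsto_add[of "\<lambda>k. ((*v) A ^^ k) x" 0 _ "\<lambda>k. ((*v) A ^^ k) y" 0]
    by (simp add: decaying_def funpow_matrix_linear)
  show "c *\<^sub>R x \<in> decaying A" if "x \<in> decaying A" for c x
    using that tendsto_scaleR[of "\<lambda>_. c" c _ "\<lambda>k. ((*v) A ^^ k) x" 0]
    by (simp add: decaying_def funpow_matrix_linear)
qed

text \<open>For \<open>norm c \<ge> 1\<close> the map \<open>A - c\<close> is injective, hence bijective on the invariant subspace
  of decaying vectors.\<close>

lemma decaying_cancel_factor:
  assumes "stable_matrix A" and y: "A *v y - c *s y \<in> decaying A"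
  shows "y \<in> decaying A"
proof (cases "norm c < 1")
  case True
  define x where "x k = ((*v) A ^^ k) y" for k
  \<comment> \<open>For \<open>norm c < 1\<close> the orbit of \<open>y\<close> obeys a scalar
    contraction, driven by the decaying orbit of \<open>A *v y - c *s y\<close>.\<close>
  have step: "x (Suc k) = c *s x k + ((*v) A ^^ k) (A *v y - c *s y)" for k
    by (simp add: x_def funpow_matrix_linear funpow_swap1)
  have "(\<lambda>k. norm (x k)) \<longlonglongrightarrow> 0"
  proof (rule contraction_tendsto_zero[where \<rho> = "norm c"])
    show "norm (x (Suc k)) \<le> norm c * norm (x k) + norm (((*v) A ^^ k) (A *v y - c *s y))" for k
      unfolding step using norm_triangle_ineq norm_vector_scale by metis
    show "(\<lambda>k. norm (((*v) A ^^ k) (A *v y - c *s y))) \<longlonglongrightarrow> 0"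
      using y by (simp add: decaying_def tendsto_norm_zero)
  qed (use True in auto)
  then show ?thesis by (simp add: decaying_def x_def tendsto_norm_zero_iff)
next
  case False
  define f where "f x = A *v x - c *s x" for x
  have f_eq: "f = (*v) (A - mat c)"
    by (auto simp: f_def matrix_vector_mult_diff_rdistrib mat_vector_mult)
  have "linear f" unfolding f_eq by simp
  have "inj f"
  proof (subst linear_injective_0[OF \<open>linear f\<close>], intro allI impI)
    fix v assume "f v = 0"
    then have "A *v v = c *s v" by (simp add: f_def)
    then show "v = 0" using assms(1) False unfolding stable_matrix_def by blast
  qed
  have "f ` decaying A \<subseteq> decaying A"
    by (auto simp: f_def intro!: subspace_diff[OF subspace_decaying] decaying_mult decaying_scale)
  moreover have "dim (f ` decaying A) = dim (decaying A)"
    using \<open>linear f\<close> \<open>inj f\<close> by (intro dim_image_eq) (auto intro: inj_on_subset)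
  ultimately have "f ` decaying A = decaying A"
    using subspace_dim_equal[of "f ` decaying A" "decaying A"] subspace_decaying[of A]
      linear_subspace_image[OF \<open>linear f\<close>] by auto
  then obtain y' where "y' \<in> decaying A" "f y' = f y"
    using y by (metis f_def imageE)
  then show ?thesis using \<open>inj f\<close> by (auto dest: injD)
qed

text \<open>Over the complex numbers the polynomial splits, and any linear factor can be cancelled
  whether or not its root is an eigenvalue.\<close>

lemma decaying_if_poly_act:
  assumes "stable_matrix A" "p \<noteq> 0" "poly_act A p x \<in> decaying A"
  shows "x \<in> decaying A"
  using assms(2,3)
proof (induction "degree p" arbitrary: p)
  case 0
  then obtain c where "p = [:c:]" "c \<noteq> 0" by (metis degree_eq_zeroE pCons_0_0)
  then have "c *s x \<in> decaying A" using 0 by (simp add: poly_act_def)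
  from decaying_scale[OF this, of "inverse c"] show ?case
    using \<open>c \<noteq> 0\<close> by (simp add: vec.scale_scale)
next
  case (Suc n)
  have "\<not> constant (poly p)" using Suc.hyps(2) by (simp add: constant_degree)
  then obtain c where "poly p c = 0" using fundamental_theorem_of_algebra by blast
  then obtain q where q: "p = [:- c, 1:] * q" by (metis poly_eq_0_iff_dvd dvdE)
  then have "q \<noteq> 0" using Suc.prems by auto
  then have "degree p = Suc (degree q)" unfolding q by (subst degree_mult_eq) auto
  moreover have "poly_act A q x \<in> decaying A"
    using Suc.prems(2) unfolding q poly_act_linear_factor by (rule decaying_cancel_factor[OF assms(1)])
  ultimately show ?case using Suc.hyps \<open>q \<noteq> 0\<close> by auto
qed

lemma stable_matrix_decaying: "stable_matrix A \<Longrightarrow> x \<in> decaying A"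
  by (metis annihilating_polynomial decaying_if_poly_act subspace_0 subspace_decaying)

text \<open>The adapted norm is \<open>\<Sum>\<^sub>i\<^sub><\<^sub>N 2\<^bsup>i/N\<^esup> \<parallel>A\<^sup>i x\<parallel>\<close> with \<open>N\<close> so large that \<open>A\<^sup>N\<close> halves all norms.\<close>

lemma stable_matrix_adapted_norm:
  fixes A :: "complex ^ 'n ^ 'n"
  assumes "stable_matrix A"
  obtains \<nu> :: "complex ^ 'n \<Rightarrow> real" and \<rho> c where "0 < \<rho>" "\<rho> < 1" "0 < c"
    "\<And>x. norm x \<le> \<nu> x" "\<And>x. \<nu> x \<le> c * norm x" "\<And>x y. \<nu> (x + y) \<le> \<nu> x + \<nu> y"
    "\<And>x. \<nu> (A *v x) \<le> \<rho> * \<nu> x"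
proof -
  define P where "P k = (*v) A ^^ k" for k
  \<comment> \<open>Bounds the operator norm of the power by its values on unit vectors, so that
    pointwise decay becomes uniform decay.\<close>
  define b where "b k = (\<Sum>i\<in>UNIV. norm (P k (axis i 1)))" for k
  have bound: "norm (P k x) \<le> b k * norm x" for k x
  proof -
    have "P k (\<Sum>i\<in>I. x $ i *s axis i 1) = (\<Sum>i\<in>I. x $ i *s P k (axis i 1))" for I
    proof (induction I rule: infinite_finite_induct)
      case (insert i I)
      then show ?case by (simp add: P_def funpow_matrix_linear)
    qed (use funpow_matrix_linear(2)[where c = 0 and x = 0] in \<open>auto simp: P_def\<close>)
    then have "P k x = (\<Sum>i\<in>UNIV. x $ i *s P k (axis i 1))"
      by (metis basis_expansion)
    also have "norm \<dots> \<le> (\<Sum>i\<in>UNIV. norm (x $ i *s P k (axis i 1)))"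
      by (rule norm_sum)
    also have "\<dots> \<le> (\<Sum>i\<in>UNIV. norm x * norm (P k (axis i 1)))"
      by (intro sum_mono) (simp add: norm_vector_scale mult_right_mono Finite_Cartesian_Product.norm_nth_le)
    finally show ?thesis by (simp add: b_def sum_distrib_left mult.commute)
  qed
  have "b \<longlonglongrightarrow> (\<Sum>i\<in>(UNIV :: 'n set). 0)"
    unfolding b_def
    using stable_matrix_decaying[OF assms] by (intro tendsto_sum) (simp add: decaying_def P_def tendsto_norm_zero)
  then obtain N0 where N0: "\<And>k. k \<ge> N0 \<Longrightarrow> \<bar>b k\<bar> < 1 / 2"
    using LIMSEQ_D[of b 0 "1 / 2"] by auto
  \<comment> \<open>\<open>Suc\<close> keeps \<open>N\<close> positive: the root is then meaningful
    and the term \<open>norm x\<close> occurs in \<open>\<nu> x\<close>.\<close>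
  define N where "N = Suc N0"
  have half: "2 * norm (P N x) \<le> norm x" for x
  proof -
    have "norm (P N x) \<le> b N * norm x" by (rule bound)
    also have "\<dots> \<le> 1 / 2 * norm x" using N0[of N] by (intro mult_right_mono) (auto simp: N_def)
    finally show ?thesis by simp
  qed
  define \<sigma> where "\<sigma> = root N 2"
  have \<sigma>: "\<sigma> > 1" "\<sigma> ^ N = 2"
    using real_root_pow_pos[of N 2] by (auto simp: \<sigma>_def N_def)
  define \<nu> where "\<nu> x = (\<Sum>i<N. \<sigma> ^ i * norm (P i x))" for x
  define c where "c = 1 + (\<Sum>i<N. \<sigma> ^ i * b i)"
  have b_nonneg: "b i \<ge> 0" for i by (simp add: b_def sum_nonneg)
  show thesis
  proof (rule that[of "inverse \<sigma>" c \<nu>])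
    show "0 < inverse \<sigma>" "inverse \<sigma> < 1" using \<sigma> by (auto simp: inverse_less_1_iff)
    show "0 < c" unfolding c_def using b_nonneg \<sigma> by (intro add_pos_nonneg sum_nonneg) auto
    fix x y
    show "norm x \<le> \<nu> x"
      unfolding \<nu>_def N_def by (subst sum.lessThan_Suc_shift) (use \<sigma> in \<open>auto simp: P_def intro!: sum_nonneg\<close>)
    have "\<nu> x \<le> (\<Sum>i<N. \<sigma> ^ i * (b i * norm x))"
      unfolding \<nu>_def using bound \<sigma> by (intro sum_mono mult_left_mono) auto
    also have "\<dots> = (c - 1) * norm x"
      by (simp add: c_def sum_distrib_right mult.assoc)
    also have "\<dots> \<le> c * norm x"
      by (simp add: algebra_simps)
    finally show "\<nu> x \<le> c * norm x" .
    show "\<nu> (x + y) \<le> \<nu> x + \<nu> y"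
      unfolding \<nu>_def sum.distrib[symmetric] using \<sigma>
      by (intro sum_mono) (auto simp: P_def funpow_matrix_linear norm_triangle_ineq simp flip: distrib_left)
    \<comment> \<open>Applying \<open>A\<close> shifts the sum by one place: \<open>norm x\<close>
      leaves, and \<open>2 * norm (P N x)\<close>, which is no larger, enters.\<close>
    have "\<sigma> * \<nu> (A *v x) = (\<Sum>i<N. \<sigma> ^ Suc i * norm (P (Suc i) x))"
      by (simp add: \<nu>_def P_def funpow_swap1 sum_distrib_left mult.assoc)
    also have "\<dots> = (\<Sum>i<Suc N. \<sigma> ^ i * norm (P i x)) - norm x"
      by (subst sum.lessThan_Suc_shift) (simp add: P_def)
    also have "\<dots> = \<nu> x + (2 * norm (P N x) - norm x)"
      by (simp add: \<nu>_def \<sigma>)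
    also have "\<dots> \<le> \<nu> x" using half[of x] by simp
    finally show "\<nu> (A *v x) \<le> inverse \<sigma> * \<nu> x"
      using \<sigma> by (simp add: field_simps)
  qed
qed

text \<open>Measured in the adapted norm, the recursion is a scalar contraction with a vanishing
  perturbation.\<close>

lemma stable_matrix_tendsto_zero:
  assumes "stable_matrix A" "\<And>k. x (Suc k) = A *v x k + f k" "f \<longlonglongrightarrow> 0"
  shows "x \<longlonglongrightarrow> 0"
proof -
  obtain \<nu> and \<rho> c where \<nu>: "0 < \<rho>" "\<rho> < 1" "0 < c"
    "\<And>x. norm x \<le> \<nu> x" "\<And>x. \<nu> x \<le> c * norm x" "\<And>x y. \<nu> (x + y) \<le> \<nu> x + \<nu> y"
    "\<And>x. \<nu> (A *v x) \<le> \<rho> * \<nu> x"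
    by (rule stable_matrix_adapted_norm[OF assms(1)]) (rule that)
  have \<nu>_nonneg: "\<nu> y \<ge> 0" for y using \<nu>(4)[of y] norm_ge_zero[of y] by linarith
  have lim: "(\<lambda>k. \<nu> (f k)) \<longlonglongrightarrow> 0"
  proof (rule tendsto_sandwich[of "\<lambda>_. 0"])
    show "(\<lambda>k. c * norm (f k)) \<longlonglongrightarrow> 0"
      using tendsto_mult_right_zero[OF tendsto_norm_zero[OF assms(3)]] .
  qed (use \<nu> \<nu>_nonneg in auto)
  have "(\<lambda>k. \<nu> (x k)) \<longlonglongrightarrow> 0"
  proof (rule contraction_tendsto_zero[where \<rho> = \<rho>])
    show "\<nu> (x (Suc k)) \<le> \<rho> * \<nu> (x k) + \<nu> (f k)" for k
      using \<nu>(6)[of "A *v x k" "f k"] \<nu>(7)[of "x k"] by (simp add: assms(2))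
  qed (use \<nu> \<nu>_nonneg lim in auto)
  then show ?thesis
    by (rule Lim_null_comparison[rotated]) (simp add: \<nu>(4))
qed

subsection \<open>The discrete-time optimal control problem\<close>

locale dual_riccati = riccati A B C D X
  for A :: "complex ^ 'n ^ 'n" and B :: "complex ^ 'p ^ 'n"
    and C :: "complex ^ 'n ^ 'm" and D :: "complex ^ 'p ^ 'm" and X +
  fixes Y :: "complex ^ 'n ^ 'n"
  assumes nonneg_dual: "nonneg_selfadjoint Y" and fare: "FARE A B C D Y"
    and stable: "stable_matrix (A + B ** F)"
begin

sublocale dual: riccati "adj A" "adj C" "adj B" "adj D" Y
  using nonneg_dual fare by unfold_locales (auto simp: CARE_def FARE_def)

definition H where "H = adj dual.F"

lemma output_injection_stable: "stable_matrix (A + H ** C)"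
proof (rule stable_matrix_adj)
  have adj_AH: "adj (A + H ** C) = adj A + adj C ** dual.F"
    by (simp add: H_def adj_add adj_mult)
  have st: "stable_matrix (adj (A + B ** F))"
    by (rule stable_matrix_adj) (simp add: stable)
  show "stable_matrix (adj (A + H ** C))"
    unfolding stable_matrix_def
  proof (intro allI impI, rule ccontr)
    fix k v assume v: "v \<noteq> 0" and eig: "adj (A + H ** C) *v v = k *s v" and "\<not> norm k < 1"
    define \<eta> where "\<eta> = dual.F *v v"
    have kv: "adj A *v v + adj C *v \<eta> = k *s v"
      using eig unfolding adj_AH \<eta>_def by (simp add: matrix_vector_mult_add_rdistrib matrix_vector_mul_assoc)
    \<comment> \<open>With the feedback value as control the completed square of the dual system
      disappears.\<close>
    have "dual.V (k *s v) + (norm (adj B *v v + adj D *v \<eta>))\<^sup>2 + (norm \<eta>)\<^sup>2 = dual.V v"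
      using dual.completion_of_squares[of v \<eta>] unfolding kv by (simp add: \<eta>_def cinner_def)
    moreover have "dual.V (k *s v) = (norm k)\<^sup>2 * dual.V v"
    proof -
      have "cinner (k *s v) (Y *v (k *s v)) = of_real ((norm k)\<^sup>2) * cinner v (Y *v v)"
        by (simp add: vector_scalar_commute cinner_scale_left cinner_scale_right complex_norm_square
            mult_ac del: of_real_power)
      then show ?thesis unfolding dual.V_def by (simp del: of_real_power)
    qed
    \<comment> \<open>Outside the open unit disc the dual value does not drop along the step, which
      leaves no room for the two squares.\<close>
    moreover have "(norm k)\<^sup>2 * dual.V v \<ge> 1 * dual.V v"
      using \<open>\<not> norm k < 1\<close> dual.V_nonneg by (intro mult_right_mono) (auto simp: one_le_power)
    ultimately have "(norm (adj B *v v + adj D *v \<eta>))\<^sup>2 + (norm \<eta>)\<^sup>2 \<le> 0" by simp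
    then have z: "norm (adj B *v v + adj D *v \<eta>) = 0 \<and> norm \<eta> = 0"
      by (simp only: sum_power2_le_zero_iff)
    have "\<eta> = 0" "adj B *v v + adj D *v \<eta> = 0"
      using z[THEN conjunct1] z[THEN conjunct2] by (simp_all only: norm_eq_zero)
    then have "adj A *v v = k *s v" "adj B *v v = 0" using kv by simp_all
    then have "adj (A + B ** F) *v v = k *s v"
      by (simp add: adj_add adj_mult matrix_vector_mult_add_rdistrib flip: matrix_vector_mul_assoc)
    with st v \<open>\<not> norm k < 1\<close> show False unfolding stable_matrix_def by blast
  qed
qed

lemma finite_cost_tendsto_zero:
  assumes "\<And>k. x (Suc k) = A *v x k + B *v v k"
    and "summable (\<lambda>k. (norm (C *v x k + D *v v k))\<^sup>2 + (norm (v k))\<^sup>2)"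
  shows "x \<longlonglongrightarrow> 0"
proof -
  define y where "y k = C *v x k + D *v v k" for k
  have lim: "(\<lambda>k. (norm (y k))\<^sup>2 + (norm (v k))\<^sup>2) \<longlonglongrightarrow> 0"
    using summable_LIMSEQ_zero[OF assms(2)] by (simp add: y_def)
  have "(\<lambda>k. (norm (y k))\<^sup>2) \<longlonglongrightarrow> 0" "(\<lambda>k. (norm (v k))\<^sup>2) \<longlonglongrightarrow> 0"
    by (rule tendsto_sandwich[OF _ _ tendsto_const lim]; simp)+
  then have "y \<longlonglongrightarrow> 0" "v \<longlonglongrightarrow> 0"
    using tendsto_norm_zero_iff by fastforce+
  then have "(\<lambda>k. (B + H ** D) *v v k - H *v y k) \<longlonglongrightarrow> (B + H ** D) *v 0 - H *v 0"
    by (intro tendsto_diff tendsto_matrix_vector_mult)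
  moreover have "x (Suc k) = (A + H ** C) *v x k + ((B + H ** D) *v v k - H *v y k)" for k
    by (simp add: assms(1) y_def matrix_vector_mult_add_rdistrib matrix_vector_right_distrib
        matrix_vector_mul_assoc)
  ultimately show ?thesis
    using stable_matrix_tendsto_zero[OF output_injection_stable, of x] by simp
qed

lemma tendsto_V: "x \<longlonglongrightarrow> 0 \<Longrightarrow> (\<lambda>k. V (x k)) \<longlonglongrightarrow> 0"
proof -
  assume "x \<longlonglongrightarrow> 0"
  then have "(\<lambda>k. Re (\<Sum>i\<in>UNIV. cnj (x k $ i) * (X *v x k) $ i)) \<longlonglongrightarrow> Re (\<Sum>i\<in>UNIV. cnj (0 $ i) * (X *v 0) $ i)"
    by (intro tendsto_intros tendsto_matrix_vector_mult)
  then show ?thesis by (simp add: V_def cinner_def)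
qed

text \<open>For finite cost the terminal value in the telescoped identity tends to zero, and
  \<open>S_lower\<close> turns the penalties into plain squares. In \<open>ennreal\<close> an
  infinite cost is covered trivially.\<close>

lemma cost_lower_bound:
  assumes "\<And>k. x (Suc k) = A *v x k + B *v v k"
  shows "ennreal (V (x 0)) + (\<Sum>k. ennreal ((norm (v k - F *v x k))\<^sup>2))
     \<le> (\<Sum>k. ennreal ((norm (C *v x k + D *v v k))\<^sup>2 + (norm (v k))\<^sup>2))"
    (is "_ \<le> (\<Sum>k. ennreal (?c k))")
proof (cases "(\<Sum>k. ennreal (?c k)) = top")
  case False
  then have c: "summable ?c" by (intro summable_suminf_not_top) auto
  have V0: "(\<lambda>k. V (x k)) \<longlonglongrightarrow> 0"
    by (rule tendsto_V[OF finite_cost_tendsto_zero[OF assms c]])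
  \<comment> \<open>The horizon \<open>m\<close> goes to infinity while \<open>n\<close> stays
    fixed; the penalties between \<open>n\<close> and \<open>m\<close> are discarded.\<close>
  have partial: "V (x 0) + (\<Sum>k<n. (norm (v k - F *v x k))\<^sup>2) \<le> suminf ?c" for n
  proof (rule LIMSEQ_le_const[of "\<lambda>m. (\<Sum>k<m. ?c k) + V (x m)"])
    show "(\<lambda>m. (\<Sum>k<m. ?c k) + V (x m)) \<longlonglongrightarrow> suminf ?c"
      using tendsto_add[OF summable_LIMSEQ[OF c] V0] by simp
    have "V (x 0) + (\<Sum>k<n. (norm (v k - F *v x k))\<^sup>2) \<le> (\<Sum>k<m. ?c k) + V (x m)" if "m \<ge> n" for m
    proof -
      have "(\<Sum>k<n. (norm (v k - F *v x k))\<^sup>2) \<le> (\<Sum>k<m. (norm (v k - F *v x k))\<^sup>2)"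
        using that by (intro sum_mono2) auto
      also have "\<dots> \<le> (\<Sum>k<m. Re (cinner (v k - F *v x k) (S *v (v k - F *v x k))))"
        by (intro sum_mono S_lower)
      finally show ?thesis using summation[of x v m, OF assms] by simp
    qed
    then show "\<exists>N. \<forall>m\<ge>N. V (x 0) + (\<Sum>k<n. (norm (v k - F *v x k))\<^sup>2) \<le> (\<Sum>k<m. ?c k) + V (x m)"
      by blast
  qed
  have e: "summable (\<lambda>k. (norm (v k - F *v x k))\<^sup>2)"
    using partial by (intro summableI_nonneg_bounded[of _ "suminf ?c - V (x 0)"]) (auto simp: algebra_simps)
  have "V (x 0) + (\<Sum>k. (norm (v k - F *v x k))\<^sup>2) \<le> suminf ?c"
  proof (rule LIMSEQ_le_const2[of "\<lambda>n. V (x 0) + (\<Sum>k<n. (norm (v k - F *v x k))\<^sup>2)"])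
    show "(\<lambda>n. V (x 0) + (\<Sum>k<n. (norm (v k - F *v x k))\<^sup>2))
        \<longlonglongrightarrow> V (x 0) + (\<Sum>k. (norm (v k - F *v x k))\<^sup>2)"
      by (intro tendsto_add tendsto_const summable_LIMSEQ e)
  qed (use partial in auto)
  then show ?thesis
    using c e V_nonneg[of "x 0"]
    by (simp add: suminf_ennreal2 suminf_nonneg flip: ennreal_plus)
next
  case True
  show ?thesis unfolding True by (rule top_greatest)
qed

text \<open>The penalties vanish, and so does the terminal value in the limit because
  \<open>A + B ** F\<close> is stable: the lower bound is attained.\<close>

lemma cost_of_feedback:
  assumes "\<And>k. x (Suc k) = (A + B ** F) *v x k"
  shows "(\<Sum>k. ennreal ((norm (C *v x k + D *v (F *v x k)))\<^sup>2 + (norm (F *v x k))\<^sup>2)) = ennreal (V (x 0))"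
    (is "(\<Sum>k. ennreal (?c k)) = _")
proof -
  have "x \<longlonglongrightarrow> 0"
    using stable_matrix_tendsto_zero[OF stable, of x "\<lambda>_. 0"] assms by simp
  then have "(\<lambda>n. V (x 0) - V (x n)) \<longlonglongrightarrow> V (x 0) - 0"
    by (intro tendsto_diff tendsto_const tendsto_V)
  moreover have "x (Suc k) = A *v x k + B *v (F *v x k)" for k
    using assms by (simp add: matrix_vector_mult_add_rdistrib matrix_vector_mul_assoc)
  from summation[of x "\<lambda>k. F *v x k", OF this]
  have "(\<Sum>k<n. ?c k) = V (x 0) - V (x n)" for n by (simp add: cinner_def algebra_simps)
  ultimately have "?c sums V (x 0)" by (simp add: sums_def)
  then show ?thesis by (intro suminf_ennreal_eq) auto
qed

end

subsection \<open>Square integrable functions\<close>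

text \<open>Borel functions stay measurable under the shifts, reflections and changes of variable
  used below, which is why Lebesgue measurable data are replaced at the outset.\<close>

lemma borel_representative:
  fixes f :: "real \<Rightarrow> 'a::euclidean_space"
  assumes "f \<in> borel_measurable (lebesgue_on S)" "S \<in> sets borel"
  obtains g where "g \<in> borel_measurable borel" "AE x in lborel. x \<in> S \<longrightarrow> f x = g x"
proof -
  define h where "h x = (if x \<in> S then f x else 0)" for x
  have h: "h \<in> borel_measurable lebesgue"
    unfolding h_def using assms by (simp add: borel_measurable_if)
  \<comment> \<open>Real-valued representatives exist for each coordinate; the finitely many null
    sets are then united.\<close>
  have "\<forall>b. \<exists>g\<in>borel_measurable lborel. AE x in lborel. h x \<bullet> b = g x"
    using h by (intro allI completion_ex_borel_measurable_real) simp
  then obtain g where g: "\<And>b. g b \<in> borel_measurable lborel" "\<And>b. AE x in lborel. h x \<bullet> b = g b x"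
    by metis
  show thesis
  proof (rule that)
    show "(\<lambda>x. \<Sum>b\<in>Basis. g b x *\<^sub>R b) \<in> borel_measurable borel"
      using g(1) by (intro borel_measurable_sum borel_measurable_scaleR) auto
    have "AE x in lborel. \<forall>b\<in>Basis. h x \<bullet> b = g b x"
      using g(2) by (intro AE_finite_allI) auto
    then show "AE x in lborel. x \<in> S \<longrightarrow> f x = (\<Sum>b\<in>Basis. g b x *\<^sub>R b)"
    proof eventually_elim
      case (elim x)
      have "(\<Sum>b\<in>Basis. g b x *\<^sub>R b) = (\<Sum>b\<in>Basis. (h x \<bullet> b) *\<^sub>R b)"
        using elim by (intro sum.cong) auto
      then show ?case by (simp add: euclidean_representation h_def)
    qed
  qed
qed

lemma AE_lebesgue_on_iff:
  fixes S :: "real set"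
  assumes "S \<in> sets borel"
  shows "(AE x in lebesgue_on S. P x) \<longleftrightarrow> (AE x in lborel. x \<in> S \<longrightarrow> P x)"
  using assms by (subst AE_restrict_space_iff) (auto simp: AE_completion_iff)

lemma nn_integral_lebesgue_on:
  fixes S :: "real set"
  assumes "S \<in> sets borel"
  shows "(\<integral>\<^sup>+x. f x \<partial>lebesgue_on S) = (\<integral>\<^sup>+x\<in>S. f x \<partial>lborel)"
  using assms by (subst nn_integral_restrict_space) (auto simp: nn_integral_completion)

lemma borel_measurable_lebesgue_onI:
  assumes "f \<in> borel_measurable borel"
  shows "f \<in> borel_measurable (lebesgue_on S)"
  using assms by (intro measurable_restrict_space1 measurable_completion) simp

lemma power2_norm_add_le: "(norm (x + y))\<^sup>2 \<le> 2 * (norm x)\<^sup>2 + 2 * (norm (y::'a::real_normed_vector))\<^sup>2"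
proof -
  have "(norm (x + y))\<^sup>2 \<le> (norm x + norm y)\<^sup>2"
    by (intro power_mono norm_triangle_ineq) simp
  also have "\<dots> \<le> 2 * (norm x)\<^sup>2 + 2 * (norm y)\<^sup>2"
    using sum_squares_bound[of "norm x" "norm y"] by (simp add: power2_sum)
  finally show ?thesis .
qed

lemma L2_onD:
  assumes "f \<in> L2_on S"
  shows "f \<in> borel_measurable (lebesgue_on S)" "integrable (lebesgue_on S) (\<lambda>x. (norm (f x))\<^sup>2)"
  using assms by (auto simp: L2_on_def)

lemma L2_on_scaleR: "f \<in> L2_on S \<Longrightarrow> (\<lambda>x. c *\<^sub>R f x) \<in> L2_on S"
  by (auto simp: L2_on_def power_mult_distrib)

lemma L2_on_bounded_linear:
  assumes "bounded_linear h" "f \<in> L2_on S"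
  shows "(\<lambda>x. h (f x)) \<in> L2_on S"
proof -
  obtain K where K: "\<And>x. norm (h x) \<le> K * norm x" "K \<ge> 0"
    using bounded_linear.nonneg_bounded[OF assms(1)] by (metis mult.commute)
  have [measurable]: "f \<in> borel_measurable (lebesgue_on S)" "h \<in> borel_measurable borel"
    using assms by (auto simp: L2_on_def intro: borel_measurable_continuous_onI linear_continuous_on)
  have "integrable (lebesgue_on S) (\<lambda>x. (norm (h (f x)))\<^sup>2)"
  proof (rule Bochner_Integration.integrable_bound)
    show "integrable (lebesgue_on S) (\<lambda>x. K\<^sup>2 * (norm (f x))\<^sup>2)"
      using assms(2) by (simp add: L2_on_def)
    show "AE x in lebesgue_on S. norm ((norm (h (f x)))\<^sup>2) \<le> norm (K\<^sup>2 * (norm (f x))\<^sup>2)"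
      using K by (auto simp flip: power_mult_distrib intro!: power_mono)
  qed measurable
  then show ?thesis by (simp add: L2_on_def)
qed

lemma L2_on_add:
  assumes "f \<in> L2_on S" "g \<in> L2_on S"
  shows "(\<lambda>x. f x + g x) \<in> L2_on S"
proof -
  have [measurable]: "f \<in> borel_measurable (lebesgue_on S)" "g \<in> borel_measurable (lebesgue_on S)"
    using assms by (auto simp: L2_on_def)
  have "integrable (lebesgue_on S) (\<lambda>x. (norm (f x + g x))\<^sup>2)"
  proof (rule Bochner_Integration.integrable_bound)
    show "integrable (lebesgue_on S) (\<lambda>x. 2 * (norm (f x))\<^sup>2 + 2 * (norm (g x))\<^sup>2)"
      using assms by (simp add: L2_on_def)
    show "AE x in lebesgue_on S. norm ((norm (f x + g x))\<^sup>2) \<le> norm (2 * (norm (f x))\<^sup>2 + 2 * (norm (g x))\<^sup>2)"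
      using power2_norm_add_le by auto
  qed measurable
  then show ?thesis by (simp add: L2_on_def)
qed

lemma L2_on_minus: "f \<in> L2_on S \<Longrightarrow> (\<lambda>x. - f x) \<in> L2_on S"
  using L2_on_scaleR[of f S "-1"] by simp

lemma L2_on_diff: "f \<in> L2_on S \<Longrightarrow> g \<in> L2_on S \<Longrightarrow> (\<lambda>x. f x - g x) \<in> L2_on S"
  using L2_on_add[OF _ L2_on_minus, of f S g] by simp

lemma L2_on_zero: "(\<lambda>x. 0) \<in> L2_on S"
  by (simp add: L2_on_def)

lemma L2_on_sum: "(\<And>i. i \<in> I \<Longrightarrow> f i \<in> L2_on S) \<Longrightarrow> (\<lambda>x. \<Sum>i\<in>I. f i x) \<in> L2_on S"
  by (induction I rule: infinite_finite_induct) (auto intro: L2_on_add L2_on_zero)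

lemma L2_on_cong_AE:
  assumes "f \<in> L2_on S" "AE x in lebesgue_on S. f x = g x" "g \<in> borel_measurable (lebesgue_on S)"
  shows "g \<in> L2_on S"
proof -
  have "integrable (lebesgue_on S) (\<lambda>x. (norm (f x))\<^sup>2) \<longleftrightarrow> integrable (lebesgue_on S) (\<lambda>x. (norm (g x))\<^sup>2)"
    using assms by (intro integrable_cong_AE) (auto simp: L2_on_def)
  then show ?thesis using assms by (simp add: L2_on_def)
qed

lemma L2_on_subset:
  assumes "f \<in> L2_on S" "T \<subseteq> S" "T \<in> sets borel" "S \<in> sets borel"
  shows "f \<in> L2_on T"
proof -
  have "set_integrable lebesgue S (\<lambda>x. (norm (f x))\<^sup>2)"
    using assms L2_onD(2)[OF assms(1)] by (simp add: set_integrable_def integrable_restrict_space)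
  then have "set_integrable lebesgue T (\<lambda>x. (norm (f x))\<^sup>2)"
    by (rule set_integrable_subset) (use assms in auto)
  moreover have "f \<in> borel_measurable (lebesgue_on T)"
    using L2_onD(1)[OF assms(1)] assms(2) by (rule measurable_restrict_mono)
  ultimately show ?thesis
    using assms by (simp add: L2_on_def set_integrable_def integrable_restrict_space)
qed

text \<open>Squared norms in the extended reals, which can be compared before finiteness is
  known.\<close>

abbreviation energy :: "real set \<Rightarrow> (real \<Rightarrow> 'a::real_normed_vector) \<Rightarrow> ennreal" where
  "energy S f \<equiv> \<integral>\<^sup>+x\<in>S. ennreal ((norm (f x))\<^sup>2) \<partial>lborel"

abbreviation total_energy :: "(real \<Rightarrow> 'a::real_normed_vector) \<Rightarrow> ennreal" where
  "total_energy f \<equiv> \<integral>\<^sup>+x. ennreal ((norm (f x))\<^sup>2) \<partial>lborel"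

lemma L2_on_borel_iff:
  fixes S :: "real set"
  assumes "f \<in> borel_measurable borel" "S \<in> sets borel"
  shows "f \<in> L2_on S \<longleftrightarrow> (\<integral>\<^sup>+x\<in>S. ennreal ((norm (f x))\<^sup>2) \<partial>lborel) < \<infinity>"
proof -
  have m: "f \<in> borel_measurable (lebesgue_on S)"
    using assms(1) by (rule borel_measurable_lebesgue_onI)
  then have m2: "(\<lambda>x. (norm (f x))\<^sup>2) \<in> borel_measurable (lebesgue_on S)" by simp
  then show ?thesis
    using m unfolding L2_on_def
    by (simp add: integrable_iff_bounded nn_integral_lebesgue_on[OF assms(2)])
qed

lemma L2_norm_on_borel:
  fixes S :: "real set"
  assumes "f \<in> borel_measurable borel" "S \<in> sets borel"
  shows "L2_norm_on S f = sqrt (enn2real (\<integral>\<^sup>+x\<in>S. ennreal ((norm (f x))\<^sup>2) \<partial>lborel))"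
proof -
  have "(\<lambda>x. (norm (f x))\<^sup>2) \<in> borel_measurable (lebesgue_on S)"
    using borel_measurable_lebesgue_onI[OF assms(1), of S] by simp
  then show ?thesis
    unfolding L2_norm_on_def
    by (subst integral_eq_nn_integral) (auto simp: nn_integral_lebesgue_on[OF assms(2)])
qed

lemma L2_norm_on_borel_le:
  fixes S :: "real set"
  assumes "f \<in> borel_measurable borel" "S \<in> sets borel" "c \<ge> 0"
    "(\<integral>\<^sup>+x\<in>S. ennreal ((norm (f x))\<^sup>2) \<partial>lborel) \<le> ennreal (c\<^sup>2)"
  shows "L2_norm_on S f \<le> c"
proof -
  have "enn2real (\<integral>\<^sup>+x\<in>S. ennreal ((norm (f x))\<^sup>2) \<partial>lborel) \<le> c\<^sup>2"
    using assms(4) enn2real_leI by auto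
  then show ?thesis
    using assms by (simp add: L2_norm_on_borel real_le_lsqrt)
qed

lemma L2_norm_on_nonneg [simp]: "0 \<le> L2_norm_on S f"
  by (simp add: L2_norm_on_def)

lemma L2_norm_on_power2: "(L2_norm_on S f)\<^sup>2 = (LINT x|lebesgue_on S. (norm (f x))\<^sup>2)"
  by (simp add: L2_norm_on_def)

lemma L2_norm_on_cong_AE:
  assumes "f \<in> borel_measurable (lebesgue_on S)" "g \<in> borel_measurable (lebesgue_on S)"
    "AE x in lebesgue_on S. norm (f x) = norm (g x)"
  shows "L2_norm_on S f = L2_norm_on S g"
proof -
  have "(LINT x|lebesgue_on S. (norm (f x))\<^sup>2) = (LINT x|lebesgue_on S. (norm (g x))\<^sup>2)"
    using assms by (intro integral_cong_AE) auto
  then show ?thesis by (simp add: L2_norm_on_def)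
qed

lemma nn_integral_L2_norm_on:
  assumes "f \<in> L2_on S"
  shows "(\<integral>\<^sup>+x. ennreal ((norm (f x))\<^sup>2) \<partial>lebesgue_on S) = ennreal ((L2_norm_on S f)\<^sup>2)"
  unfolding L2_norm_on_power2 using L2_onD(2)[OF assms] by (intro nn_integral_eq_integral) auto

section \<open>Cauchy-Schwarz and triangle inequality for square integrable functions\<close>

lemma L2_Cauchy_Schwarz:
  assumes "f \<in> L2_on S" "g \<in> L2_on S"
  shows "integrable (lebesgue_on S) (\<lambda>x. norm (f x) * norm (g x))"
    and "(LINT x|lebesgue_on S. norm (f x) * norm (g x)) \<le> L2_norm_on S f * L2_norm_on S g"
proof -
  have [measurable]: "f \<in> borel_measurable (lebesgue_on S)" "g \<in> borel_measurable (lebesgue_on S)"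
    using assms by (auto simp: L2_on_def)
  have "norm (norm (f x) * norm (g x)) \<le> norm ((norm (f x))\<^sup>2 + (norm (g x))\<^sup>2)" for x
  proof -
    have "2 * (norm (f x) * norm (g x)) \<le> (norm (f x))\<^sup>2 + (norm (g x))\<^sup>2"
      using sum_squares_bound[of "norm (f x)" "norm (g x)"] by simp
    moreover have "0 \<le> norm (f x) * norm (g x)" by simp
    ultimately show ?thesis by (simp del: zero_le_mult_iff mult_nonneg_nonneg)
  qed
  then show int: "integrable (lebesgue_on S) (\<lambda>x. norm (f x) * norm (g x))"
    by (intro Bochner_Integration.integrable_bound[OF Bochner_Integration.integrable_add
          [OF L2_onD(2)[OF assms(1)] L2_onD(2)[OF assms(2)]]] AE_I2) measurable
  have "(\<integral>\<^sup>+x. ennreal (norm (f x)) * ennreal (norm (g x)) \<partial>lebesgue_on S)\<^sup>2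
      \<le> (\<integral>\<^sup>+x. (ennreal (norm (f x)))\<^sup>2 \<partial>lebesgue_on S) * (\<integral>\<^sup>+x. (ennreal (norm (g x)))\<^sup>2 \<partial>lebesgue_on S)"
    by (rule Cauchy_Schwarz_nn_integral) auto
  moreover have "(\<integral>\<^sup>+x. ennreal (norm (f x)) * ennreal (norm (g x)) \<partial>lebesgue_on S)
      = ennreal (LINT x|lebesgue_on S. norm (f x) * norm (g x))"
    by (subst nn_integral_eq_integral[OF int, symmetric]) (simp_all add: ennreal_mult)
  ultimately have "ennreal ((LINT x|lebesgue_on S. norm (f x) * norm (g x))\<^sup>2)
      \<le> ennreal ((L2_norm_on S f)\<^sup>2 * (L2_norm_on S g)\<^sup>2)"
    using assms by (simp add: ennreal_power ennreal_mult nn_integral_L2_norm_on)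
  then have "(LINT x|lebesgue_on S. norm (f x) * norm (g x))\<^sup>2 \<le> (L2_norm_on S f * L2_norm_on S g)\<^sup>2"
    by (simp add: power_mult_distrib ennreal_le_iff)
  then show "(LINT x|lebesgue_on S. norm (f x) * norm (g x)) \<le> L2_norm_on S f * L2_norm_on S g"
    by (rule power2_le_imp_le) simp
qed

lemma L2_norm_on_triangle:
  assumes "f \<in> L2_on S" "g \<in> L2_on S"
  shows "L2_norm_on S (\<lambda>x. f x + g x) \<le> L2_norm_on S f + L2_norm_on S g"
proof (rule power2_le_imp_le)
  have "(L2_norm_on S (\<lambda>x. f x + g x))\<^sup>2
     \<le> (LINT x|lebesgue_on S. (norm (f x))\<^sup>2 + (2 * (norm (f x) * norm (g x)) + (norm (g x))\<^sup>2))"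
    unfolding L2_norm_on_power2
  proof (rule integral_mono)
    show "integrable (lebesgue_on S) (\<lambda>x. (norm (f x))\<^sup>2 + (2 * (norm (f x) * norm (g x)) + (norm (g x))\<^sup>2))"
      using assms L2_Cauchy_Schwarz(1)[OF assms] by (simp add: L2_on_def)
    show "(norm (f x + g x))\<^sup>2 \<le> (norm (f x))\<^sup>2 + (2 * (norm (f x) * norm (g x)) + (norm (g x))\<^sup>2)" for x
      using power_mono[OF norm_triangle_ineq[of "f x" "g x"], of 2] by (simp add: power2_sum algebra_simps)
  qed (use L2_onD(2)[OF L2_on_add[OF assms]] in simp)
  also have "\<dots> = (L2_norm_on S f)\<^sup>2 + (2 * (LINT x|lebesgue_on S. norm (f x) * norm (g x)) + (L2_norm_on S g)\<^sup>2)"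
    using assms L2_Cauchy_Schwarz(1)[OF assms] by (simp add: L2_norm_on_power2 L2_on_def)
  also have "\<dots> \<le> (L2_norm_on S f + L2_norm_on S g)\<^sup>2"
    using L2_Cauchy_Schwarz(2)[OF assms] by (simp add: power2_sum)
  finally show "(L2_norm_on S (\<lambda>x. f x + g x))\<^sup>2 \<le> (L2_norm_on S f + L2_norm_on S g)\<^sup>2" .
qed simp

lemma L2_norm_on_sum_le:
  assumes "\<And>i. i \<in> I \<Longrightarrow> f i \<in> L2_on S"
  shows "L2_norm_on S (\<lambda>x. \<Sum>i\<in>I. f i x) \<le> (\<Sum>i\<in>I. L2_norm_on S (f i))"
  using assms
proof (induction I rule: infinite_finite_induct)
  case (insert i I)
  then have "L2_norm_on S (\<lambda>x. f i x + (\<Sum>i\<in>I. f i x)) \<le> L2_norm_on S (f i) + L2_norm_on S (\<lambda>x. \<Sum>i\<in>I. f i x)"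
    by (intro L2_norm_on_triangle L2_on_sum) auto
  then show ?case using insert by simp
qed (auto simp: L2_norm_on_def)

text \<open>Cauchy-Schwarz against the constant function 1.\<close>

lemma L2_on_integrable:
  assumes "f \<in> L2_on {a..b}"
  shows "integrable (lebesgue_on {a..b}) f"
    and "norm (integral {a..b} f) \<le> sqrt (b - a) * L2_norm_on {a..b} f"
proof -
  define one :: "real \<Rightarrow> real" where "one = (\<lambda>_. 1)"
  have fin: "integrable (lebesgue_on {a..b}) (\<lambda>x. c)" for c :: real
    by (simp add: integrable_restrict_space)
  have one: "one \<in> L2_on {a..b}" "L2_norm_on {a..b} one = sqrt (measure (lebesgue_on {a..b}) {a..b})"
    using fin by (auto simp: L2_on_def one_def L2_norm_on_def)
  have norm_int: "integrable (lebesgue_on {a..b}) (\<lambda>x. norm (f x))"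
    using L2_Cauchy_Schwarz(1)[OF assms one(1)] by (simp add: one_def)
  then show int: "integrable (lebesgue_on {a..b}) f"
    using assms by (simp add: integrable_norm_iff L2_on_def)
  show "norm (integral {a..b} f) \<le> sqrt (b - a) * L2_norm_on {a..b} f"
  proof (cases "a \<le> b")
    case True
    have "integral {a..b} f = (LINT x|lebesgue_on {a..b}. f x)"
      using int by (subst lebesgue_integral_eq_integral) auto
    also have "norm \<dots> \<le> (LINT x|lebesgue_on {a..b}. norm (f x))"
      by (rule integral_norm_bound)
    also have "\<dots> \<le> L2_norm_on {a..b} f * L2_norm_on {a..b} one"
      using L2_Cauchy_Schwarz(2)[OF assms one(1)] by (simp add: one_def)
    also have "L2_norm_on {a..b} one = sqrt (b - a)"
      using True by (simp add: one(2) measure_restrict_space)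
    finally show ?thesis by (simp add: mult.commute)
  next
    case False
    \<comment> \<open>On an empty interval both the integral and the norm vanish, whatever
      \<open>sqrt (b - a)\<close> is.\<close>
    then have "{a..b} = {}" by simp
    then show ?thesis by (simp add: L2_norm_on_def integral_restrict_space)
  qed
qed

text \<open>The bound refers to the whole interval \<open>{a..b}\<close> and is thus uniform in the
  subinterval.\<close>

lemma L2_on_integrable_on:
  assumes "f \<in> L2_on {a..b}" "a \<le> c" "d \<le> b"
  shows "f integrable_on {c..d}" "f absolutely_integrable_on {c..d}"
    "norm (integral {c..d} f) \<le> sqrt (b - a) * L2_norm_on {a..b} f"
proof -
  have "f \<in> L2_on {c..d}"
    by (rule L2_on_subset[OF assms(1)]) (use assms in auto)
  note cd = L2_on_integrable[OF this]
  show "f integrable_on {c..d}"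
    using cd(1) by (rule integrable_on_lebesgue_on) simp
  show "f absolutely_integrable_on {c..d}"
    using cd(1) by (simp add: absolutely_integrable_on_def set_integrable_def integrable_restrict_space)
  show "norm (integral {c..d} f) \<le> sqrt (b - a) * L2_norm_on {a..b} f"
  proof (cases "c \<le> d")
    case True
    have "L2_norm_on {c..d} f \<le> L2_norm_on {a..b} f"
      unfolding L2_norm_on_def
    proof (rule real_sqrt_le_mono)
      have "(LINT x|lebesgue_on {c..d}. (norm (f x))\<^sup>2) = (LINT x:{c..d}|lebesgue. (norm (f x))\<^sup>2)"
        by (simp add: integral_restrict_space set_lebesgue_integral_def)
      also have "\<dots> \<le> (LINT x:{a..b}|lebesgue. (norm (f x))\<^sup>2)"
        using L2_onD(2)[OF assms(1)] L2_onD(2)[OF \<open>f \<in> L2_on {c..d}\<close>] assms(2,3)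
        unfolding set_lebesgue_integral_def
        by (intro integral_mono) (auto simp: integrable_restrict_space indicator_def)
      also have "\<dots> = (LINT x|lebesgue_on {a..b}. (norm (f x))\<^sup>2)"
        by (simp add: integral_restrict_space set_lebesgue_integral_def)
      finally show "(LINT x|lebesgue_on {c..d}. (norm (f x))\<^sup>2) \<le> (LINT x|lebesgue_on {a..b}. (norm (f x))\<^sup>2)" .
    qed
    moreover have "sqrt (d - c) \<le> sqrt (b - a)" using assms by simp
    ultimately have "sqrt (d - c) * L2_norm_on {c..d} f \<le> sqrt (b - a) * L2_norm_on {a..b} f"
      using True by (intro mult_mono) auto
    with cd(2) show ?thesis by linarith
  next
    case False
    then have "{c..d} = {}" by simp
    then show ?thesis
    proof (cases "a \<le> b")
      case False
      then have "{a..b} = {}" by simp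
      with \<open>{c..d} = {}\<close> show ?thesis by (simp add: L2_norm_on_def integral_restrict_space)
    qed simp
  qed
qed

section \<open>Differentiation of integrals and equality almost everywhere\<close>

lemma AE_lborel_not_in_negligible:
  fixes N :: "real set"
  assumes "negligible N"
  shows "AE x in lborel. x \<notin> N"
proof -
  have "AE x in lebesgue. x \<notin> N"
    using assms by (intro AE_not_in) (simp add: negligible_iff_null_sets)
  then show ?thesis by (simp add: AE_completion_iff)
qed

text \<open>Lebesgue differentiation in two-sided form: right difference quotients are controlled
  through \<open>f\<close>, left ones through its reflection \<open>f'\<close>, whose exceptional
  null set is pulled back under negation.\<close>

lemma AE_has_vector_derivative_integral:
  fixes f :: "real \<Rightarrow> 'a::euclidean_space"
  assumes f: "\<And>a b. f integrable_on {a..b}"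
  shows "AE x in lborel. a < x \<longrightarrow> ((\<lambda>t. integral {a..t} f) has_vector_derivative f x) (at x)"
proof -
  obtain N where N: "negligible N"
    "\<And>x e. x \<notin> N \<Longrightarrow> 0 < e \<Longrightarrow> \<exists>d>0. \<forall>h. 0 < h \<and> h < d \<longrightarrow> norm (integral {x..x + h} f /\<^sub>R h - f x) < e"
    using integrable_ccontinuous_explicit[of f] f by auto
  define f' where "f' = (\<lambda>x. f (- x))"
  have f': "f' integrable_on {a..b}" for a b
    using f[of "- b" "- a"] Henstock_Kurzweil_Integration.integrable_reflect_real[where f = f and a = "- b" and b = "- a"] by (simp add: f'_def)
  obtain N' where N': "negligible N'"
    "\<And>x e. x \<notin> N' \<Longrightarrow> 0 < e \<Longrightarrow> \<exists>d>0. \<forall>h. 0 < h \<and> h < d \<longrightarrow> norm (integral {x..x + h} f' /\<^sub>R h - f' x) < e"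
    using integrable_ccontinuous_explicit[of f'] f' by auto
  have "AE x in distr lborel borel uminus. x \<notin> N'"
    unfolding lborel_distr_uminus by (rule AE_lborel_not_in_negligible[OF N'(1)])
  then have null': "AE x in lborel. - x \<notin> N'"
    by (rule AE_distrD[rotated]) simp
  have "((\<lambda>t. integral {a..t} f) has_vector_derivative f x) (at x)"
    if x: "x \<notin> N" and "- x \<notin> N'" and "a < x" for x
  proof -
    have "((\<lambda>y. (integral {a..y} f - integral {a..x} f) /\<^sub>R (y - x)) \<longlongrightarrow> f x) (at x)"
      unfolding LIM_eq
    proof (intro allI impI)
      fix e :: real assume "0 < e"
      obtain d1 where d1: "d1 > 0" "\<And>h. 0 < h \<Longrightarrow> h < d1 \<Longrightarrow> norm (integral {x..x + h} f /\<^sub>R h - f x) < e"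
        using N(2)[of x e] x \<open>0 < e\<close> by auto
      obtain d2 where d2: "d2 > 0" "\<And>h. 0 < h \<Longrightarrow> h < d2 \<Longrightarrow> norm (integral {- x..- x + h} f' /\<^sub>R h - f' (- x)) < e"
        using N'(2)[of "- x" e] \<open>- x \<notin> N'\<close> \<open>0 < e\<close> by auto
      \<comment> \<open>The bound \<open>x - a\<close> keeps \<open>y\<close> in the range where
        \<open>integral {a..y} f\<close> is additive.\<close>
      define d where "d = min (x - a) (min d1 d2)"
      have "norm ((integral {a..y} f - integral {a..x} f) /\<^sub>R (y - x) - f x) < e"
        if "y \<noteq> x" "norm (y - x) < d" for y
      proof (cases "y > x")
        case True
        have "integral {a..x} f + integral {x..y} f = integral {a..y} f"
          using True \<open>a < x\<close> f by (intro Henstock_Kurzweil_Integration.integral_combine) auto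
        then have "integral {a..y} f - integral {a..x} f = integral {x..x + (y - x)} f"
          by (simp add: algebra_simps)
        then show ?thesis using d1(2)[of "y - x"] True that by (simp add: d_def)
      next
        case False
        then have "y < x" using that by simp
        have "a \<le> y" using that \<open>y < x\<close> by (simp add: d_def)
        have "integral {a..y} f + integral {y..x} f = integral {a..x} f"
          using \<open>y < x\<close> \<open>a \<le> y\<close> f by (intro Henstock_Kurzweil_Integration.integral_combine) auto
        moreover have "integral {- x..- x + (x - y)} f' = integral {y..x} f"
          unfolding f'_def by (simp add: Henstock_Kurzweil_Integration.integral_reflect_real)
        ultimately have "integral {a..y} f - integral {a..x} f = - integral {- x..- x + (x - y)} f'"
          by (simp add: algebra_simps)
        moreover have "inverse (y - x) = - inverse (x - y)"
          by (simp add: inverse_minus_eq[symmetric] del: inverse_minus_eq)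
        ultimately have "(integral {a..y} f - integral {a..x} f) /\<^sub>R (y - x)
            = integral {- x..- x + (x - y)} f' /\<^sub>R (x - y)"
          by simp
        then show ?thesis using d2(2)[of "x - y"] \<open>y < x\<close> that by (simp add: d_def f'_def)
      qed
      then show "\<exists>d>0. \<forall>y. y \<noteq> x \<and> norm (y - x) < d \<longrightarrow>
          norm ((integral {a..y} f - integral {a..x} f) /\<^sub>R (y - x) - f x) < e"
        using d1 d2 \<open>a < x\<close> by (intro exI[of _ d]) (auto simp: d_def)
    qed
    then have "((\<lambda>y. norm ((integral {a..y} f - integral {a..x} f) /\<^sub>R (y - x) - f x)) \<longlongrightarrow> 0) (at x)"
      by (intro tendsto_norm_zero LIM_zero)
    moreover have "norm ((integral {a..y} f - integral {a..x} f) /\<^sub>R (y - x) - f x)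
        = norm (integral {a..y} f - integral {a..x} f - (y - x) *\<^sub>R f x) / norm (y - x)" if "y \<noteq> x" for y
    proof -
      have "(integral {a..y} f - integral {a..x} f) /\<^sub>R (y - x) - f x
          = inverse (y - x) *\<^sub>R (integral {a..y} f - integral {a..x} f - (y - x) *\<^sub>R f x)"
        using that by (simp add: scaleR_diff_right)
      then show ?thesis by (simp add: divide_inverse abs_inverse mult.commute)
    qed
    ultimately have "((\<lambda>y. norm (integral {a..y} f - integral {a..x} f - (y - x) *\<^sub>R f x) / norm (y - x)) \<longlongrightarrow> 0) (at x)"
      by (subst (asm) Lim_cong_within[OF refl refl refl]) auto
    then show ?thesis
      by (simp add: has_vector_derivative_def has_derivative_iff_norm bounded_linear_scaleR_left)
  qed
  then show ?thesis
    using AE_lborel_not_in_negligible[OF N(1)] null' by (auto elim: eventually_elim2)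
qed

text \<open>The difference, extended by zero to negative arguments so as to be integrable on every
  interval, has a vanishing primitive; differentiate it.\<close>

lemma AE_eq_if_integral_eq:
  fixes f g :: "real \<Rightarrow> 'a::euclidean_space"
  assumes f: "\<And>t. 0 \<le> t \<Longrightarrow> f integrable_on {0..t}" and g: "\<And>t. 0 \<le> t \<Longrightarrow> g integrable_on {0..t}"
    and eq: "\<And>t. 0 \<le> t \<Longrightarrow> integral {0..t} f = integral {0..t} g"
  shows "AE t in lborel. 0 \<le> t \<longrightarrow> f t = g t"
proof -
  define h where "h t = (if 0 \<le> t then f t - g t else 0)" for t
  have int_h: "h integrable_on {a..b}" "integral {0..b} h = 0" for a b
  proof -
    have *: "(h has_integral 0) {0..t}" if "0 \<le> t" for t
    proof -
      have "((\<lambda>t. f t - g t) has_integral 0) {0..t}"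
        using has_integral_diff[OF integrable_integral[OF f[OF that]] integrable_integral[OF g[OF that]]] eq[OF that] by simp
      then show ?thesis
        by (rule has_integral_eq[rotated]) (simp add: h_def)
    qed
    have "h integrable_on {min a 0..0}"
      by (rule integrable_spike_finite[of "{0}" _ _ "\<lambda>_. 0"]) (auto simp: h_def)
    moreover have "h integrable_on {0..max b 0}"
      using *[of "max b 0"] by auto
    ultimately have "h integrable_on {min a 0..max b 0}"
      by (intro Henstock_Kurzweil_Integration.integrable_combine[of "min a 0" 0 "max b 0"]) auto
    then show "h integrable_on {a..b}"
      by (rule integrable_on_subinterval) auto
    show "integral {0..b} h = 0"
      using *[of b] by (cases "0 \<le> b") (auto simp: integral_unique)
  qed
  have "AE x in lborel. 0 < x \<longrightarrow> ((\<lambda>t. integral {0..t} h) has_vector_derivative h x) (at x)"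
    using int_h(1) by (rule AE_has_vector_derivative_integral)
  then have "AE x in lborel. 0 < x \<longrightarrow> h x = 0"
  proof eventually_elim
    case (elim x)
    show ?case
    proof
      assume "0 < x"
      with elim have "((\<lambda>t. 0) has_vector_derivative h x) (at x)" by (simp add: int_h(2))
      then show "h x = 0" using vector_derivative_unique_at has_vector_derivative_const by blast
    qed
  qed
  moreover have "AE x in lborel. x \<noteq> (0::real)" by (rule AE_lborel_singleton)
  ultimately show ?thesis
    by eventually_elim (auto simp: h_def)
qed

text \<open>Translation is continuous in \<open>L\<^sup>2\<close>; by density it suffices to consider continuous functions
  of compact support.\<close>

lemma L2_approx_continuous:
  fixes f :: "real \<Rightarrow> 'a::euclidean_space"
  assumes f [measurable]: "f \<in> borel_measurable borel"
    and fin: "total_energy f < \<infinity>" and "0 < e"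
  obtains g R where "continuous_on UNIV g" "\<And>x. R < \<bar>x\<bar> \<Longrightarrow> g x = 0"
    "total_energy (\<lambda>x. f x - g x) < ennreal e"
proof -
  \<comment> \<open>Truncates value and support at once, so that bounded domination becomes
    available.\<close>
  define fR where "fR n x = (if norm (f x) \<le> real n \<and> \<bar>x\<bar> \<le> real n then f x else 0)" for n :: nat and x
  have [measurable]: "fR n \<in> borel_measurable borel" for n unfolding fR_def by measurable
  have "(\<lambda>n. \<integral>\<^sup>+x. ennreal ((norm (f x - fR n x))\<^sup>2) \<partial>lborel) \<longlonglongrightarrow> (\<integral>\<^sup>+x. 0 \<partial>(lborel :: real measure))"
  proof (rule nn_integral_dominated_convergence[where w = "\<lambda>x. ennreal ((norm (f x))\<^sup>2)"])
    show "AE x in lborel. ennreal ((norm (f x - fR n x))\<^sup>2) \<le> ennreal ((norm (f x))\<^sup>2)" for n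
      by (auto simp: fR_def)
    show "AE x in lborel. (\<lambda>n. ennreal ((norm (f x - fR n x))\<^sup>2)) \<longlonglongrightarrow> 0"
    proof (rule AE_I2)
      fix x
      obtain N where N: "max (norm (f x)) \<bar>x\<bar> \<le> real N" using real_arch_simple by blast
      have "eventually (\<lambda>n. ennreal ((norm (f x - fR n x))\<^sup>2) = 0) sequentially"
        using eventually_ge_at_top[of N] by eventually_elim (use N in \<open>auto simp: fR_def\<close>)
      then show "(\<lambda>n. ennreal ((norm (f x - fR n x))\<^sup>2)) \<longlonglongrightarrow> 0"
        by (rule tendsto_eventually)
    qed
  qed (use fin in auto)
  \<comment> \<open>A quarter of \<open>e\<close> for each of the two approximations: squaring a sum
    of two terms costs a factor 2.\<close>
  then obtain R where R: "total_energy (\<lambda>x. f x - fR R x) < ennreal (e / 4)"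
    using order_tendstoD(2)[of _ 0 sequentially "ennreal (e / 4)"] \<open>0 < e\<close>
    by (auto simp: eventually_sequentially)
  have "fR R measurable_on UNIV"
    by (subst measurable_on_iff_borel_measurable) (auto intro: borel_measurable_lebesgue_onI)
  then obtain N g where N: "negligible N" and g: "\<And>n. continuous_on UNIV (g n)"
    "\<And>x. x \<notin> N \<Longrightarrow> (\<lambda>n. g n x) \<longlonglongrightarrow> fR R x"
    unfolding measurable_on_def by auto
  \<comment> \<open>The approximants \<open>g n\<close> come without any bound. The cutoff
    \<open>\<phi>\<close> and the retraction \<open>P\<close> onto a ball supply a common one, and
    neither alters the limit \<open>fR R\<close>.\<close>
  define \<phi> where "\<phi> x = max 0 (min 1 (real R + 1 - \<bar>x\<bar>))" for x :: real
  define P where "P = closest_point (cball (0::'a) (real R))"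
  have P: "continuous_on UNIV P" unfolding P_def
    by (rule continuous_on_closest_point) auto
  have norm_P: "norm (P y) \<le> real R" for y
    using closest_point_in_set[of "cball (0::'a) (real R)" y] by (auto simp: P_def)
  define k where "k n x = \<phi> x *\<^sub>R P (g n x)" for n x
  have k_cont: "continuous_on UNIV (k n)" for n
    unfolding k_def \<phi>_def by (intro continuous_intros continuous_on_compose2[OF P g(1)]) auto
  have [measurable]: "k n \<in> borel_measurable borel" for n
    using k_cont by (rule borel_measurable_continuous_onI)
  have k_zero: "k n x = 0" if "real R + 1 < \<bar>x\<bar>" for n x using that by (simp add: k_def \<phi>_def)
  have norm_k: "norm (k n x) \<le> real R" for n x
  proof -
    have "\<phi> x * norm (P (g n x)) \<le> 1 * real R"
      using norm_P by (intro mult_mono) (auto simp: \<phi>_def)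
    then show ?thesis by (simp add: k_def \<phi>_def)
  qed
  have "(\<lambda>n. \<integral>\<^sup>+x. ennreal ((norm (fR R x - k n x))\<^sup>2) \<partial>lborel) \<longlonglongrightarrow> (\<integral>\<^sup>+x. 0 \<partial>(lborel :: real measure))"
  proof (rule nn_integral_dominated_convergence[where w = "\<lambda>x. ennreal ((2 * real R)\<^sup>2) * indicator {- real R - 1..real R + 1} x"])
    show "AE x in lborel. ennreal ((norm (fR R x - k n x))\<^sup>2) \<le> ennreal ((2 * real R)\<^sup>2) * indicator {- real R - 1..real R + 1} x" for n
    proof (rule AE_I2)
      fix x
      have "norm (fR R x - k n x) \<le> 2 * real R"
        using norm_k[of n x] norm_triangle_ineq4[of "fR R x" "k n x"] by (auto simp: fR_def split: if_splits)
      then have "(norm (fR R x - k n x))\<^sup>2 \<le> (2 * real R)\<^sup>2" by (intro power_mono) auto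
      then show "ennreal ((norm (fR R x - k n x))\<^sup>2) \<le> ennreal ((2 * real R)\<^sup>2) * indicator {- real R - 1..real R + 1} x"
        using k_zero[of x n] by (cases "\<bar>x\<bar> \<le> real R + 1") (auto simp: fR_def indicator_def abs_le_iff intro!: ennreal_leI)
    qed
    show "AE x in lborel. (\<lambda>n. ennreal ((norm (fR R x - k n x))\<^sup>2)) \<longlonglongrightarrow> 0"
      using AE_lborel_not_in_negligible[OF N]
    proof eventually_elim
      case (elim x)
      have "isCont P (fR R x)" using P by (simp add: continuous_on_eq_continuous_at)
      then have "(\<lambda>n. P (g n x)) \<longlonglongrightarrow> P (fR R x)"
        using g(2)[OF elim] by (rule isCont_tendsto_compose)
      moreover have "P (fR R x) = fR R x"
        unfolding P_def by (rule closest_point_self) (auto simp: fR_def)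
      ultimately have "(\<lambda>n. k n x) \<longlonglongrightarrow> \<phi> x *\<^sub>R fR R x"
        unfolding k_def by (intro tendsto_scaleR tendsto_const) simp
      moreover have "\<phi> x *\<^sub>R fR R x = fR R x" by (simp add: \<phi>_def fR_def)
      ultimately have "(\<lambda>n. (norm (fR R x - k n x))\<^sup>2) \<longlonglongrightarrow> (norm (fR R x - fR R x))\<^sup>2"
        by (intro tendsto_intros) simp
      then have "(\<lambda>n. ennreal ((norm (fR R x - k n x))\<^sup>2)) \<longlonglongrightarrow> ennreal ((norm (fR R x - fR R x))\<^sup>2)"
        by (rule tendsto_ennrealI)
      then show ?case by simp
    qed
    show "(\<integral>\<^sup>+x. ennreal ((2 * real R)\<^sup>2) * indicator {- real R - 1..real R + 1} x \<partial>lborel) < \<infinity>"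
      by (subst nn_integral_cmult_indicator) (auto simp: ennreal_mult_less_top)
  qed auto
  then obtain n where n: "total_energy (\<lambda>x. fR R x - k n x) < ennreal (e / 4)"
    using order_tendstoD(2)[of _ 0 sequentially "ennreal (e / 4)"] \<open>0 < e\<close>
    by (auto simp: eventually_sequentially)
  show thesis
  proof (rule that[of "k n" "real R + 1"])
    have "total_energy (\<lambda>x. f x - k n x)
      \<le> (\<integral>\<^sup>+x. 2 * ennreal ((norm (f x - fR R x))\<^sup>2) + 2 * ennreal ((norm (fR R x - k n x))\<^sup>2) \<partial>lborel)"
    proof (rule nn_integral_mono)
      fix x
      have "(norm (f x - k n x))\<^sup>2 \<le> 2 * (norm (f x - fR R x))\<^sup>2 + 2 * (norm (fR R x - k n x))\<^sup>2"
        using power2_norm_add_le[of "f x - fR R x" "fR R x - k n x"] by simp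
      from ennreal_leI[OF this] show "ennreal ((norm (f x - k n x))\<^sup>2)
          \<le> 2 * ennreal ((norm (f x - fR R x))\<^sup>2) + 2 * ennreal ((norm (fR R x - k n x))\<^sup>2)"
        by (simp add: ennreal_mult)
    qed
    also have "\<dots> = 2 * total_energy (\<lambda>x. f x - fR R x)
        + 2 * total_energy (\<lambda>x. fR R x - k n x)"
      by (simp add: nn_integral_add nn_integral_cmult)
    also have "\<dots> < 2 * ennreal (e / 4) + 2 * ennreal (e / 4)"
      using R n by (intro add_strict_mono ennreal_mult_strict_left_mono) auto
    also have "\<dots> = ennreal e"
      using \<open>0 < e\<close> by (simp flip: ennreal_plus ennreal_numeral ennreal_mult')
    finally show "total_energy (\<lambda>x. f x - k n x) < ennreal e" .
  qed (use k_cont k_zero in auto)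
qed

text \<open>Compare \<open>f\<close> with a continuous \<open>k\<close> of bounded support before
  and after the shift: the outer errors agree by translation invariance, the middle one is uniformly
  small on a bounded set.\<close>

lemma L2_translation_continuous_aux:
  fixes f :: "real \<Rightarrow> 'a::euclidean_space"
  assumes f [measurable]: "f \<in> borel_measurable borel"
    and fin: "total_energy f < \<infinity>" and "0 < e"
  obtains d where "0 < d" "\<And>h. \<bar>h\<bar> < d \<Longrightarrow> total_energy (\<lambda>x. f (x + h) - f x) < ennreal e"
proof -
  \<comment> \<open>Each of the three errors is weighted by 4, so \<open>e / 16\<close> leads to a
    total of 3e/4.\<close>
  obtain k R0 where k: "continuous_on UNIV k" "\<And>x. R0 < \<bar>x\<bar> \<Longrightarrow> k x = 0"
    "total_energy (\<lambda>x. f x - k x) < ennreal (e / 16)"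
    using L2_approx_continuous[OF f fin, of "e / 16"] \<open>0 < e\<close> by auto
  define R where "R = max R0 0"
  have R: "R \<ge> 0" "\<And>x. R < \<bar>x\<bar> \<Longrightarrow> k x = 0" using k(2) by (auto simp: R_def)
  have [measurable]: "k \<in> borel_measurable borel"
    using k(1) by (rule borel_measurable_continuous_onI)
  \<comment> \<open>The shift difference of \<open>k\<close> lives on an interval of length
    \<open>2 * R + 2\<close>; its energy is then at most \<open>e / 16\<close>.\<close>
  define \<eta> where "\<eta> = sqrt (e / (16 * (2 * R + 2)))"
  have \<eta>: "\<eta> > 0" "\<eta>\<^sup>2 * (2 * R + 2) = e / 16"
    using R(1) \<open>0 < e\<close> by (auto simp: \<eta>_def field_simps)
  \<comment> \<open>One unit wider than the interval of integration, to leave room for shifts below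
    1.\<close>
  have "uniformly_continuous_on {- R - 2..R + 2} k"
    using k(1) by (intro compact_uniformly_continuous) (auto intro: continuous_on_subset)
  then obtain d where d: "d > 0" "\<And>x y. x \<in> {- R - 2..R + 2} \<Longrightarrow> y \<in> {- R - 2..R + 2} \<Longrightarrow> dist y x < d \<Longrightarrow> dist (k y) (k x) < \<eta>"
    using \<eta>(1) unfolding uniformly_continuous_on_def by metis
  show thesis
  proof (rule that[of "min d 1"])
    fix h :: real assume h: "\<bar>h\<bar> < min d 1"
    have mid: "total_energy (\<lambda>x. k (x + h) - k x) \<le> ennreal (e / 16)"
    proof -
      have "total_energy (\<lambda>x. k (x + h) - k x)
          \<le> (\<integral>\<^sup>+x. ennreal (\<eta>\<^sup>2) * indicator {- R - 1..R + 1} x \<partial>lborel)"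
      proof (rule nn_integral_mono)
        fix x
        show "ennreal ((norm (k (x + h) - k x))\<^sup>2) \<le> ennreal (\<eta>\<^sup>2) * indicator {- R - 1..R + 1} x"
        proof (cases "\<bar>x\<bar> \<le> R + 1")
          case True
          then have "dist (k (x + h)) (k x) < \<eta>"
            using h by (intro d(2)) (auto simp: dist_real_def)
          then have "(norm (k (x + h) - k x))\<^sup>2 \<le> \<eta>\<^sup>2"
            by (intro power_mono) (auto simp: dist_norm)
          then show ?thesis using True by (auto simp: indicator_def abs_le_iff intro: ennreal_leI)
        next
          case False
          then have "k (x + h) = 0" "k x = 0" using h by (auto intro!: R(2))
          then show ?thesis by simp
        qed
      qed
      also have "\<dots> = ennreal (\<eta>\<^sup>2 * (2 * R + 2))"
        using R(1) by (subst nn_integral_cmult_indicator) (auto simp: ennreal_mult algebra_simps)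
      finally show ?thesis by (simp only: \<eta>(2))
    qed
    have shift: "total_energy (\<lambda>x. f (x + h) - k (x + h))
        = total_energy (\<lambda>x. f x - k x)"
      by (subst nn_integral_real_affine[of "\<lambda>x. ennreal ((norm (f x - k x))\<^sup>2)" 1 h]) (auto simp: add.commute)
    have "total_energy (\<lambda>x. f (x + h) - f x)
       \<le> (\<integral>\<^sup>+x. 4 * ennreal ((norm (f (x + h) - k (x + h)))\<^sup>2) + (4 * ennreal ((norm (k (x + h) - k x))\<^sup>2)
             + 4 * ennreal ((norm (f x - k x))\<^sup>2)) \<partial>lborel)"
    proof (rule nn_integral_mono)
      fix x
      have "(norm (f (x + h) - f x))\<^sup>2 \<le> 2 * (norm (f (x + h) - k (x + h)))\<^sup>2 + 2 * (norm (k (x + h) - f x))\<^sup>2"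
        using power2_norm_add_le[of "f (x + h) - k (x + h)" "k (x + h) - f x"] by simp
      moreover have "(norm (k (x + h) - f x))\<^sup>2 \<le> 2 * (norm (k (x + h) - k x))\<^sup>2 + 2 * (norm (f x - k x))\<^sup>2"
        using power2_norm_add_le[of "k (x + h) - k x" "k x - f x"] by (simp add: norm_minus_commute)
      ultimately have "(norm (f (x + h) - f x))\<^sup>2 \<le> 4 * (norm (f (x + h) - k (x + h)))\<^sup>2
          + (4 * (norm (k (x + h) - k x))\<^sup>2 + 4 * (norm (f x - k x))\<^sup>2)" 
        using zero_le_power2[of "norm (f (x + h) - k (x + h))"] by linarith
      from ennreal_leI[OF this] show "ennreal ((norm (f (x + h) - f x))\<^sup>2)
          \<le> 4 * ennreal ((norm (f (x + h) - k (x + h)))\<^sup>2) + (4 * ennreal ((norm (k (x + h) - k x))\<^sup>2)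
             + 4 * ennreal ((norm (f x - k x))\<^sup>2))"
        by (simp add: ennreal_mult)
    qed
    also have "\<dots> = 4 * total_energy (\<lambda>x. f x - k x)
        + (4 * total_energy (\<lambda>x. k (x + h) - k x)
           + 4 * total_energy (\<lambda>x. f x - k x))"
      by (simp add: nn_integral_add nn_integral_cmult shift)
    also have "\<dots> \<le> 4 * ennreal (e / 16) + (4 * ennreal (e / 16) + 4 * ennreal (e / 16))"
      using k(3) mid by (intro add_mono mult_left_mono) auto
    also have "\<dots> = ennreal (3 * e / 4)"
      using \<open>0 < e\<close> by (simp flip: ennreal_plus ennreal_numeral ennreal_mult')
    also have "\<dots> < ennreal e" using \<open>0 < e\<close> by (simp add: ennreal_less_iff)
    finally show "total_energy (\<lambda>x. f (x + h) - f x) < ennreal e" .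
  qed (use d in auto)
qed

text \<open>Only the values of \<open>g\<close> on a bounded interval enter, so \<open>g\<close> may
  be cut off there. The reflected argument is the form in which a delay acts on the profile of a
  trajectory.\<close>

lemma L2_translation_continuous:
  fixes g :: "real \<Rightarrow> 'a::euclidean_space"
  assumes g [measurable]: "g \<in> borel_measurable borel"
    and fin: "\<And>a b. energy {a..b} g < \<infinity>" and "0 < e"
  obtains d where "0 < d"
    "\<And>s t. s \<in> {c..c'} \<Longrightarrow> t \<in> {c..c'} \<Longrightarrow> \<bar>s - t\<bar> < d \<Longrightarrow>
      energy {a..b} (\<lambda>x. g (s - x) - g (t - x)) < ennreal e"
proof -
  define I where "I = {c - b..c' - a}"
  define f where "f x = indicator I x *\<^sub>R g x" for x
  have [measurable]: "f \<in> borel_measurable borel" unfolding f_def I_def by measurable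
  have "total_energy f = (\<integral>\<^sup>+x\<in>I. ennreal ((norm (g x))\<^sup>2) \<partial>lborel)"
    by (intro nn_integral_cong) (auto simp: f_def indicator_def)
  also have "\<dots> < \<infinity>" unfolding I_def by (rule fin)
  finally have "total_energy f < \<infinity>" .
  then obtain d where d: "0 < d"
    "\<And>h. \<bar>h\<bar> < d \<Longrightarrow> total_energy (\<lambda>x. f (x + h) - f x) < ennreal e"
    using L2_translation_continuous_aux[of f e] \<open>0 < e\<close> by auto
  show thesis
  proof (rule that[OF d(1)])
    fix s t assume st: "s \<in> {c..c'}" "t \<in> {c..c'}" "\<bar>s - t\<bar> < d"
    have "energy {a..b} (\<lambda>x. g (s - x) - g (t - x))
       \<le> total_energy (\<lambda>x. f (t - x + (s - t)) - f (t - x))"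
      using st by (intro nn_integral_mono) (auto simp: f_def I_def indicator_def)
    also have "\<dots> = total_energy (\<lambda>x. f (x + (s - t)) - f x)"
      by (subst nn_integral_real_affine[of "\<lambda>x. ennreal ((norm (f (x + (s - t)) - f x))\<^sup>2)" "-1" t]) auto
    also have "\<dots> < ennreal e" using st by (intro d(2)) auto
    finally show "energy {a..b} (\<lambda>x. g (s - x) - g (t - x)) < ennreal e" .
  qed
qed

lemma L2_on_continuous:
  fixes f :: "real \<Rightarrow> 'a::euclidean_space"
  assumes "continuous_on {a..b} f"
  shows "f \<in> L2_on {a..b}"
proof -
  have "f absolutely_integrable_on {a..b}" "(\<lambda>x. (norm (f x))\<^sup>2) absolutely_integrable_on {a..b}"
    using assms by (auto intro!: absolutely_integrable_continuous_real continuous_intros)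
  then have "integrable (lebesgue_on {a..b}) f" "integrable (lebesgue_on {a..b}) (\<lambda>x. (norm (f x))\<^sup>2)"
    by (auto simp: absolutely_integrable_on_def set_integrable_def integrable_restrict_space)
  then show ?thesis by (auto simp: L2_on_def)
qed

lemma AE_eq_if_integral_eq_interval:
  fixes f g :: "real \<Rightarrow> 'a::euclidean_space"
  assumes "0 \<le> b" and f: "f integrable_on {0..b}" and g: "g integrable_on {0..b}"
    and eq: "\<And>t. t \<in> {0..b} \<Longrightarrow> integral {0..t} f = integral {0..t} g"
  shows "AE t in lborel. t \<in> {0..b} \<longrightarrow> f t = g t"
proof -
  define cut where "cut h t = (if t \<in> {0..b} then h t else 0)" for h :: "real \<Rightarrow> 'a" and t
  have cut: "cut h integrable_on {0..t}" "integral {0..t} (cut h) = integral {0..min t b} h"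
    if "h integrable_on {0..b}" for h and t :: real
  proof -
    have "h integrable_on {0..min t b}"
      using that by (rule integrable_on_subinterval) auto
    then have "(h has_integral integral {0..min t b} h) ({0..b} \<inter> {0..t})"
      by (simp add: integrable_integral Int_atLeastAtMost min.commute)
    then have "(cut h has_integral integral {0..min t b} h) {0..t}"
      unfolding cut_def by (simp only: has_integral_restrict_Int)
    then show "cut h integrable_on {0..t}" "integral {0..t} (cut h) = integral {0..min t b} h"
      by (auto simp: integral_unique)
  qed
  have "AE t in lborel. 0 \<le> t \<longrightarrow> cut f t = cut g t"
  proof (rule AE_eq_if_integral_eq)
    show "integral {0..t} (cut f) = integral {0..t} (cut g)" if "0 \<le> t" for t
      using eq[of "min t b"] that \<open>0 \<le> b\<close> by (simp add: cut f g)
  qed (simp_all add: cut f g)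
  then show ?thesis by eventually_elim (auto simp: cut_def)
qed

subsection \<open>Primitives\<close>

text \<open>A signed primitive on the whole line, because trajectories also have a past, where the
  initial state is stored.\<close>

definition prim :: "(real \<Rightarrow> 'a::euclidean_space) \<Rightarrow> real \<Rightarrow> 'a" where
  "prim f x = (if 0 \<le> x then integral {0..x} f else - integral {x..0} f)"

lemma prim_diff:
  assumes f: "\<And>a b. f integrable_on {a..b}" and "a \<le> b"
  shows "integral {a..b} f = prim f b - prim f a"
proof -
  have comb: "integral {a..c} f + integral {c..b} f = integral {a..b} f" if "a \<le> c" "c \<le> b" for a b c :: real
    using that f by (intro Henstock_Kurzweil_Integration.integral_combine) auto
  consider "0 \<le> a" | "b < 0" | "a < 0" "0 \<le> b" using \<open>a \<le> b\<close> by linarith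
  then show ?thesis
  proof cases
    case 1
    then show ?thesis using comb[of 0 a b] \<open>a \<le> b\<close> by (simp add: prim_def algebra_simps)
  next
    case 2
    then show ?thesis using comb[of a b 0] \<open>a \<le> b\<close> by (simp add: prim_def algebra_simps)
  next
    case 3
    then show ?thesis using comb[of a 0 b] by (simp add: prim_def add.commute)
  qed
qed

lemma prim_0 [simp]: "prim f 0 = 0"
  by (simp add: prim_def)

lemma continuous_on_prim:
  assumes f: "\<And>a b. f integrable_on {a..b}"
  shows "continuous_on S (prim f)"
proof -
  have "isCont (prim f) x" for x
  proof -
    have "continuous_on {x - 1..x + 1} (\<lambda>y. prim f (x - 1) + integral {x - 1..y} f)"
      by (intro continuous_intros indefinite_integral_continuous_1 f)
    then have "continuous_on {x - 1..x + 1} (prim f)"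
      by (rule continuous_on_eq) (simp add: prim_diff[OF f])
    then show ?thesis by (rule continuous_on_interior) simp
  qed
  then show ?thesis by (simp add: continuous_at_imp_continuous_on)
qed

subsection \<open>Travel time\<close>

text \<open>The speed \<open>l\<close> is a Borel representative of \<open>\<lambda>\<^sub>0\<close>, redefined so that its bounds hold everywhere on the
  real line.\<close>

locale transport =
  fixes l :: "real \<Rightarrow> real" and lo hi :: real
  assumes l_borel [measurable]: "l \<in> borel_measurable borel"
    and lo_pos: "0 < lo" and lo_le: "\<And>\<zeta>. lo \<le> l \<zeta>" and le_hi: "\<And>\<zeta>. l \<zeta> \<le> hi"
begin

definition rate where "rate \<zeta> = inverse (l \<zeta>)"
definition p where "p = prim rate"
definition q where "q = inv p"
definition T where "T = p 1"

lemma l_pos: "0 < l \<zeta>" using lo_pos lo_le[of \<zeta>] by linarith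
lemma hi_pos: "0 < hi" using l_pos[of 0] le_hi[of 0] by linarith

lemma rate_borel [measurable]: "rate \<in> borel_measurable borel"
  unfolding rate_def by measurable

lemma rate_bounds: "0 < rate \<zeta>" "inverse hi \<le> rate \<zeta>" "rate \<zeta> \<le> inverse lo"
  using l_pos lo_le le_hi lo_pos by (auto simp: rate_def le_imp_inverse_le)

lemma l_rate: "l \<zeta> * rate \<zeta> = 1" "rate \<zeta> * l \<zeta> = 1"
  using l_pos[of \<zeta>] by (simp_all add: rate_def)

lemma rate_integrable: "rate integrable_on {a..b}"
proof (rule measurable_bounded_by_integrable_imp_integrable)
  show "rate \<in> borel_measurable (lebesgue_on {a..b})"
    by (rule borel_measurable_lebesgue_onI) measurable
  show "(\<lambda>_. inverse lo) integrable_on {a..b}" by (rule integrable_const_ivl)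
  show "norm (rate x) \<le> inverse lo" if "x \<in> {a..b}" for x
    using rate_bounds[of x] by simp
qed auto

lemma p_diff: "a \<le> b \<Longrightarrow> integral {a..b} rate = p b - p a"
  unfolding p_def by (rule prim_diff[OF rate_integrable])

text \<open>Two-sided slope bounds: they make \<open>p\<close> a bijection of the whole line and its
  inverse \<open>q\<close> Lipschitz continuous.\<close>

lemma p_bounds:
  assumes "a \<le> b"
  shows "inverse hi * (b - a) \<le> p b - p a" "p b - p a \<le> inverse lo * (b - a)"
proof -
  have "integral {a..b} (\<lambda>_. inverse hi) \<le> integral {a..b} rate"
    using rate_bounds rate_integrable by (intro integral_le) auto
  then show "inverse hi * (b - a) \<le> p b - p a" using assms by (simp add: p_diff mult.commute)
  have "integral {a..b} rate \<le> integral {a..b} (\<lambda>_. inverse lo)"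
    using rate_bounds rate_integrable by (intro integral_le) auto
  then show "p b - p a \<le> inverse lo * (b - a)" using assms by (simp add: p_diff mult.commute)
qed

lemma p_0 [simp]: "p 0 = 0" by (simp add: p_def)

lemma p_less_iff [simp]: "p a < p b \<longleftrightarrow> a < b"
proof -
  have "p a < p b" if "a < b" for a b
    using p_bounds(1)[of a b] that hi_pos by (smt (verit) positive_imp_inverse_positive mult_pos_pos)
  then show ?thesis by (metis linorder_neqE order_less_asym)
qed

lemma p_le_iff [simp]: "p a \<le> p b \<longleftrightarrow> a \<le> b"
  by (metis p_less_iff linorder_not_le)

lemma p_continuous: "continuous_on S p"
  unfolding p_def by (rule continuous_on_prim[OF rate_integrable])

lemma p_borel [measurable]: "p \<in> borel_measurable borel"
  by (rule borel_measurable_continuous_onI[OF p_continuous])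

lemma bij_p: "bij p"
proof (rule bijI)
  show "inj p" by (rule injI) (metis p_le_iff order_antisym order_refl)
  show "surj p"
  proof (rule surjI[of _ "\<lambda>y. SOME x. p x = y"], rule someI_ex)
    fix y :: real
    \<comment> \<open>The slope is at least \<open>inverse hi\<close>, so over a distance
      \<open>hi * \<bar>y\<bar>\<close> the value of \<open>p\<close> moves by at least
      \<open>\<bar>y\<bar>\<close>.\<close>
    have "p (- hi * \<bar>y\<bar>) \<le> y" "y \<le> p (hi * \<bar>y\<bar>)"
      using p_bounds(1)[of "- hi * \<bar>y\<bar>" 0] p_bounds(1)[of 0 "hi * \<bar>y\<bar>"] hi_pos by (auto simp: field_simps)
    moreover have "- hi * \<bar>y\<bar> \<le> hi * \<bar>y\<bar>"
      using hi_pos by (smt (verit) mult_nonneg_nonneg mult_minus_left abs_ge_zero)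
    ultimately show "\<exists>x. p x = y"
      using IVT'[of p "- hi * \<bar>y\<bar>" y "hi * \<bar>y\<bar>"] p_continuous by blast
  qed
qed

lemma p_q [simp]: "p (q x) = x" and q_p [simp]: "q (p x) = x"
  using bij_p by (simp_all add: q_def bij_is_surj surj_f_inv_f bij_is_inj)

lemma q_le_iff [simp]: "q x \<le> q y \<longleftrightarrow> x \<le> y"
  using p_le_iff[of "q x" "q y"] by simp

lemma q_0 [simp]: "q 0 = 0" using q_p[of 0] by simp
lemma q_T [simp]: "q T = 1" by (simp add: T_def)
lemma T_pos: "0 < T" using p_less_iff[of 0 1] by (simp add: T_def)

lemma q_continuous: "continuous_on S q"
proof -
  have "\<bar>q x - q y\<bar> \<le> hi * \<bar>x - y\<bar>" for x y
  proof (induction x y rule: linorder_wlog)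
    case (le x y)
    then show ?case using p_bounds(1)[of "q x" "q y"] hi_pos by (simp add: field_simps)
  qed (simp add: abs_minus_commute)
  then have "hi-lipschitz_on S q"
    using hi_pos by (intro lipschitz_onI) (auto simp: dist_real_def)
  then show ?thesis by (rule lipschitz_on_continuous_on)
qed

lemma q_borel [measurable]: "q \<in> borel_measurable borel"
  by (rule borel_measurable_continuous_onI[OF q_continuous])

lemma q_in_01: "x \<in> {0..T} \<Longrightarrow> q x \<in> {0..1}" and p_in_0T: "\<zeta> \<in> {0..1} \<Longrightarrow> p \<zeta> \<in> {0..T}"
  using q_le_iff[of 0 x] q_le_iff[of x T] p_le_iff[of 0 \<zeta>] p_le_iff[of \<zeta> 1]
  by (auto simp: T_def simp del: q_le_iff p_le_iff)

text \<open>Change of variables without pointwise differentiability of \<open>p\<close>: the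
  pushed-forward measure gives each interval its length, and that characterizes Lebesgue measure.
  Both substitution rules follow.\<close>

lemma distr_p: "distr (density lborel (\<lambda>x. ennreal (rate x))) borel p = lborel"
proof (rule lborel_eqI[symmetric])
  fix a b :: real assume "\<And>c. c \<in> Basis \<Longrightarrow> a \<bullet> c \<le> b \<bullet> c"
  then have "a \<le> b" by simp
  have "p -` {a<..<b} = {q a<..<q b}"
    using p_less_iff[of "q a"] p_less_iff[of _ "q b"] by (auto simp del: p_less_iff)
  then have "emeasure (distr (density lborel (\<lambda>x. ennreal (rate x))) borel p) (box a b)
      = (\<integral>\<^sup>+x. ennreal (rate x) * indicator {q a<..<q b} x \<partial>lborel)"
    by (simp add: emeasure_distr emeasure_density)
  also have "\<dots> = (\<integral>\<^sup>+x. ennreal (if x \<in> {q a<..<q b} then rate x else 0) \<partial>lborel)"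
    by (intro nn_integral_cong) (auto simp: indicator_def)
  also have "\<dots> = integral {q a<..<q b} rate"
  proof (rule nn_integral_has_integral_lborel)
    show "((\<lambda>x. if x \<in> {q a<..<q b} then rate x else 0) has_integral integral {q a<..<q b} rate) UNIV"
      using rate_integrable by (subst has_integral_restrict_UNIV)
        (auto simp: integrable_on_open_interval_real intro: integrable_integral)
  qed (use rate_bounds(1) in \<open>auto intro: less_imp_le\<close>)
  also have "integral {q a<..<q b} rate = b - a"
    using p_diff[of "q a" "q b"] \<open>a \<le> b\<close> by (simp add: integral_open_interval_real)
  finally show "emeasure (distr (density lborel (\<lambda>x. ennreal (rate x))) borel p) (box a b)
      = ennreal (\<Prod>c\<in>Basis. (b - a) \<bullet> c)"
    by simp
qed simp

lemma nn_integral_substitution: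
  assumes [measurable]: "f \<in> borel_measurable borel"
  shows "(\<integral>\<^sup>+\<zeta>\<in>{a..b}. ennreal (rate \<zeta>) * f (p \<zeta>) \<partial>lborel) = (\<integral>\<^sup>+x\<in>{p a..p b}. f x \<partial>lborel)"
proof -
  have "(\<integral>\<^sup>+x\<in>{p a..p b}. f x \<partial>lborel)
      = (\<integral>\<^sup>+x. f x * indicator {p a..p b} x \<partial>distr (density lborel (\<lambda>x. ennreal (rate x))) borel p)"
    by (simp add: distr_p)
  also have "\<dots> = (\<integral>\<^sup>+\<zeta>. ennreal (rate \<zeta>) * (f (p \<zeta>) * indicator {p a..p b} (p \<zeta>)) \<partial>lborel)"
    by (simp add: nn_integral_distr nn_integral_density)
  also have "\<dots> = (\<integral>\<^sup>+\<zeta>\<in>{a..b}. ennreal (rate \<zeta>) * f (p \<zeta>) \<partial>lborel)"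
    by (intro nn_integral_cong) (auto simp: indicator_def)
  finally show ?thesis by simp
qed

lemma integral_substitution:
  fixes f :: "real \<Rightarrow> 'a::euclidean_space"
  assumes [measurable]: "f \<in> borel_measurable borel" and int: "set_integrable lborel {p a..p b} f"
  shows "((\<lambda>\<zeta>. rate \<zeta> *\<^sub>R f (p \<zeta>)) has_integral integral {p a..p b} f) {a..b}"
proof -
  define h where "h x = indicator {p a..p b} x *\<^sub>R f x" for x
  have [measurable]: "h \<in> borel_measurable borel" unfolding h_def by measurable
  have h: "integrable lborel h" using int by (simp add: h_def[abs_def] set_integrable_def)
  let ?D = "density lborel (\<lambda>x. ennreal (rate x))"
  have "integrable (distr ?D borel p) h" by (simp add: distr_p h)
  then have "integrable ?D (\<lambda>\<zeta>. h (p \<zeta>))"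
    by (subst (asm) integrable_distr_eq) auto
  then have int': "integrable lborel (\<lambda>\<zeta>. rate \<zeta> *\<^sub>R h (p \<zeta>))"
    using rate_bounds(1) by (subst (asm) integrable_density) (auto intro: less_imp_le)
  have "integral\<^sup>L lborel h = integral\<^sup>L (distr ?D borel p) h" by (simp add: distr_p)
  also have "\<dots> = integral\<^sup>L ?D (\<lambda>\<zeta>. h (p \<zeta>))" by (rule integral_distr) auto
  also have "\<dots> = integral\<^sup>L lborel (\<lambda>\<zeta>. rate \<zeta> *\<^sub>R h (p \<zeta>))"
    using rate_bounds(1) by (subst integral_density) (auto intro: less_imp_le)
  finally have eq: "integral\<^sup>L lborel h = integral\<^sup>L lborel (\<lambda>\<zeta>. rate \<zeta> *\<^sub>R h (p \<zeta>))" .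
  have "((\<lambda>\<zeta>. rate \<zeta> *\<^sub>R h (p \<zeta>)) has_integral integral\<^sup>L lborel h) UNIV"
    unfolding eq by (rule has_integral_integral_lborel[OF int'])
  moreover have "(\<lambda>\<zeta>. rate \<zeta> *\<^sub>R h (p \<zeta>)) = (\<lambda>\<zeta>. if \<zeta> \<in> {a..b} then rate \<zeta> *\<^sub>R f (p \<zeta>) else 0)"
    by (auto simp: h_def indicator_def fun_eq_iff)
  moreover have "integral\<^sup>L lborel h = integral {p a..p b} f"
    using set_borel_integral_eq_integral(2)[OF int] by (simp add: h_def[abs_def] set_lebesgue_integral_def)
  ultimately show ?thesis by (simp only: has_integral_restrict_UNIV)
qed

text \<open>Of the two factors \<open>rate\<close> in the square, one is spent on the substitution
  and the other is bounded. With its counterpart below this makes the norm of a state equivalent to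
  that of the stretch of trajectory encoding it.\<close>

lemma nn_integral_rate_upper:
  assumes [measurable]: "h \<in> borel_measurable borel"
  shows "energy {0..1} (\<lambda>\<zeta>. rate \<zeta> *\<^sub>R h (p \<zeta>))
    \<le> ennreal (inverse lo) * energy {0..T} h"
proof -
  have "energy {0..1} (\<lambda>\<zeta>. rate \<zeta> *\<^sub>R h (p \<zeta>))
    \<le> (\<integral>\<^sup>+\<zeta>. ennreal (inverse lo) * (ennreal (rate \<zeta>) * ennreal ((norm (h (p \<zeta>)))\<^sup>2) * indicator {0..1} \<zeta>) \<partial>lborel)"
  proof (rule nn_integral_mono)
    fix \<zeta>
    have "(norm (rate \<zeta> *\<^sub>R h (p \<zeta>)))\<^sup>2 = rate \<zeta> * (rate \<zeta> * (norm (h (p \<zeta>)))\<^sup>2)"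
      by (simp add: power_mult_distrib power2_eq_square)
    also have "\<dots> \<le> inverse lo * (rate \<zeta> * (norm (h (p \<zeta>)))\<^sup>2)"
      using rate_bounds[of \<zeta>] by (intro mult_right_mono) auto
    finally have "ennreal ((norm (rate \<zeta> *\<^sub>R h (p \<zeta>)))\<^sup>2) \<le> ennreal (inverse lo * (rate \<zeta> * (norm (h (p \<zeta>)))\<^sup>2))"
      by (rule ennreal_leI)
    then show "ennreal ((norm (rate \<zeta> *\<^sub>R h (p \<zeta>)))\<^sup>2) * indicator {0..1} \<zeta>
        \<le> ennreal (inverse lo) * (ennreal (rate \<zeta>) * ennreal ((norm (h (p \<zeta>)))\<^sup>2) * indicator {0..1} \<zeta>)"
      using lo_pos rate_bounds(1)[of \<zeta>] by (simp add: ennreal_mult indicator_def)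
  qed
  also have "\<dots> = ennreal (inverse lo) * energy {p 0..p 1} h"
    by (subst nn_integral_substitution[symmetric]) (auto simp: nn_integral_cmult)
  finally show ?thesis by (simp add: T_def)
qed

lemma nn_integral_rate_lower:
  assumes [measurable]: "h \<in> borel_measurable borel"
  shows "energy {0..T} h
    \<le> ennreal hi * energy {0..1} (\<lambda>\<zeta>. rate \<zeta> *\<^sub>R h (p \<zeta>))"
proof -
  have "energy {p 0..p 1} h
      = (\<integral>\<^sup>+\<zeta>\<in>{0..1}. ennreal (rate \<zeta>) * ennreal ((norm (h (p \<zeta>)))\<^sup>2) \<partial>lborel)"
    by (rule nn_integral_substitution[symmetric]) measurable
  also have "\<dots> \<le> (\<integral>\<^sup>+\<zeta>. ennreal hi * (ennreal ((norm (rate \<zeta> *\<^sub>R h (p \<zeta>)))\<^sup>2) * indicator {0..1} \<zeta>) \<partial>lborel)"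
  proof (rule nn_integral_mono)
    fix \<zeta>
    have "rate \<zeta> * (norm (h (p \<zeta>)))\<^sup>2 = l \<zeta> * (norm (rate \<zeta> *\<^sub>R h (p \<zeta>)))\<^sup>2"
      using l_rate[of \<zeta>] by (simp add: power_mult_distrib power2_eq_square)
    also have "\<dots> \<le> hi * (norm (rate \<zeta> *\<^sub>R h (p \<zeta>)))\<^sup>2"
      using le_hi by (intro mult_right_mono) auto
    finally have "ennreal (rate \<zeta> * (norm (h (p \<zeta>)))\<^sup>2) \<le> ennreal (hi * (norm (rate \<zeta> *\<^sub>R h (p \<zeta>)))\<^sup>2)"
      by (rule ennreal_leI)
    then show "ennreal (rate \<zeta>) * ennreal ((norm (h (p \<zeta>)))\<^sup>2) * indicator {0..1} \<zeta>
        \<le> ennreal hi * (ennreal ((norm (rate \<zeta> *\<^sub>R h (p \<zeta>)))\<^sup>2) * indicator {0..1} \<zeta>)"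
      using hi_pos rate_bounds(1)[of \<zeta>] by (simp add: ennreal_mult indicator_def)
  qed
  also have "\<dots> = ennreal hi * energy {0..1} (\<lambda>\<zeta>. rate \<zeta> *\<^sub>R h (p \<zeta>))"
    by (simp add: nn_integral_cmult)
  finally show ?thesis by (simp add: T_def)
qed

end

subsection \<open>Locally square integrable functions\<close>

text \<open>Functions rather than classes, defined on the whole line, so that recursions can be
  imposed at every point.\<close>

definition loc_L2 :: "(real \<Rightarrow> 'a::euclidean_space) \<Rightarrow> bool" where
  "loc_L2 g \<longleftrightarrow> g \<in> borel_measurable borel \<and>
     (\<forall>a b. energy {a..b} g < \<infinity>)"

lemma loc_L2_L2_on: "loc_L2 g \<Longrightarrow> g \<in> L2_on {a..b}"
  by (simp add: loc_L2_def L2_on_borel_iff)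

lemma loc_L2_integrable_on: "loc_L2 g \<Longrightarrow> g integrable_on {a..b}"
  by (rule L2_on_integrable_on(1)[OF loc_L2_L2_on]) auto

lemma loc_L2_set_integrable:
  assumes "loc_L2 g"
  shows "set_integrable lborel {a..b} g"
proof -
  have [measurable]: "g \<in> borel_measurable borel" using assms by (simp add: loc_L2_def)
  have "g absolutely_integrable_on {a..b}"
    by (rule L2_on_integrable_on(2)[OF loc_L2_L2_on[OF assms]]) auto
  then show ?thesis
    unfolding absolutely_integrable_on_def set_integrable_def by (subst (asm) integrable_completion) auto
qed

lemma loc_L2_reflect:
  assumes "loc_L2 g"
  shows "loc_L2 (\<lambda>x. g (t - x))"
proof -
  have [measurable]: "g \<in> borel_measurable borel" using assms by (simp add: loc_L2_def)
  have "energy {a..b} (\<lambda>x. g (t - x))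
      = energy {t - b..t - a} g" for a b
    by (subst nn_integral_real_affine[of "\<lambda>x. ennreal ((norm (g x))\<^sup>2) * indicator {t - b..t - a} x" "-1" t])
      (auto intro!: nn_integral_cong simp: indicator_def)
  then show ?thesis using assms by (simp add: loc_L2_def)
qed

lemma integral_reflect_shift:
  fixes g :: "real \<Rightarrow> 'a::euclidean_space"
  shows "integral {a..b} (\<lambda>x. g (t - x)) = integral {t - b..t - a} g"
proof -
  have "integral {a..b} (\<lambda>x. g (t - x)) = integral {- b..- a} (\<lambda>x. g (t + x))"
    using Henstock_Kurzweil_Integration.integral_reflect_real[of "- a" "- b" "\<lambda>x. g (t + x)"] by simp
  also have "\<dots> = integral {t - b..t - a} g"
    using integral_shift_Icc_real[of "- b" "- a" g t] by (simp add: comp_def)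
  finally show ?thesis .
qed

section \<open>Explicit mild solutions by transport along characteristics\<close>

context transport
begin

definition zsol :: "(real \<Rightarrow> 'a::euclidean_space) \<Rightarrow> real \<Rightarrow> real \<Rightarrow> 'a" where
  "zsol g t \<zeta> = rate \<zeta> *\<^sub>R g (t - p \<zeta>)"

text \<open>The flux \<open>g (s - p \<zeta>)\<close> integrated over \<open>s\<close> from 0 to
  \<open>t\<close>.\<close>

definition wsol :: "(real \<Rightarrow> 'a::euclidean_space) \<Rightarrow> real \<Rightarrow> real \<Rightarrow> 'a" where
  "wsol g t \<zeta> = prim g (t - p \<zeta>) - prim g (- p \<zeta>)"

lemma zsol_borel [measurable]:
  assumes "loc_L2 g"
  shows "zsol g t \<in> borel_measurable borel"
proof -
  have [measurable]: "g \<in> borel_measurable borel" using assms by (simp add: loc_L2_def)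
  show ?thesis unfolding zsol_def[abs_def] by measurable
qed

lemma zsol_L2:
  assumes g: "loc_L2 g"
  shows "zsol g t \<in> L2_on {0..1}"
proof -
  note g' = loc_L2_reflect[OF g, of t]
  have "energy {0..1} (\<lambda>\<zeta>. zsol g t \<zeta>)
      \<le> ennreal (inverse lo) * energy {0..T} (\<lambda>x. g (t - x))"
    using nn_integral_rate_upper[of "\<lambda>x. g (t - x)"] g' by (simp add: zsol_def loc_L2_def)
  also have "\<dots> < \<infinity>" using g' by (simp add: loc_L2_def ennreal_mult_less_top)
  finally show ?thesis using zsol_borel[OF g] by (simp add: L2_on_borel_iff)
qed

text \<open>The constant mesh in \<open>X_integral\<close> calls for continuity that is uniform in
  time. It comes from translations; there the tolerance \<open>lo * e\<^sup>2\<close> offsets the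
  factor \<open>inverse lo\<close> of the change of variables.\<close>

lemma zsol_uniform:
  assumes g: "loc_L2 g" and "0 < e"
  obtains d where "0 < d" "\<And>s t. s \<in> {c..c'} \<Longrightarrow> t \<in> {c..c'} \<Longrightarrow> \<bar>s - t\<bar> < d \<Longrightarrow>
    energy {0..1} (\<lambda>\<zeta>. zsol g s \<zeta> - zsol g t \<zeta>) \<le> ennreal (e\<^sup>2)"
proof -
  have g': "g \<in> borel_measurable borel" "\<And>a b. energy {a..b} g < \<infinity>"
    using g by (auto simp: loc_L2_def)
  note [measurable] = g'(1)
  obtain d where d: "0 < d" "\<And>s t. s \<in> {c..c'} \<Longrightarrow> t \<in> {c..c'} \<Longrightarrow> \<bar>s - t\<bar> < d \<Longrightarrow>
      energy {0..T} (\<lambda>x. g (s - x) - g (t - x)) < ennreal (lo * e\<^sup>2)"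
    by (rule L2_translation_continuous[OF g', of "lo * e\<^sup>2"]) (use lo_pos \<open>0 < e\<close> in auto)
  show thesis
  proof (rule that[OF d(1)])
    fix s t assume st: "s \<in> {c..c'}" "t \<in> {c..c'}" "\<bar>s - t\<bar> < d"
    have "energy {0..1} (\<lambda>\<zeta>. zsol g s \<zeta> - zsol g t \<zeta>)
      = energy {0..1} (\<lambda>\<zeta>. rate \<zeta> *\<^sub>R (g (s - p \<zeta>) - g (t - p \<zeta>)))"
      by (simp add: zsol_def scaleR_diff_right)
    also have "\<dots> \<le> ennreal (inverse lo) * energy {0..T} (\<lambda>x. g (s - x) - g (t - x))"
      by (rule nn_integral_rate_upper) measurable
    also have "\<dots> \<le> ennreal (inverse lo) * ennreal (lo * e\<^sup>2)"
      using d(2)[OF st] by (intro mult_left_mono) auto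
    also have "\<dots> = ennreal (e\<^sup>2)"
      using lo_pos by (simp flip: ennreal_mult')
    finally show "energy {0..1} (\<lambda>\<zeta>. zsol g s \<zeta> - zsol g t \<zeta>) \<le> ennreal (e\<^sup>2)" .
  qed
qed

lemma zsol_continuous:
  assumes g: "loc_L2 g"
  shows "X_continuous (zsol g)"
  unfolding X_continuous_def
proof (intro allI impI conjI zsol_L2[OF g])
  fix t :: real assume "0 \<le> t"
  note [measurable] = zsol_borel[OF g]
  show "((\<lambda>s. L2_norm_on {0..1} (\<lambda>\<zeta>. zsol g s \<zeta> - zsol g t \<zeta>)) \<longlongrightarrow> 0) (at t within {0..})"
  proof (rule tendstoI)
    fix e :: real assume "0 < e"
    obtain d where d: "0 < d" "\<And>s t'. s \<in> {0..t + 1} \<Longrightarrow> t' \<in> {0..t + 1} \<Longrightarrow> \<bar>s - t'\<bar> < d \<Longrightarrow>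
      energy {0..1} (\<lambda>\<zeta>. zsol g s \<zeta> - zsol g t' \<zeta>) \<le> ennreal ((e / 2)\<^sup>2)"
      by (rule zsol_uniform[OF g, of "e / 2" 0 "t + 1"]) (use \<open>0 < e\<close> in auto)
    have "L2_norm_on {0..1} (\<lambda>\<zeta>. zsol g s \<zeta> - zsol g t \<zeta>) \<le> e / 2" if "0 \<le> s" "\<bar>s - t\<bar> < min d 1" for s
      using that \<open>0 \<le> t\<close> \<open>0 < e\<close> by (intro L2_norm_on_borel_le d(2)) auto
    then show "\<forall>\<^sub>F s in at t within {0..}. dist (L2_norm_on {0..1} (\<lambda>\<zeta>. zsol g s \<zeta> - zsol g t \<zeta>)) 0 < e"
      unfolding eventually_at using \<open>0 < e\<close> d(1)
      by (intro exI[of _ "min d 1"]) (fastforce simp: dist_real_def)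
  qed
qed

text \<open>For these explicit representatives, time integration may be carried out at each position
  separately.\<close>

lemma wsol_eq_integral:
  assumes g: "loc_L2 g" and "a \<le> b"
  shows "((\<lambda>r. zsol g r \<zeta>) has_integral rate \<zeta> *\<^sub>R (prim g (b - p \<zeta>) - prim g (a - p \<zeta>))) {a..b}"
proof -
  have "((\<lambda>r. g (r - p \<zeta>)) has_integral (prim g (b - p \<zeta>) - prim g (a - p \<zeta>))) {a..b}"
  proof -
    have "(g has_integral (prim g (b - p \<zeta>) - prim g (a - p \<zeta>))) {a - p \<zeta>..b - p \<zeta>}"
      using prim_diff[OF loc_L2_integrable_on[OF g], of "a - p \<zeta>" "b - p \<zeta>"] \<open>a \<le> b\<close>
        integrable_integral[OF loc_L2_integrable_on[OF g, of "a - p \<zeta>" "b - p \<zeta>"]] by simp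
    then show ?thesis
      using has_integral_shift_Icc_real[of g "- p \<zeta>" _ a b] by (simp add: comp_def)
  qed
  then show ?thesis unfolding zsol_def by (rule has_integral_cmul)
qed

text \<open>The Riemann error on one cell. Cauchy-Schwarz in time bounds it at each position; Fubini
  then exchanges the integrals, so that \<open>close\<close> applies at each time. Each of the two
  steps contributes a factor \<open>b - a\<close>.\<close>

lemma wsol_X_integral_cell:
  assumes g: "loc_L2 g" and "a \<le> b" and "0 \<le> e"
    and close: "\<And>r. r \<in> {a..b} \<Longrightarrow>
      energy {0..1} (\<lambda>\<zeta>. zsol g s \<zeta> - zsol g r \<zeta>) \<le> ennreal (e\<^sup>2)"
  defines "Y \<equiv> \<lambda>\<zeta>. (b - a) *\<^sub>R zsol g s \<zeta> - integral {a..b} (\<lambda>r. zsol g r \<zeta>)"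
  shows "Y \<in> L2_on {0..1}" "L2_norm_on {0..1} Y \<le> (b - a) * e"
proof -
  have gm [measurable]: "g \<in> borel_measurable borel" using g by (simp add: loc_L2_def)
  have [measurable]: "prim g \<in> borel_measurable borel"
    by (rule borel_measurable_continuous_onI[OF continuous_on_prim[OF loc_L2_integrable_on[OF g]]])
  have [measurable]: "zsol g t \<in> borel_measurable borel" for t by (rule zsol_borel[OF g])
  have "integral {a..b} (\<lambda>r. zsol g r \<zeta>) = rate \<zeta> *\<^sub>R (prim g (b - p \<zeta>) - prim g (a - p \<zeta>))" for \<zeta>
    using wsol_eq_integral[OF g \<open>a \<le> b\<close>] by (rule integral_unique)
  then have Y [measurable]: "Y \<in> borel_measurable borel"
    unfolding Y_def by simp
  have pt: "ennreal ((norm (Y \<zeta>))\<^sup>2) \<le> ennreal (b - a) * energy {a..b} (\<lambda>r. zsol g s \<zeta> - zsol g r \<zeta>)"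
    (is "_ \<le> _ * ?N") for \<zeta>
  proof -
    define h where "h r = zsol g s \<zeta> - zsol g r \<zeta>" for r
    have [measurable]: "h \<in> borel_measurable borel" unfolding h_def zsol_def by measurable
    have gr: "(\<lambda>r. g (r - p \<zeta>)) \<in> L2_on {a..b}"
    proof -
      have "loc_L2 (\<lambda>x. g (0 - (p \<zeta> - x)))"
        using loc_L2_reflect[OF loc_L2_reflect[OF g, of 0], of "p \<zeta>"] .
      then show ?thesis using loc_L2_L2_on by simp
    qed
    then have h: "h \<in> L2_on {a..b}"
      unfolding h_def zsol_def by (intro L2_on_diff L2_on_scaleR L2_on_continuous[OF continuous_on_const] gr)
    have "(\<lambda>r. zsol g r \<zeta>) integrable_on {a..b}"
      using wsol_eq_integral[OF g \<open>a \<le> b\<close>, of \<zeta>] by blast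
    then have "integral {a..b} h = integral {a..b} (\<lambda>_. zsol g s \<zeta>) - integral {a..b} (\<lambda>r. zsol g r \<zeta>)"
      unfolding h_def by (intro Henstock_Kurzweil_Integration.integral_diff integrable_const_ivl)
    then have "Y \<zeta> = integral {a..b} h"
      using \<open>a \<le> b\<close> by (simp add: Y_def)
    then have "norm (Y \<zeta>) \<le> sqrt (b - a) * L2_norm_on {a..b} h"
      using L2_on_integrable(2)[OF h] by simp
    then have "(norm (Y \<zeta>))\<^sup>2 \<le> (b - a) * (L2_norm_on {a..b} h)\<^sup>2"
      using power_mono[of "norm (Y \<zeta>)" _ 2] \<open>a \<le> b\<close> by (fastforce simp: power_mult_distrib)
    then have "ennreal ((norm (Y \<zeta>))\<^sup>2) \<le> ennreal (b - a) * ennreal ((L2_norm_on {a..b} h)\<^sup>2)"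
      using \<open>a \<le> b\<close> by (simp add: ennreal_leI flip: ennreal_mult')
    also have "ennreal ((L2_norm_on {a..b} h)\<^sup>2) = ?N"
      using nn_integral_L2_norm_on[OF h] by (simp add: nn_integral_lebesgue_on h_def)
    finally show ?thesis .
  qed
  have "energy {0..1} Y
     \<le> (\<integral>\<^sup>+\<zeta>. \<integral>\<^sup>+r. ennreal (b - a) * (ennreal ((norm (zsol g s \<zeta> - zsol g r \<zeta>))\<^sup>2)
          * indicator {a..b} r * indicator {0..1} \<zeta>) \<partial>lborel \<partial>lborel)"
  proof (rule nn_integral_mono)
    fix \<zeta>
    have [measurable]: "(\<lambda>r. zsol g r \<zeta>) \<in> borel_measurable borel" unfolding zsol_def by measurable
    show "ennreal ((norm (Y \<zeta>))\<^sup>2) * indicator {0..1} \<zeta> \<le> (\<integral>\<^sup>+r. ennreal (b - a) * (ennreal ((norm (zsol g s \<zeta> - zsol g r \<zeta>))\<^sup>2)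
          * indicator {a..b} r * indicator {0..1} \<zeta>) \<partial>lborel)"
      using pt[of \<zeta>] by (cases "\<zeta> \<in> {0..1}") (auto simp: nn_integral_cmult)
  qed
  also have "\<dots> = (\<integral>\<^sup>+r. \<integral>\<^sup>+\<zeta>. ennreal (b - a) * (ennreal ((norm (zsol g s \<zeta> - zsol g r \<zeta>))\<^sup>2)
          * indicator {a..b} r * indicator {0..1} \<zeta>) \<partial>lborel \<partial>lborel)"
  proof (rule lborel_pair.Fubini')
    show "(\<lambda>(r, \<zeta>). ennreal (b - a) * (ennreal ((norm (zsol g s \<zeta> - zsol g r \<zeta>))\<^sup>2)
          * indicator {a..b} r * indicator {0..1} \<zeta>)) \<in> borel_measurable (lborel \<Otimes>\<^sub>M lborel)"
      unfolding zsol_def by measurable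
  qed
  also have "\<dots> = (\<integral>\<^sup>+r. ennreal (b - a) * (indicator {a..b} r *
      energy {0..1} (\<lambda>\<zeta>. zsol g s \<zeta> - zsol g r \<zeta>)) \<partial>lborel)"
    by (intro nn_integral_cong) (auto simp: nn_integral_cmult indicator_def)
  also have "\<dots> \<le> (\<integral>\<^sup>+r. ennreal (b - a) * (ennreal (e\<^sup>2) * indicator {a..b} r) \<partial>lborel)"
    using close by (intro nn_integral_mono mult_left_mono) (auto simp: indicator_def)
  also have "\<dots> = ennreal (b - a) * (ennreal (e\<^sup>2) * ennreal (b - a))"
    using \<open>a \<le> b\<close> by (simp add: nn_integral_cmult nn_integral_cmult_indicator)
  also have "\<dots> = ennreal (((b - a) * e)\<^sup>2)"
    using \<open>a \<le> b\<close> by (simp add: power_mult_distrib power2_eq_square mult_ac flip: ennreal_mult')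
  finally have le: "energy {0..1} Y \<le> ennreal (((b - a) * e)\<^sup>2)" .
  also have "\<dots> < \<infinity>" by simp
  finally show "Y \<in> L2_on {0..1}" by (simp add: L2_on_borel_iff)
  show "L2_norm_on {0..1} Y \<le> (b - a) * e"
    using le \<open>a \<le> b\<close> \<open>0 \<le> e\<close> by (intro L2_norm_on_borel_le) auto
qed

lemma wsol_X_integral:
  assumes g: "loc_L2 g" and "0 \<le> t"
  shows "X_integral (zsol g) t (\<lambda>\<zeta>. rate \<zeta> *\<^sub>R wsol g t \<zeta>)"
  unfolding X_integral_def
proof (intro conjI allI impI)
  define Z where "Z = (\<lambda>\<zeta>. rate \<zeta> *\<^sub>R wsol g t \<zeta>)"
  have Z: "((\<lambda>r. zsol g r \<zeta>) has_integral Z \<zeta>) {0..t}" for \<zeta>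
    using wsol_eq_integral[OF g \<open>0 \<le> t\<close>] by (simp add: Z_def wsol_def)
  have gm [measurable]: "g \<in> borel_measurable borel" using g by (simp add: loc_L2_def)
  have cont: "continuous_on {0..1} (wsol g t)"
    unfolding wsol_def
    by (intro continuous_intros continuous_on_compose2[OF continuous_on_prim[OF loc_L2_integrable_on[OF g], of UNIV]] p_continuous) auto
  show "(\<lambda>\<zeta>. rate \<zeta> *\<^sub>R wsol g t \<zeta>) \<in> L2_on {0..1}"
  proof -
    have [measurable]: "prim g \<in> borel_measurable borel"
      by (rule borel_measurable_continuous_onI[OF continuous_on_prim[OF loc_L2_integrable_on[OF g]]])
    have [measurable]: "(\<lambda>\<zeta>. rate \<zeta> *\<^sub>R wsol g t \<zeta>) \<in> borel_measurable (lebesgue_on {0..1})"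
      unfolding wsol_def by (intro borel_measurable_lebesgue_onI) measurable
    have "integrable (lebesgue_on {0..1}) (\<lambda>\<zeta>. (norm (rate \<zeta> *\<^sub>R wsol g t \<zeta>))\<^sup>2)"
    proof (rule Bochner_Integration.integrable_bound)
      show "integrable (lebesgue_on {0..1}) (\<lambda>\<zeta>. (norm (inverse lo *\<^sub>R wsol g t \<zeta>))\<^sup>2)"
        by (rule L2_onD(2)[OF L2_on_scaleR[OF L2_on_continuous[OF cont]]])
      show "AE \<zeta> in lebesgue_on {0..1}. norm ((norm (rate \<zeta> *\<^sub>R wsol g t \<zeta>))\<^sup>2) \<le> norm ((norm (inverse lo *\<^sub>R wsol g t \<zeta>))\<^sup>2)"
        using rate_bounds lo_pos by (intro AE_I2) (auto intro!: power_mono mult_right_mono simp: less_imp_le)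
    qed measurable
    then show ?thesis by (simp add: L2_on_def)
  qed
  fix e :: real assume "0 < e"
  \<comment> \<open>The cell errors add up to \<open>t * e'\<close>; the summand 1 covers
    \<open>t = 0\<close>.\<close>
  define e' where "e' = e / (2 * (t + 1))"
  have e': "e' > 0" "t * e' < e" using \<open>0 < e\<close> \<open>0 \<le> t\<close> by (auto simp: e'_def field_simps add_nonneg_pos)
  obtain d where d: "0 < d" "\<And>s t'. s \<in> {0..t} \<Longrightarrow> t' \<in> {0..t} \<Longrightarrow> \<bar>s - t'\<bar> < d \<Longrightarrow>
      energy {0..1} (\<lambda>\<zeta>. zsol g s \<zeta> - zsol g t' \<zeta>) \<le> ennreal (e'\<^sup>2)"
    by (rule zsol_uniform[OF g e'(1), of 0 t]) auto
  show "\<exists>d>0. \<forall>D. D tagged_division_of {0..t} \<and> (\<lambda>s. ball s d) fine D \<longrightarrow>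
      L2_norm_on {0..1} (\<lambda>\<zeta>. (\<Sum>(s, k)\<in>D. measure lborel k *\<^sub>R zsol g s \<zeta>) - rate \<zeta> *\<^sub>R wsol g t \<zeta>) < e"
  proof (intro exI[of _ d] conjI allI impI)
    fix D assume D: "D tagged_division_of {0..t} \<and> (\<lambda>s. ball s d) fine D"
    define Y where "Y = (\<lambda>(s, k) \<zeta>. measure lborel k *\<^sub>R zsol g s \<zeta> - integral k (\<lambda>r. zsol g r \<zeta>))"
    have cell: "Y x \<in> L2_on {0..1} \<and> L2_norm_on {0..1} (Y x) \<le> measure lborel (snd x) * e'" if x: "x \<in> D" for x
    proof -
      obtain s k where x_eq: "x = (s, k)" by force
      have "s \<in> k" "k \<subseteq> {0..t}" using D x tagged_division_ofD(2,3) unfolding x_eq by auto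
      obtain a b where k: "k = {a..b}" using D x tagged_division_ofD(4) unfolding x_eq by (metis box_real(2))
      have "k \<subseteq> ball s d" using D x unfolding x_eq fine_def by auto
      have "a \<le> b" using \<open>s \<in> k\<close> k by simp
      have "energy {0..1} (\<lambda>\<zeta>. zsol g s \<zeta> - zsol g r \<zeta>) \<le> ennreal (e'\<^sup>2)"
        if "r \<in> {a..b}" for r
        using that \<open>s \<in> k\<close> \<open>k \<subseteq> {0..t}\<close> \<open>k \<subseteq> ball s d\<close> unfolding k by (intro d(2)) (auto simp: dist_real_def subset_iff)
      from wsol_X_integral_cell[OF g \<open>a \<le> b\<close> less_imp_le[OF e'(1)] this]
      show ?thesis using \<open>a \<le> b\<close> by (simp add: Y_def x_eq k)
    qed
    \<comment> \<open>The integral \<open>Z\<close> also splits over the cells, so the error of the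
      Riemann sum is the sum of the cell errors.\<close>
    have "(\<Sum>(s, k)\<in>D. measure lborel k *\<^sub>R zsol g s \<zeta>) - Z \<zeta> = (\<Sum>x\<in>D. Y x \<zeta>)" for \<zeta>
    proof -
      have "Z \<zeta> = (\<Sum>(s, k)\<in>D. integral k (\<lambda>r. zsol g r \<zeta>))"
        using integral_combine_tagged_division_topdown[of "\<lambda>r. zsol g r \<zeta>" 0 t D] D Z[of \<zeta>]
        by (auto simp: integral_unique integrable_on_def)
      then show ?thesis by (simp add: Y_def sum_subtractf case_prod_unfold)
    qed
    then have "L2_norm_on {0..1} (\<lambda>\<zeta>. (\<Sum>(s, k)\<in>D. measure lborel k *\<^sub>R zsol g s \<zeta>) - Z \<zeta>)
        = L2_norm_on {0..1} (\<lambda>\<zeta>. \<Sum>x\<in>D. Y x \<zeta>)" by simp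
    also have "\<dots> \<le> (\<Sum>x\<in>D. L2_norm_on {0..1} (Y x))"
      using cell by (intro L2_norm_on_sum_le) auto
    also have "\<dots> \<le> (\<Sum>x\<in>D. measure lborel (snd x) * e')"
      using cell by (intro sum_mono) auto
    also have "\<dots> = t * e'"
      using additive_content_tagged_division[of D 0 t] D \<open>0 \<le> t\<close>
      by (simp add: case_prod_unfold flip: sum_distrib_right)
    also have "\<dots> < e" by (rule e')
    finally show "L2_norm_on {0..1} (\<lambda>\<zeta>. (\<Sum>(s, k)\<in>D. measure lborel k *\<^sub>R zsol g s \<zeta>) - rate \<zeta> *\<^sub>R wsol g t \<zeta>) < e"
      by (simp add: Z_def)
  qed (rule d(1))
qed

lemma zsol_integral:
  assumes g: "loc_L2 g" and "0 \<le> \<zeta>"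
  shows "(zsol g t has_integral (prim g t - prim g (t - p \<zeta>))) {0..\<zeta>}"
proof -
  note g' = loc_L2_reflect[OF g, of t]
  have "(zsol g t has_integral integral {p 0..p \<zeta>} (\<lambda>x. g (t - x))) {0..\<zeta>}"
    unfolding zsol_def[abs_def] using g' by (intro integral_substitution loc_L2_set_integrable) (simp add: loc_L2_def)
  also have "integral {p 0..p \<zeta>} (\<lambda>x. g (t - x)) = integral {t - p \<zeta>..t} g"
    by (simp add: integral_reflect_shift)
  also have "\<dots> = prim g t - prim g (t - p \<zeta>)"
    using p_le_iff[of 0 \<zeta>] \<open>0 \<le> \<zeta>\<close> by (intro prim_diff loc_L2_integrable_on g) simp
  finally show ?thesis .
qed

text \<open>The factors \<open>l\<close> and \<open>rate\<close> cancel, so \<open>wsol g t\<close>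
  is itself the continuous representative; its increments in space come from
  \<open>zsol_integral\<close>.\<close>

lemma zsol_mild:
  assumes g: "loc_L2 g"
  shows "transport_mild l (zsol g 0) (zsol g) (wsol g)"
  unfolding transport_mild_def
proof (intro conjI allI impI zsol_continuous[OF g])
  fix t :: real assume "0 \<le> t"
  have cont: "continuous_on {0..1} (wsol g t)"
    unfolding wsol_def
    by (intro continuous_intros continuous_on_compose2[OF continuous_on_prim[OF loc_L2_integrable_on[OF g], of UNIV]] p_continuous) auto
  have "H1_derivative (\<lambda>\<zeta>. l \<zeta> *\<^sub>R rate \<zeta> *\<^sub>R wsol g t \<zeta>) (\<lambda>\<zeta>. - (zsol g t \<zeta> - zsol g 0 \<zeta>)) (wsol g t)"
    unfolding H1_derivative_def
  proof (intro conjI ballI)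
    show "(\<lambda>\<zeta>. l \<zeta> *\<^sub>R rate \<zeta> *\<^sub>R wsol g t \<zeta>) \<in> L2_on {0..1}"
      using L2_on_continuous[OF cont] by (simp add: l_rate)
    show "(\<lambda>\<zeta>. - (zsol g t \<zeta> - zsol g 0 \<zeta>)) \<in> L2_on {0..1}"
      by (intro L2_on_minus L2_on_diff zsol_L2 g)
    show "AE \<zeta> in lebesgue_on {0..1}. l \<zeta> *\<^sub>R rate \<zeta> *\<^sub>R wsol g t \<zeta> = wsol g t \<zeta>"
      by (simp add: l_rate)
    fix \<zeta> :: real assume "\<zeta> \<in> {0..1}"
    then have "0 \<le> \<zeta>" by simp
    have "((\<lambda>\<zeta>. - (zsol g t \<zeta> - zsol g 0 \<zeta>)) has_integral
        - ((prim g t - prim g (t - p \<zeta>)) - (prim g 0 - prim g (0 - p \<zeta>)))) {0..\<zeta>}"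
      by (intro has_integral_neg has_integral_diff zsol_integral[OF g \<open>0 \<le> \<zeta>\<close>])
    then have "integral {0..\<zeta>} (\<lambda>\<zeta>. - (zsol g t \<zeta> - zsol g 0 \<zeta>))
        = - ((prim g t - prim g (t - p \<zeta>)) - (prim g 0 - prim g (0 - p \<zeta>)))"
      by (rule integral_unique)
    then show "wsol g t \<zeta> = wsol g t 0 + integral {0..\<zeta>} (\<lambda>\<zeta>. - (zsol g t \<zeta> - zsol g 0 \<zeta>))"
      by (simp add: wsol_def)
  qed
  then show "\<exists>Z. X_integral (zsol g) t Z \<and>
      H1_derivative (\<lambda>\<zeta>. l \<zeta> *\<^sub>R Z \<zeta>) (\<lambda>\<zeta>. - (zsol g t \<zeta> - zsol g 0 \<zeta>)) (wsol g t)"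
    using wsol_X_integral[OF g \<open>0 \<le> t\<close>] by blast
qed

end

subsection \<open>Uniqueness of mild solutions\<close>

lemma zero_if_integrals_zero:
  fixes f :: "real \<Rightarrow> 'a::euclidean_space"
  assumes "0 < L" "continuous_on {0..L} f" "\<And>x. x \<in> {0..L} \<Longrightarrow> integral {0..x} f = 0" "x \<in> {0..L}"
  shows "f x = 0"
proof (rule vector_derivative_unique_within_closed_interval[OF assms(1)])
  show "x \<in> cbox 0 L" using assms(4) by simp
  show "((\<lambda>u. integral {0..u} f) has_vector_derivative f x) (at x within cbox 0 L)"
    using integral_has_vector_derivative[OF assms(2,4)] by simp
  show "((\<lambda>u. integral {0..u} f) has_vector_derivative 0) (at x within cbox 0 L)"
    by (rule has_vector_derivative_transform[OF _ _ has_vector_derivative_const[of 0]])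
      (use assms(3,4) in auto)
qed

lemma integral_near_constant:
  fixes f :: "real \<Rightarrow> 'a::euclidean_space"
  assumes "a \<le> b" "continuous_on {a..b} f" "\<And>x. x \<in> {a..b} \<Longrightarrow> norm (f x - c) \<le> e"
  shows "norm (integral {a..b} f - (b - a) *\<^sub>R c) \<le> e * (b - a)"
proof -
  have "integral {a..b} (\<lambda>x. f x - c) = integral {a..b} f - (b - a) *\<^sub>R c"
    using assms(1) by (subst Henstock_Kurzweil_Integration.integral_diff)
      (auto intro: integrable_continuous_real assms(2))
  moreover have "norm (integral {a..b} (\<lambda>x. f x - c)) \<le> e * (b - a)"
    using assms by (intro integral_bound continuous_intros) auto
  ultimately show ?thesis by simp
qed

text \<open>The hypothesis says that \<open>\<Phi>(t,x) = \<integral>\<^sub>0\<^sup>x E(t,\<cdot>) = -\<integral>\<^sub>0\<^sup>t E(\<cdot>,x)\<close> satisfies \<open>\<Phi>\<^sub>t + \<Phi>\<^sub>x = 0\<close>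
  and vanishes for \<open>t = 0\<close> and for \<open>x = 0\<close>; hence it is constant along characteristics.\<close>

lemma characteristic_zero:
  fixes E :: "real \<Rightarrow> real \<Rightarrow> 'a::euclidean_space"
  assumes "0 < L" and cont: "continuous_on ({0..} \<times> {0..L}) (\<lambda>(t, x). E t x)"
    and eq: "\<And>t x. 0 \<le> t \<Longrightarrow> x \<in> {0..L} \<Longrightarrow> integral {0..x} (E t) + integral {0..t} (\<lambda>s. E s x) = 0"
    and "0 \<le> t" "x \<in> {0..L}"
  shows "E t x = 0"
proof -
  define \<Phi> where "\<Phi> t x = integral {0..x} (E t)" for t x
  have contx: "continuous_on S (E t)" if "0 \<le> t" "S \<subseteq> {0..L}" for t S
  proof -
    have "continuous_on S (\<lambda>x. (\<lambda>(t, x). E t x) (t, x))"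
      by (rule continuous_on_compose2[OF cont]) (use that in \<open>auto intro!: continuous_intros\<close>)
    then show ?thesis by simp
  qed
  have contt: "continuous_on S (\<lambda>t. E t x)" if "x \<in> {0..L}" "S \<subseteq> {0..}" for x S
  proof -
    have "continuous_on S (\<lambda>t. (\<lambda>(t, x). E t x) (t, x))"
      by (rule continuous_on_compose2[OF cont]) (use that in \<open>auto intro!: continuous_intros\<close>)
    then show ?thesis by simp
  qed
  have \<Phi>2: "\<Phi> t x = - integral {0..t} (\<lambda>s. E s x)" if "0 \<le> t" "x \<in> {0..L}" for t x
    using eq[OF that] by (simp add: \<Phi>_def eq_neg_iff_add_eq_0)
  have "\<Phi> t x = 0" if "0 \<le> t" "x \<in> {0..L}" for t x
  proof -
    \<comment> \<open>The time needed to follow the characteristic through \<open>(t, x)\<close>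
      backwards until it meets \<open>t = 0\<close> or \<open>x = 0\<close>.\<close>
    define m where "m = min t x"
    define \<phi> where "\<phi> r = \<Phi> (t - r) (x - r)" for r
    have "m \<ge> 0" using that by (simp add: m_def)
    have "compact ({0..t} \<times> {0..x})" by (intro compact_Times) auto
    moreover have "continuous_on ({0..t} \<times> {0..x}) (\<lambda>(t, x). E t x)"
      by (rule continuous_on_subset[OF cont]) (use that in auto)
    ultimately have uc: "uniformly_continuous_on ({0..t} \<times> {0..x}) (\<lambda>(t, x). E t x)"
      by (rule compact_uniformly_continuous[rotated])
    have "(\<phi> has_derivative (\<lambda>_. 0)) (at r within {0..m})" if r: "r \<in> {0..m}" for r
      unfolding has_derivative_within_alt
    proof (intro conjI allI impI bounded_linear_zero)
      fix e :: real assume "0 < e"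
      then obtain d where d: "d > 0" "\<And>u v. u \<in> {0..t} \<times> {0..x} \<Longrightarrow> v \<in> {0..t} \<times> {0..x} \<Longrightarrow> dist v u < d \<Longrightarrow>
          dist ((\<lambda>(t, x). E t x) v) ((\<lambda>(t, x). E t x) u) < e / 2"
        using uc unfolding uniformly_continuous_on_def by (metis half_gt_zero)
      \<comment> \<open>The partial derivatives of \<open>\<Phi>\<close> are \<open>E\<close> in
        space and \<open>-E\<close> in time. The diagonal increment is split into a step in space
        and a step in time; each is close to the same multiple of \<open>c\<close>, and the two
        cancel.\<close>
      have main: "norm (\<phi> r - \<phi> y) \<le> e * (y - r)" if ry: "r \<in> {0..m}" "y \<in> {0..m}" "r \<le> y" "y - r < d / 2" for r y
      proof -
        define c where "c = E (t - r) (x - r)"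
        have dom: "0 \<le> t - y" "t - r \<le> t" "0 \<le> x - y" "x - r \<le> x" "t - y \<le> t - r" "x - y \<le> x - r"
          using ry by (auto simp: m_def)
        have close: "norm (E s \<xi> - c) \<le> e / 2" if "s \<in> {t - y..t - r}" "\<xi> \<in> {x - y..x - r}" for s \<xi>
        proof -
          have "dist (s, \<xi>) (t - r, x - r) \<le> \<bar>s - (t - r)\<bar> + \<bar>\<xi> - (x - r)\<bar>"
            unfolding dist_Pair_Pair dist_real_def by (rule sqrt_sum_squares_le_sum_abs[THEN order_trans]) simp
          also have "\<dots> < d" using that ry by auto
          finally have "dist (E s \<xi>) c < e / 2"
            using d(2)[of "(t - r, x - r)" "(s, \<xi>)"] that dom by (auto simp: c_def)
          then show ?thesis by (simp add: dist_norm)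
        qed
        have xL: "{0..x} \<subseteq> {0..L}" using \<open>x \<in> {0..L}\<close> by auto
        have "integral {0..x - y} (E (t - r)) + integral {x - y..x - r} (E (t - r)) = integral {0..x - r} (E (t - r))"
          using dom xL by (intro Henstock_Kurzweil_Integration.integral_combine integrable_continuous_real contx) auto
        then have 1: "\<Phi> (t - r) (x - r) - \<Phi> (t - r) (x - y) = integral {x - y..x - r} (E (t - r))"
          by (simp add: \<Phi>_def algebra_simps)
        have xy: "x - y \<in> {0..L}" using dom xL by auto
        have "integral {0..t - y} (\<lambda>s. E s (x - y)) + integral {t - y..t - r} (\<lambda>s. E s (x - y)) = integral {0..t - r} (\<lambda>s. E s (x - y))"
          using dom xy by (intro Henstock_Kurzweil_Integration.integral_combine integrable_continuous_real contt) auto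
        then have 2: "\<Phi> (t - r) (x - y) - \<Phi> (t - y) (x - y) = - integral {t - y..t - r} (\<lambda>s. E s (x - y))"
          using dom xy by (simp add: \<Phi>2 algebra_simps)
        have "\<phi> r - \<phi> y = (integral {x - y..x - r} (E (t - r)) - (x - r - (x - y)) *\<^sub>R c)
            - (integral {t - y..t - r} (\<lambda>s. E s (x - y)) - (t - r - (t - y)) *\<^sub>R c)"
          using 1 2 by (simp add: \<phi>_def algebra_simps)
        also have "norm \<dots> \<le> e / 2 * (x - r - (x - y)) + e / 2 * (t - r - (t - y))"
          using dom xL xy by (intro order_trans[OF norm_triangle_ineq4] add_mono integral_near_constant contx contt close) auto
        also have "\<dots> = e * (y - r)" by (simp add: field_simps)
        finally show ?thesis .
      qed
      show "\<exists>d>0. \<forall>y\<in>{0..m}. norm (y - r) < d \<longrightarrow> norm (\<phi> y - \<phi> r - 0) \<le> e * norm (y - r)"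
      proof (intro exI[of _ "d / 2"] conjI ballI impI)
        fix y assume "y \<in> {0..m}" "norm (y - r) < d / 2"
        then show "norm (\<phi> y - \<phi> r - 0) \<le> e * norm (y - r)"
          using main[of r y] main[of y r] r by (cases "r \<le> y") (auto simp: norm_minus_commute abs_if)
      qed (use d in simp)
    qed
    then have "\<phi> m = \<phi> 0"
      using \<open>m \<ge> 0\<close> by (intro has_derivative_zero_unique[of "{0..m}"]) auto
    moreover have "\<phi> m = 0"
      using that \<Phi>2[of 0 "x - t"] by (cases "t \<le> x") (auto simp: \<phi>_def m_def \<Phi>_def min_def)
    ultimately show ?thesis by (simp add: \<phi>_def)
  qed
  then have "integral {0..x} (E t) = 0" if "x \<in> {0..L}" for x
    using that \<open>0 \<le> t\<close> by (simp add: \<Phi>_def)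
  then show ?thesis
    using zero_if_integrals_zero[OF \<open>0 < L\<close> contx[OF \<open>0 \<le> t\<close> order_refl] _ \<open>x \<in> {0..L}\<close>] by blast
qed

section \<open>A priori regularity and representation of an arbitrary mild solution\<close>

context transport
begin

context
  fixes z0 :: "real \<Rightarrow> 'a::euclidean_space" and z w
  assumes z0: "z0 \<in> L2_on {0..1}" and sol: "transport_mild l z0 z w"
begin

text \<open>Mass of the initial state on \<open>{0..\<zeta>}\<close>; the classes \<open>z t\<close>
  are accessed through such masses.\<close>

definition I where "I \<zeta> = integral {0..\<zeta>} z0"

lemma z_L2: "0 \<le> t \<Longrightarrow> z t \<in> L2_on {0..1}"
  using sol by (simp add: transport_mild_def X_continuous_def)

lemma z_lim: "0 \<le> t \<Longrightarrow> ((\<lambda>s. L2_norm_on {0..1} (\<lambda>\<zeta>. z s \<zeta> - z t \<zeta>)) \<longlongrightarrow> 0) (at t within {0..})"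
  using sol by (simp add: transport_mild_def X_continuous_def)

lemma z_integral:
  assumes "0 \<le> t" "\<zeta> \<in> {0..1}"
  shows "integral {0..\<zeta>} (\<lambda>\<eta>. z t \<eta> - z0 \<eta>) = w t 0 - w t \<zeta>"
    and "integral {0..\<zeta>} (z t) = w t 0 - w t \<zeta> + I \<zeta>"
proof -
  have "w t \<zeta> = w t 0 + integral {0..\<zeta>} (\<lambda>\<eta>. - (z t \<eta> - z0 \<eta>))"
    using sol assms unfolding transport_mild_def H1_derivative_def by blast
  then show 1: "integral {0..\<zeta>} (\<lambda>\<eta>. z t \<eta> - z0 \<eta>) = w t 0 - w t \<zeta>"
    by (simp only: Henstock_Kurzweil_Integration.integral_neg) simp
  have "integral {0..\<zeta>} (\<lambda>\<eta>. z t \<eta> - z0 \<eta>) = integral {0..\<zeta>} (z t) - I \<zeta>"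
    unfolding I_def using assms z0 z_L2
    by (intro Henstock_Kurzweil_Integration.integral_diff L2_on_integrable_on(1)) auto
  then show "integral {0..\<zeta>} (z t) = w t 0 - w t \<zeta> + I \<zeta>" using 1 by (simp add: algebra_simps)
qed

text \<open>Relative to its inlet value, \<open>w\<close> is a mass and inherits the continuity of
  \<open>z\<close>. The inlet value itself needs a separate argument,
  \<open>w_0_lim\<close>.\<close>

lemma w_difference:
  assumes "0 \<le> s" "0 \<le> t" "\<zeta> \<in> {0..1}"
  shows "norm ((w s 0 - w s \<zeta>) - (w t 0 - w t \<zeta>)) \<le> L2_norm_on {0..1} (\<lambda>\<zeta>. z s \<zeta> - z t \<zeta>)"
proof -
  have "(w s 0 - w s \<zeta>) - (w t 0 - w t \<zeta>) = integral {0..\<zeta>} (\<lambda>\<eta>. z s \<eta> - z t \<eta>)"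
    using z_integral(2)[OF assms(1,3)] z_integral(2)[OF assms(2,3)] assms z_L2
    by (subst Henstock_Kurzweil_Integration.integral_diff) (auto intro!: L2_on_integrable_on(1))
  also have "norm \<dots> \<le> sqrt (1 - 0) * L2_norm_on {0..1} (\<lambda>\<zeta>. z s \<zeta> - z t \<zeta>)"
    using assms z_L2 by (intro L2_on_integrable_on(3) L2_on_diff) auto
  finally show ?thesis by simp
qed

lemma w_continuous_space:
  assumes "0 \<le> t"
  shows "continuous_on {0..1} (w t)"
proof -
  have "(\<lambda>\<eta>. z t \<eta> - z0 \<eta>) integrable_on {0..1}"
    using assms z_L2 z0 by (intro L2_on_integrable_on(1)[OF L2_on_diff]) auto
  then have "continuous_on {0..1} (\<lambda>\<zeta>. w t 0 - integral {0..\<zeta>} (\<lambda>\<eta>. z t \<eta> - z0 \<eta>))"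
    by (intro continuous_intros indefinite_integral_continuous_1)
  then show ?thesis
    by (rule continuous_on_eq) (simp add: z_integral(1)[OF assms])
qed

text \<open>Integration over \<open>{0..\<zeta>}\<close> is a bounded functional on the state space.
  Applied to the Riemann sums of \<open>X_integral\<close>, it turns the state-valued integral into
  an ordinary gauge integral in time, with no joint measurability involved.\<close>

lemma w_time_integral:
  assumes "0 \<le> t" "\<zeta> \<in> {0..1}"
  shows "((\<lambda>s. w s 0 - w s \<zeta> + I \<zeta>) has_integral integral {0..\<zeta>} (\<lambda>\<eta>. rate \<eta> *\<^sub>R w t \<eta>)) {0..t}"
proof -
  obtain Z where XZ: "X_integral z t Z" and HZ: "H1_derivative (\<lambda>\<zeta>. l \<zeta> *\<^sub>R Z \<zeta>) (\<lambda>\<zeta>. - (z t \<zeta> - z0 \<zeta>)) (w t)"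
    using sol assms(1) unfolding transport_mild_def by blast
  have Z: "Z \<in> L2_on {0..1}" using XZ by (simp add: X_integral_def)
  have "AE \<eta> in lebesgue_on {0..1}. l \<eta> *\<^sub>R Z \<eta> = w t \<eta>"
    using HZ unfolding H1_derivative_def by blast
  then have "AE \<eta> in lborel. \<eta> \<in> {0..1} \<longrightarrow> l \<eta> *\<^sub>R Z \<eta> = w t \<eta>"
    by (subst (asm) AE_lebesgue_on_iff) simp_all
  then have "AE \<eta> in lborel. \<eta> \<in> {0..\<zeta>} \<longrightarrow> Z \<eta> = rate \<eta> *\<^sub>R w t \<eta>"
  proof eventually_elim
    case (elim \<eta>)
    show ?case
    proof
      assume "\<eta> \<in> {0..\<zeta>}"
      then have "l \<eta> *\<^sub>R Z \<eta> = w t \<eta>" using elim assms(2) by auto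
      then have "rate \<eta> *\<^sub>R w t \<eta> = rate \<eta> *\<^sub>R l \<eta> *\<^sub>R Z \<eta>" by (simp only:)
      then show "Z \<eta> = rate \<eta> *\<^sub>R w t \<eta>" by (simp add: l_rate)
    qed
  qed
  then have Zint: "integral {0..\<zeta>} Z = integral {0..\<zeta>} (\<lambda>\<eta>. rate \<eta> *\<^sub>R w t \<eta>)"
    unfolding integral_def integrable_on_def by (simp only: has_integral_AE)
  show ?thesis
    unfolding Zint[symmetric] has_integral_real
  proof (intro allI impI)
    fix e :: real assume "0 < e"
    then obtain d where d: "d > 0" "\<And>D. D tagged_division_of {0..t} \<Longrightarrow> (\<lambda>s. ball s d) fine D \<Longrightarrow>
        L2_norm_on {0..1} (\<lambda>\<zeta>. (\<Sum>(s, k)\<in>D. measure lborel k *\<^sub>R z s \<zeta>) - Z \<zeta>) < e"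
      using XZ unfolding X_integral_def by blast
    show "\<exists>\<gamma>. gauge \<gamma> \<and> (\<forall>D. D tagged_division_of {0..t} \<and> \<gamma> fine D \<longrightarrow>
        norm ((\<Sum>(s, k)\<in>D. measure lborel k *\<^sub>R (w s 0 - w s \<zeta> + I \<zeta>)) - integral {0..\<zeta>} Z) < e)"
    proof (intro exI[of _ "\<lambda>s. ball s d"] conjI allI impI gauge_ball d(1))
      fix D assume D: "D tagged_division_of {0..t} \<and> (\<lambda>s. ball s d) fine D"
      have fin: "finite D" using D tagged_division_ofD(1) by blast
      have tag: "0 \<le> s" if "(s, k) \<in> D" for s k
      proof -
        have "s \<in> k" "k \<subseteq> {0..t}" using D that tagged_division_ofD(2,3) by auto
        then show ?thesis by auto
      qed
      have zD: "(\<lambda>\<zeta>. measure lborel k *\<^sub>R z s \<zeta>) \<in> L2_on {0..1}" if "(s, k) \<in> D" for s k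
        using tag[OF that] by (intro L2_on_scaleR z_L2)
      have sumL2: "(\<lambda>\<zeta>. \<Sum>x\<in>D. measure lborel (snd x) *\<^sub>R z (fst x) \<zeta>) \<in> L2_on {0..1}"
        using zD by (intro L2_on_sum) auto
      have "integral {0..\<zeta>} (\<lambda>\<zeta>. (\<Sum>x\<in>D. measure lborel (snd x) *\<^sub>R z (fst x) \<zeta>) - Z \<zeta>)
          = integral {0..\<zeta>} (\<lambda>\<zeta>. \<Sum>x\<in>D. measure lborel (snd x) *\<^sub>R z (fst x) \<zeta>) - integral {0..\<zeta>} Z"
        using assms(2) by (intro Henstock_Kurzweil_Integration.integral_diff L2_on_integrable_on(1)[OF sumL2] L2_on_integrable_on(1)[OF Z]) auto
      also have "integral {0..\<zeta>} (\<lambda>\<zeta>. \<Sum>x\<in>D. measure lborel (snd x) *\<^sub>R z (fst x) \<zeta>)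
          = (\<Sum>x\<in>D. integral {0..\<zeta>} (\<lambda>\<zeta>. measure lborel (snd x) *\<^sub>R z (fst x) \<zeta>))"
        using assms(2) zD fin by (intro Henstock_Kurzweil_Integration.integral_sum L2_on_integrable_on(1)[of _ 0 1]) auto
      also have "\<dots> = (\<Sum>x\<in>D. measure lborel (snd x) *\<^sub>R (w (fst x) 0 - w (fst x) \<zeta> + I \<zeta>))"
        using tag assms(2) by (intro sum.cong refl) (auto simp: z_integral(2))
      finally have "(\<Sum>(s, k)\<in>D. measure lborel k *\<^sub>R (w s 0 - w s \<zeta> + I \<zeta>)) - integral {0..\<zeta>} Z
          = integral {0..\<zeta>} (\<lambda>\<zeta>. (\<Sum>x\<in>D. measure lborel (snd x) *\<^sub>R z (fst x) \<zeta>) - Z \<zeta>)"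
        by (simp add: case_prod_unfold)
      also have "norm \<dots> \<le> sqrt (1 - 0) * L2_norm_on {0..1} (\<lambda>\<zeta>. (\<Sum>x\<in>D. measure lborel (snd x) *\<^sub>R z (fst x) \<zeta>) - Z \<zeta>)"
        using assms(2) by (intro L2_on_integrable_on(3) L2_on_diff sumL2 Z) auto
      also have "\<dots> < e" using d(2)[of D] D by (simp add: case_prod_unfold)
      finally show "norm ((\<Sum>(s, k)\<in>D. measure lborel k *\<^sub>R (w s 0 - w s \<zeta> + I \<zeta>)) - integral {0..\<zeta>} Z) < e" .
    qed
  qed
qed

lemma rate_w_integrable:
  assumes "continuous_on {0..1} (f :: real \<Rightarrow> 'a)"
  shows "(\<lambda>\<eta>. rate \<eta> *\<^sub>R f \<eta>) integrable_on {0..1}"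
proof -
  have "(\<lambda>\<eta>. rate \<eta> *\<^sub>R f \<eta>) absolutely_integrable_on {0..1}"
  proof (rule absolutely_integrable_bounded_measurable_product[of "(*\<^sub>R)"])
    show "bilinear ((*\<^sub>R) :: real \<Rightarrow> 'a \<Rightarrow> 'a)" by (simp add: bilinear_def linear_iff algebra_simps)
    show "rate \<in> borel_measurable (lebesgue_on {0..1})" by (rule borel_measurable_lebesgue_onI) measurable
    show "bounded (rate ` {0..1})"
      using rate_bounds by (intro boundedI[of _ "inverse lo"]) (auto simp: less_imp_le)
  qed (use assms in \<open>auto intro: absolutely_integrable_continuous_real\<close>)
  then show ?thesis by (rule set_lebesgue_integral_eq_integral(1))
qed

text \<open>The definition of a mild solution does not state continuity of \<open>w\<close> in time.
  It is obtained by averaging over space: the weighted mean \<open>m\<close> is an indefinite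
  integral in time, hence continuous, and \<open>T *\<^sub>R w s 0\<close> differs from it by a term
  that \<open>w_difference\<close> controls.\<close>

lemma w_0_lim:
  assumes "0 \<le> t"
  shows "((\<lambda>s. w s 0) \<longlongrightarrow> w t 0) (at t within {0..})"
proof -
  define m where "m t = integral {0..1} (\<lambda>\<eta>. rate \<eta> *\<^sub>R w t \<eta>)" for t
  define F where "F s = w s 0 - w s 1 + I 1" for s
  have mF: "(F has_integral m t) {0..t}" if "0 \<le> t" for t
    using w_time_integral[OF that, of 1] by (simp add: F_def[abs_def] m_def)
  have "F integrable_on {0..t + 1}" using mF[of "t + 1"] assms by auto
  then have "continuous_on {0..t + 1} (\<lambda>s. integral {0..s} F)"
    by (rule indefinite_integral_continuous_1)
  then have "continuous_on {0..t + 1} m"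
    by (rule continuous_on_eq) (use mF in \<open>auto intro!: integral_unique\<close>)
  then have "(m \<longlongrightarrow> m t) (at t within {0..t + 1})"
    using assms by (auto simp: continuous_on_def)
  moreover have "at t within {0..t + 1} = at t within {0..}"
    by (rule at_within_nhd[of _ "{..<t + 1}"]) auto
  ultimately have m_lim: "((\<lambda>s. norm (m s - m t)) \<longlongrightarrow> 0) (at t within {0..})"
    by (simp add: LIM_zero tendsto_norm_zero)
  define D where "D s = L2_norm_on {0..1} (\<lambda>\<zeta>. z s \<zeta> - z t \<zeta>)" for s
  have bound: "norm (T *\<^sub>R (w s 0 - w t 0)) \<le> norm (m s - m t) + T * D s" if "0 \<le> s" for s
  proof -
    have w0: "T *\<^sub>R w s 0 = m s + integral {0..1} (\<lambda>\<eta>. rate \<eta> *\<^sub>R (w s 0 - w s \<eta>))" if "0 \<le> s" for s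
    proof -
      have c: "continuous_on {0..1} (w s)" by (rule w_continuous_space[OF that])
      have "m s + integral {0..1} (\<lambda>\<eta>. rate \<eta> *\<^sub>R (w s 0 - w s \<eta>))
          = integral {0..1} (\<lambda>\<eta>. rate \<eta> *\<^sub>R w s \<eta> + rate \<eta> *\<^sub>R (w s 0 - w s \<eta>))"
        unfolding m_def using c
        by (intro Henstock_Kurzweil_Integration.integral_add[symmetric] rate_w_integrable continuous_intros)
      also have "\<dots> = integral {0..1} (\<lambda>\<eta>. rate \<eta> *\<^sub>R w s 0)"
        by (simp add: algebra_simps)
      also have "\<dots> = T *\<^sub>R w s 0"
        using has_integral_scaleR_left[OF integrable_integral[OF rate_integrable[of 0 1]], of "w s 0"] p_diff[of 0 1]
        by (simp add: integral_unique T_def)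
      finally show ?thesis by simp
    qed
    have c: "continuous_on {0..1} (w s)" "continuous_on {0..1} (w t)"
      using w_continuous_space that assms by auto
    have "T *\<^sub>R (w s 0 - w t 0) = (m s - m t) + (integral {0..1} (\<lambda>\<eta>. rate \<eta> *\<^sub>R (w s 0 - w s \<eta>))
        - integral {0..1} (\<lambda>\<eta>. rate \<eta> *\<^sub>R (w t 0 - w t \<eta>)))"
      using w0[OF that] w0[OF assms] by (simp add: algebra_simps)
    also have "integral {0..1} (\<lambda>\<eta>. rate \<eta> *\<^sub>R (w s 0 - w s \<eta>)) - integral {0..1} (\<lambda>\<eta>. rate \<eta> *\<^sub>R (w t 0 - w t \<eta>))
        = integral {0..1} (\<lambda>\<eta>. rate \<eta> *\<^sub>R (w s 0 - w s \<eta>) - rate \<eta> *\<^sub>R (w t 0 - w t \<eta>))"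
      using c by (intro Henstock_Kurzweil_Integration.integral_diff[symmetric] rate_w_integrable continuous_intros)
    also have "norm (m s - m t + \<dots>) \<le> norm (m s - m t) + integral {0..1} (\<lambda>\<eta>. rate \<eta> * D s)"
    proof (intro order_trans[OF norm_triangle_ineq] add_left_mono integral_norm_bound_integral)
      show "(\<lambda>\<eta>. rate \<eta> *\<^sub>R (w s 0 - w s \<eta>) - rate \<eta> *\<^sub>R (w t 0 - w t \<eta>)) integrable_on {0..1}"
        using c by (intro Henstock_Kurzweil_Integration.integrable_diff rate_w_integrable continuous_intros)
      show "(\<lambda>\<eta>. rate \<eta> * D s) integrable_on {0..1}"
        by (rule integrable_on_mult_left[OF rate_integrable])
      show "norm (rate \<eta> *\<^sub>R (w s 0 - w s \<eta>) - rate \<eta> *\<^sub>R (w t 0 - w t \<eta>)) \<le> rate \<eta> * D s"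
        if "\<eta> \<in> {0..1}" for \<eta>
        using w_difference[OF \<open>0 \<le> s\<close> assms that] rate_bounds(1)[of \<eta>]
        by (simp add: D_def flip: scaleR_diff_right)
    qed
    also have "integral {0..1} (\<lambda>\<eta>. rate \<eta> * D s) = T * D s"
      using p_diff[of 0 1] by (simp add: T_def)
    finally show ?thesis .
  qed
  have "((\<lambda>s. norm (m s - m t) + T * D s) \<longlongrightarrow> 0 + T * 0) (at t within {0..})"
    using z_lim[OF assms] m_lim by (intro tendsto_intros) (simp_all add: D_def[abs_def])
  then have lim: "((\<lambda>s. inverse T * (norm (m s - m t) + T * D s)) \<longlongrightarrow> 0) (at t within {0..})"
    using tendsto_mult_left[of _ "0 + T * 0" _ "inverse T"] by fastforce
  have "((\<lambda>s. w s 0 - w t 0) \<longlongrightarrow> 0) (at t within {0..})"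
  proof (rule Lim_null_comparison[OF _ lim])
    have "norm (w s 0 - w t 0) \<le> inverse T * (norm (m s - m t) + T * D s)" if "0 \<le> s" for s
    proof -
      have "T * norm (w s 0 - w t 0) \<le> norm (m s - m t) + T * D s"
        using bound[OF that] T_pos by (simp only: norm_scaleR abs_of_pos)
      then show ?thesis using T_pos by (simp add: inverse_eq_divide pos_le_divide_eq mult.commute)
    qed
    then show "\<forall>\<^sub>F s in at t within {0..}. norm (w s 0 - w t 0) \<le> inverse T * (norm (m s - m t) + T * D s)"
      unfolding eventually_at_filter by (intro always_eventually) auto
  qed
  then show ?thesis by (simp add: LIM_zero_iff)
qed

text \<open>The modulus of continuity in time does not depend on the position, so it combines with
  continuity in space at the single time \<open>t\<close>.\<close>

lemma w_continuous: "continuous_on ({0..} \<times> {0..1}) (\<lambda>(t, \<zeta>). w t \<zeta>)"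
proof -
  have key: "\<exists>d>0. \<forall>s y. 0 \<le> s \<longrightarrow> y \<in> {0..1} \<longrightarrow> dist (s, y) (t, x) < d \<longrightarrow> dist (w s y) (w t x) < e"
    if t: "0 \<le> t" and x: "x \<in> {0..1}" and "0 < e" for t x e
  proof -
    define c where "c s = norm (w s 0 - w t 0) + L2_norm_on {0..1} (\<lambda>\<zeta>. z s \<zeta> - z t \<zeta>)" for s
    have "(c \<longlongrightarrow> 0 + 0) (at t within {0..})"
      unfolding c_def by (intro tendsto_add z_lim t tendsto_norm_zero LIM_zero w_0_lim)
    then have "\<forall>\<^sub>F s in at t within {0..}. c s < e / 2"
      using \<open>0 < e\<close> by (intro order_tendstoD) auto
    then obtain d1 where d1: "d1 > 0" "\<And>s. 0 \<le> s \<Longrightarrow> s \<noteq> t \<Longrightarrow> dist s t < d1 \<Longrightarrow> c s < e / 2"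
      unfolding eventually_at by auto
    have "c t = 0" by (simp add: c_def L2_norm_on_def)
    then have d1': "c s < e / 2" if "0 \<le> s" "dist s t < d1" for s
      using d1(2)[of s] that \<open>0 < e\<close> by (cases "s = t") auto
    obtain d2 where d2: "d2 > 0" "\<And>y. y \<in> {0..1} \<Longrightarrow> dist y x < d2 \<Longrightarrow> dist (w t y) (w t x) < e / 2"
      using w_continuous_space[OF t] x \<open>0 < e\<close> unfolding continuous_on_iff by (metis half_gt_zero)
    show ?thesis
    proof (intro exI[of _ "min d1 d2"] conjI allI impI)
      fix s y assume sy: "0 \<le> s" "y \<in> {0..1}" "dist (s, y) (t, x) < min d1 d2"
      have "dist s t < d1" "dist y x < d2"
        using sy(3) dist_fst_le[of "(s, y)" "(t, x)"] dist_snd_le[of "(s, y)" "(t, x)"] by auto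
      have "w s y - w t y = (w s 0 - w t 0) - ((w s 0 - w s y) - (w t 0 - w t y))" by simp
      also have "norm \<dots> \<le> c s"
        unfolding c_def by (intro order_trans[OF norm_triangle_ineq4] add_left_mono w_difference sy t)
      finally have "dist (w s y) (w t y) < e / 2"
        using d1'[OF sy(1) \<open>dist s t < d1\<close>] by (simp add: dist_norm)
      moreover have "dist (w t y) (w t x) < e / 2" using d2 sy \<open>dist y x < d2\<close> by auto
      ultimately show "dist (w s y) (w t x) < e"
        using dist_triangle_half_l[of "w s y" "w t y"] by (metis dist_commute dist_triangle_half_r)
    qed (use d1 d2 in simp)
  qed
  show ?thesis
    unfolding continuous_on_iff
  proof (intro ballI allI impI)
    fix u :: "real \<times> real" and e :: real assume "u \<in> {0..} \<times> {0..1}" "0 < e"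
    then obtain t x where u: "u = (t, x)" "0 \<le> t" "x \<in> {0..1}" by (cases u) auto
    obtain d where "d > 0" "\<And>s y. 0 \<le> s \<Longrightarrow> y \<in> {0..1} \<Longrightarrow> dist (s, y) (t, x) < d \<Longrightarrow> dist (w s y) (w t x) < e"
      using key[OF u(2,3) \<open>0 < e\<close>] by blast
    then show "\<exists>d>0. \<forall>u'\<in>{0..} \<times> {0..1}. dist u' u < d \<longrightarrow>
        dist ((\<lambda>(t, \<zeta>). w t \<zeta>) u') ((\<lambda>(t, \<zeta>). w t \<zeta>) u) < e"
      unfolding u(1) by (intro exI[of _ d]) auto
  qed
qed

text \<open>In the variable \<open>x = p \<zeta>\<close> all characteristics have speed one; this is
  the shape that \<open>characteristic_zero\<close> expects.\<close>

lemma w_space_integral: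
  assumes "0 \<le> t" "x \<in> {0..T}"
  shows "integral {0..x} (\<lambda>y. w t (q y))
    = integral {0..t} (\<lambda>s. w s 0) - integral {0..t} (\<lambda>s. w s (q x)) + t *\<^sub>R I (q x)"
proof -
  \<comment> \<open>Clamping the position to the unit interval makes \<open>f\<close> continuous on
    the whole line, as the substitution rule needs.\<close>
  define f where "f y = w t (max 0 (min 1 (q y)))" for y
  have qx: "q x \<in> {0..1}" using q_in_01 assms(2) by blast
  have f: "continuous_on S f" for S
    unfolding f_def
    by (rule continuous_on_compose2[OF w_continuous_space[OF assms(1)]])
      (auto intro!: continuous_intros q_continuous)
  have "f \<in> borel_measurable borel" by (rule borel_measurable_continuous_onI[OF f])
  moreover have "set_integrable lborel {p 0..p (q x)} f"
    using f by (rule borel_integrable_atLeastAtMost')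
  ultimately have "((\<lambda>\<zeta>. rate \<zeta> *\<^sub>R f (p \<zeta>)) has_integral integral {p 0..p (q x)} f) {0..q x}"
    by (rule integral_substitution)
  then have "integral {0..q x} (\<lambda>\<zeta>. rate \<zeta> *\<^sub>R f (p \<zeta>)) = integral {0..x} f"
    by (simp add: integral_unique)
  moreover have "integral {0..q x} (\<lambda>\<zeta>. rate \<zeta> *\<^sub>R f (p \<zeta>)) = integral {0..q x} (\<lambda>\<zeta>. rate \<zeta> *\<^sub>R w t \<zeta>)"
    using qx by (intro integral_cong) (auto simp: f_def)
  moreover have "integral {0..x} f = integral {0..x} (\<lambda>y. w t (q y))"
  proof (rule integral_cong)
    fix y assume "y \<in> {0..x}"
    then have "q y \<in> {0..1}" using assms(2) by (intro q_in_01) auto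
    then show "f y = w t (q y)" by (simp add: f_def)
  qed
  ultimately have "integral {0..x} (\<lambda>y. w t (q y)) = integral {0..t} (\<lambda>s. w s 0 - w s (q x) + I (q x))"
    using w_time_integral[OF assms(1) qx] by (simp add: integral_unique)
  also have "\<dots> = integral {0..t} (\<lambda>s. w s 0) - integral {0..t} (\<lambda>s. w s (q x)) + t *\<^sub>R I (q x)"
  proof -
    have c: "continuous_on {0..t} (\<lambda>s. w s \<zeta>)" if "\<zeta> \<in> {0..1}" for \<zeta>
    proof -
      have "continuous_on {0..t} (\<lambda>s. (\<lambda>(t, \<zeta>). w t \<zeta>) (s, \<zeta>))"
        by (rule continuous_on_compose2[OF w_continuous]) (use that in \<open>auto intro!: continuous_intros\<close>)
      then show ?thesis by simp
    qed
    have "integral {0..t} (\<lambda>s. w s 0 - w s (q x) + I (q x))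
        = integral {0..t} (\<lambda>s. w s 0 - w s (q x)) + integral {0..t} (\<lambda>s. I (q x))"
      using c qx by (intro Henstock_Kurzweil_Integration.integral_add integrable_continuous_real continuous_intros) auto
    also have "integral {0..t} (\<lambda>s. w s 0 - w s (q x)) = integral {0..t} (\<lambda>s. w s 0) - integral {0..t} (\<lambda>s. w s (q x))"
      using c qx by (intro Henstock_Kurzweil_Integration.integral_diff integrable_continuous_real) auto
    finally show ?thesis using assms(1) by simp
  qed
  finally show ?thesis .
qed

text \<open>The value is not prescribed directly: at \<open>t = 0\<close> the time integrals
  disappear, and continuity in space forces it.\<close>

lemma w_initial:
  assumes "\<zeta> \<in> {0..1}"
  shows "w 0 \<zeta> = 0"
proof -
  have "w 0 (q (p \<zeta>)) = 0"
  proof (rule zero_if_integrals_zero[OF T_pos _ _ p_in_0T[OF assms], of "\<lambda>y. w 0 (q y)"])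
    show "continuous_on {0..T} (\<lambda>y. w 0 (q y))"
      by (rule continuous_on_compose2[OF w_continuous_space[of 0]]) (use q_in_01 in \<open>auto intro!: q_continuous\<close>)
    show "integral {0..x} (\<lambda>y. w 0 (q y)) = 0" if "x \<in> {0..T}" for x
      using w_space_integral[OF order_refl that] by simp
  qed
  then show ?thesis by simp
qed

lemma I_continuous: "continuous_on {0..1} I"
  unfolding I_def[abs_def] using z0 by (intro indefinite_integral_continuous_1 L2_on_integrable_on(1)) auto

text \<open>Subtract the expected answer and show that the remainder \<open>E\<close> satisfies the
  hypotheses of \<open>characteristic_zero\<close>. Everything is thereby reduced to the inflow
  \<open>w t 0\<close> and the initial mass.\<close>

theorem mild_representation:
  assumes "0 \<le> t" "\<zeta> \<in> {0..1}"
  shows "w t \<zeta> = I \<zeta> + (if p \<zeta> \<le> t then w (t - p \<zeta>) 0 else - I (q (p \<zeta> - t)))"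
proof -
  define J where "J x = I (max 0 (min 1 (q x)))" for x
  have J: "J x = I (q x)" if "x \<in> {0..T}" for x
    using q_in_01[OF that] by (simp add: J_def)
  have Jc: "continuous_on S J" for S
    unfolding J_def by (rule continuous_on_compose2[OF I_continuous]) (auto intro!: continuous_intros q_continuous)
  have Jm: "continuous_on S (\<lambda>x. J (- x))" for S
    by (rule continuous_on_compose2[OF Jc[of UNIV]]) (auto intro!: continuous_intros)
  have J0: "J 0 = 0" by (simp add: J_def I_def)
  \<comment> \<open>Continues the inflow to negative times by the initial state, so that
    \<open>J x + h (t - x)\<close> covers both sides of the characteristic through the origin. The
    pieces fit together because both vanish at 0.\<close>
  define h where "h r = (if 0 \<le> r then w r 0 else - J (- r))" for r
  have w0c: "continuous_on {0..} (\<lambda>s. w s 0)"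
  proof -
    have "continuous_on {0..} (\<lambda>s. (\<lambda>(t, \<zeta>). w t \<zeta>) (s, 0))"
      by (rule continuous_on_compose2[OF w_continuous]) (auto intro!: continuous_intros)
    then show ?thesis by simp
  qed
  have hc: "continuous_on S h" for S
  proof -
    have "continuous_on ({0..} \<union> {..0}) (\<lambda>r. if 0 \<le> r then w r 0 else - J (- r))"
      by (rule continuous_on_cases)
        (auto intro!: w0c Jm continuous_on_minus simp: J0 w_initial)
    moreover have "{0..} \<union> {..0} = (UNIV :: real set)" by auto
    ultimately have "continuous_on UNIV h" by (simp add: h_def[abs_def])
    then show ?thesis by (rule continuous_on_subset) simp
  qed
  have hi: "h integrable_on {a..b}" for a b by (intro integrable_continuous_real hc)
  define E where "E t x = w t (q x) - J x - h (t - x)" for t x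
  have "E t (p \<zeta>) = 0"
  proof (rule characteristic_zero[OF T_pos _ _ assms(1) p_in_0T[OF assms(2)]])
    have "continuous_on ({0..} \<times> {0..T}) (\<lambda>u. q (snd u))"
      by (rule continuous_on_compose2[OF q_continuous[of UNIV]]) (auto intro!: continuous_intros)
    then have "continuous_on ({0..} \<times> {0..T}) (\<lambda>u. (\<lambda>(t, \<zeta>). w t \<zeta>) (fst u, q (snd u)))"
      by (intro continuous_on_compose2[OF w_continuous])
        (use q_in_01 in \<open>auto intro!: continuous_intros\<close>)
    moreover have "continuous_on ({0..} \<times> {0..T}) (\<lambda>u. J (snd u))"
      by (rule continuous_on_compose2[OF Jc[of UNIV]]) (auto intro!: continuous_intros)
    moreover have "continuous_on ({0..} \<times> {0..T}) (\<lambda>u. h (fst u - snd u))"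
      by (rule continuous_on_compose2[OF hc[of UNIV]]) (auto intro!: continuous_intros)
    ultimately show "continuous_on ({0..} \<times> {0..T}) (\<lambda>(t, x). E t x)"
      unfolding E_def case_prod_unfold by (intro continuous_on_diff) simp_all
    fix t x :: real assume t: "0 \<le> t" and x: "x \<in> {0..T}"
    have qx: "q x \<in> {0..1}" using q_in_01[OF x] .
    have wx: "continuous_on {0..x} (\<lambda>y. w t (q y))"
      by (rule continuous_on_compose2[OF w_continuous_space[OF t]])
        (use q_in_01 x in \<open>auto intro!: q_continuous\<close>)
    have wt: "continuous_on {0..t} (\<lambda>s. w s (q x))"
    proof -
      have "continuous_on {0..t} (\<lambda>s. (\<lambda>(t, \<zeta>). w t \<zeta>) (s, q x))"
        by (rule continuous_on_compose2[OF w_continuous]) (use qx in \<open>auto intro!: continuous_intros\<close>)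
      then show ?thesis by simp
    qed
    have h1: "continuous_on {0..x} (\<lambda>y. h (t - y))" "continuous_on {0..t} (\<lambda>s. h (s - x))"
      by (rule continuous_on_compose2[OF hc[of UNIV]]; auto intro!: continuous_intros)+
    have e1: "integral {0..x} (E t) = integral {0..x} (\<lambda>y. w t (q y)) - integral {0..x} J - (prim h t - prim h (t - x))"
    proof -
      have "integral {0..x} (E t) = integral {0..x} (\<lambda>y. w t (q y) - J y) - integral {0..x} (\<lambda>y. h (t - y))"
        unfolding E_def by (intro Henstock_Kurzweil_Integration.integral_diff integrable_continuous_real continuous_intros wx Jc h1)
      also have "integral {0..x} (\<lambda>y. w t (q y) - J y) = integral {0..x} (\<lambda>y. w t (q y)) - integral {0..x} J"
        by (intro Henstock_Kurzweil_Integration.integral_diff integrable_continuous_real wx Jc)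
      also have "integral {0..x} (\<lambda>y. h (t - y)) = integral {t - x..t - 0} h"
        by (rule integral_reflect_shift)
      also have "\<dots> = prim h t - prim h (t - x)"
        using x by (subst prim_diff[OF hi]) auto
      finally show ?thesis .
    qed
    have e2: "integral {0..t} (\<lambda>s. E s x) = integral {0..t} (\<lambda>s. w s (q x)) - t *\<^sub>R J x - (prim h (t - x) - prim h (- x))"
    proof -
      have "integral {0..t} (\<lambda>s. E s x) = integral {0..t} (\<lambda>s. w s (q x) - J x) - integral {0..t} (\<lambda>s. h (s - x))"
        unfolding E_def by (intro Henstock_Kurzweil_Integration.integral_diff integrable_continuous_real continuous_intros wt h1)
      also have "integral {0..t} (\<lambda>s. w s (q x) - J x) = integral {0..t} (\<lambda>s. w s (q x)) - integral {0..t} (\<lambda>s. J x)"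
        by (intro Henstock_Kurzweil_Integration.integral_diff integrable_continuous_real wt continuous_intros)
      also have "integral {0..t} (\<lambda>s. h (s - x)) = integral {0 + - x..t + - x} h"
        using integral_shift_Icc_real[of 0 t h "- x"] by (simp add: comp_def)
      also have "\<dots> = prim h (t - x) - prim h (- x)"
        using t by (subst prim_diff[OF hi]) auto
      finally show ?thesis using t by simp
    qed
    have "prim h t = integral {0..t} (\<lambda>s. w s 0)"
      using t by (auto simp: prim_def h_def intro!: integral_cong)
    moreover have "prim h (- x) = integral {0..x} J"
    proof -
      have "prim h (- x) = prim h 0 - integral {0 - x..0 - 0} h"
        using x by (subst prim_diff[OF hi]) auto
      also have "integral {0 - x..0 - 0} h = integral {0..x} (\<lambda>y. h (0 - y))"
        by (rule integral_reflect_shift[symmetric])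
      also have "\<dots> = integral {0..x} (\<lambda>y. - J y)"
        by (intro integral_cong) (auto simp: h_def J0 w_initial)
      finally show ?thesis by (simp add: Henstock_Kurzweil_Integration.integral_neg)
    qed
    ultimately show "integral {0..x} (E t) + integral {0..t} (\<lambda>s. E s x) = 0"
      unfolding e1 e2 w_space_integral[OF t x] by (simp add: J[OF x])
  qed
  then have "w t \<zeta> = J (p \<zeta>) + h (t - p \<zeta>)"
    by (simp add: E_def algebra_simps)
  moreover have "h (t - p \<zeta>) = (if p \<zeta> \<le> t then w (t - p \<zeta>) 0 else - I (q (p \<zeta> - t)))"
    using p_in_0T[OF assms(2)] assms(1) by (auto simp: h_def J)
  ultimately show ?thesis
    using J[OF p_in_0T[OF assms(2)]] by simp
qed

end

text \<open>The boundary condition determines the inflow \<open>w(t,0)\<close> on \<open>[kT,(k+1)T]\<close> from its values on the preceding interval.\<close>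

lemma mild_unique:
  fixes z0 :: "real \<Rightarrow> 'a::euclidean_space"
  assumes z0: "z0 \<in> L2_on {0..1}"
    and sol: "transport_mild l z0 z w" "transport_mild l z0 z' w'"
    and bc: "\<And>t. 0 \<le> t \<Longrightarrow> w t 0 = \<Phi> (w t 1) + f t" "\<And>t. 0 \<le> t \<Longrightarrow> w' t 0 = \<Phi> (w' t 1) + f t"
    and t: "0 \<le> t"
  shows "\<zeta> \<in> {0..1} \<Longrightarrow> w t \<zeta> = w' t \<zeta>" and "AE \<zeta> in lborel. \<zeta> \<in> {0..1} \<longrightarrow> z t \<zeta> = z' t \<zeta>"
proof -
  note repr = mild_representation[OF z0 sol(1)] mild_representation[OF z0 sol(2)]
  have inflow: "w t 0 = w' t 0" if "0 \<le> t" "t < real n * T" for t n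
    using that
  proof (induction n arbitrary: t)
    case (Suc n)
    have "w t 1 = w' t 1"
      using repr[of t 1] Suc by (auto simp: T_def algebra_simps)
    then show ?case using bc Suc.prems by simp
  qed simp
  have in_eq: "w t 0 = w' t 0" if "0 \<le> t" for t
  proof -
    obtain n where "t < real n * T" using T_pos reals_Archimedean3 by blast
    then show ?thesis using inflow that by blast
  qed
  show eq: "w t \<zeta> = w' t \<zeta>" if "\<zeta> \<in> {0..1}" for \<zeta>
    using repr[OF t that] in_eq by auto
  have zz: "(\<lambda>\<zeta>. z t \<zeta>) integrable_on {0..1}" "(\<lambda>\<zeta>. z' t \<zeta>) integrable_on {0..1}"
    using z_L2[OF z0 sol(1) t] z_L2[OF z0 sol(2) t] by (auto intro: L2_on_integrable_on(1))
  \<comment> \<open>The state is recovered from its masses on \<open>{0..\<zeta>}\<close>, hence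
    only almost everywhere.\<close>
  show "AE \<zeta> in lborel. \<zeta> \<in> {0..1} \<longrightarrow> z t \<zeta> = z' t \<zeta>"
  proof (rule AE_eq_if_integral_eq_interval[OF _ zz])
    show "integral {0..\<zeta>} (z t) = integral {0..\<zeta>} (z' t)" if "\<zeta> \<in> {0..1}" for \<zeta>
      using z_integral(2)[OF z0 sol(1) t that] z_integral(2)[OF z0 sol(2) t that] eq[OF that] eq[of 0] by simp
  qed simp
qed

end

subsection \<open>Trajectories generated by a matrix recursion\<close>

lemma loc_L2I:
  assumes "g \<in> borel_measurable borel" "\<And>a b. g \<in> L2_on {a..b}"
  shows "loc_L2 g"
  using assms by (auto simp: loc_L2_def L2_on_borel_iff)

lemma loc_L2_borel: "loc_L2 g \<Longrightarrow> g \<in> borel_measurable borel"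
  by (simp add: loc_L2_def)

lemma loc_L2_add:
  assumes "loc_L2 f" "loc_L2 g"
  shows "loc_L2 (\<lambda>x. f x + g x)"
proof (rule loc_L2I)
  note [measurable] = loc_L2_borel[OF assms(1)] loc_L2_borel[OF assms(2)]
  show "(\<lambda>x. f x + g x) \<in> borel_measurable borel" by measurable
qed (intro L2_on_add loc_L2_L2_on assms)

lemma loc_L2_matrix:
  assumes "loc_L2 g"
  shows "loc_L2 (\<lambda>x. (A :: complex ^ 'n ^ 'm) *v g x)"
proof (rule loc_L2I)
  note [measurable] = loc_L2_borel[OF assms]
  show "(\<lambda>x. A *v g x) \<in> borel_measurable borel" by measurable
qed (intro L2_on_bounded_linear[OF matrix_vector_mul_bounded_linear] loc_L2_L2_on assms)

lemma loc_L2_shift: "loc_L2 g \<Longrightarrow> loc_L2 (\<lambda>x. g (x - s))"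
  using loc_L2_reflect[OF loc_L2_reflect[of g 0], of s] by simp

lemma loc_L2_dominated:
  assumes "loc_L2 g" "f \<in> borel_measurable borel" "\<And>x. norm (f x) \<le> norm (g x)"
  shows "loc_L2 f"
  unfolding loc_L2_def
proof (intro conjI allI assms(2))
  fix a b :: real
  have "energy {a..b} f \<le> energy {a..b} g"
    using assms(3) by (intro nn_integral_mono mult_right_mono ennreal_leI power_mono) auto
  also have "\<dots> < \<infinity>" using assms(1) by (simp add: loc_L2_def)
  finally show "energy {a..b} f < \<infinity>" .
qed

text \<open>The counter allows structural recursion: level \<open>n\<close> already has its final
  value for \<open>t < real n * d\<close>.\<close>

fun iterate :: "complex ^ 'n ^ 'n \<Rightarrow> real \<Rightarrow> (real \<Rightarrow> complex ^ 'n) \<Rightarrow> (real \<Rightarrow> complex ^ 'n) \<Rightarrow> nat \<Rightarrow> real \<Rightarrow> complex ^ 'n" where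
  "iterate A d g0 f 0 t = g0 t"
| "iterate A d g0 f (Suc n) t = (if t < 0 then g0 t else A *v iterate A d g0 f n (t - d) + f t)"

lemma iterate_stable: "t < real n * d \<Longrightarrow> n \<le> m \<Longrightarrow> iterate A d g0 f m t = iterate A d g0 f n t"
proof (induction n arbitrary: t m)
  case 0
  then show ?case by (cases m) auto
next
  case (Suc n)
  then obtain m' where m: "m = Suc m'" "n \<le> m'" by (metis Suc_le_D Suc_le_mono)
  have "t - d < real n * d" using Suc.prems by (simp add: algebra_simps)
  then show ?case using Suc.IH[of "t - d" m'] m by simp
qed

text \<open>At each time the iterates become stationary. On a bounded interval the limit coincides
  with a single iterate, which gives local square integrability, and the recursion holds without an
  exceptional set.\<close>

lemma trajectory_exists:
  fixes A :: "complex ^ 'n ^ 'n"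
  assumes "0 < d" and g0: "loc_L2 g0" and f: "loc_L2 f"
  obtains g where "loc_L2 g" "\<And>t. t < 0 \<Longrightarrow> g t = g0 t" "\<And>t. 0 \<le> t \<Longrightarrow> g t = A *v g (t - d) + f t"
proof -
  define G where "G = iterate A d g0 f"
  have stable: "G m t = G n t" if "t < real n * d" "n \<le> m" for m n t
    unfolding G_def by (rule iterate_stable[OF that])
  have ex: "\<exists>n. t < real n * d" for t using \<open>0 < d\<close> reals_Archimedean3 by blast
  define g where "g t = G (SOME n. t < real n * d) t" for t
  have g: "g t = G n t" if "t < real n * d" for n t
  proof -
    define k where "k = (SOME n. t < real n * d)"
    have "t < real k * d" unfolding k_def by (rule someI_ex[OF ex])
    then show ?thesis
      unfolding g_def k_def[symmetric]
      using stable[of t k "max k n"] stable[OF that, of "max k n"] by simp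
  qed
  have locG: "loc_L2 (G n)" for n
  proof (induction n)
    case 0
    then show ?case using g0 by (simp add: G_def[abs_def])
  next
    case (Suc n)
    have S: "loc_L2 (\<lambda>t. A *v G n (t - d) + f t)"
      by (intro loc_L2_add loc_L2_matrix loc_L2_shift Suc f)
    note [measurable] = loc_L2_borel[OF S] loc_L2_borel[OF g0]
    have "loc_L2 (\<lambda>t. (if t < 0 then g0 t else 0) + (if t < 0 then 0 else A *v G n (t - d) + f t))"
    proof (rule loc_L2_add)
      show "loc_L2 (\<lambda>t. if t < 0 then g0 t else 0)"
        by (rule loc_L2_dominated[OF g0]) auto
      show "loc_L2 (\<lambda>t. if t < 0 then 0 else A *v G n (t - d) + f t)"
        by (rule loc_L2_dominated[OF S]) auto
    qed
    moreover have "G (Suc n) = (\<lambda>t. (if t < 0 then g0 t else 0) + (if t < 0 then 0 else A *v G n (t - d) + f t))"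
      by (auto simp: G_def)
    ultimately show ?case by simp
  qed
  show thesis
  proof (rule that[of g])
    show "loc_L2 g"
      unfolding loc_L2_def
    proof (intro conjI allI)
      show "g \<in> borel_measurable borel"
      proof (rule borel_measurable_LIMSEQ_metric[OF loc_L2_borel[OF locG]])
        fix t
        obtain n where n: "t < real n * d" using ex by blast
        have "eventually (\<lambda>m. G m t = g t) sequentially"
          using eventually_ge_at_top[of n]
        proof eventually_elim
          case (elim m)
          show ?case unfolding g[OF n] by (rule stable[OF n elim])
        qed
        then show "(\<lambda>m. G m t) \<longlonglongrightarrow> g t" by (rule tendsto_eventually)
      qed
      fix a b
      obtain n where n: "b < real n * d" using ex by blast
      have "energy {a..b} g = energy {a..b} (\<lambda>x. G n x)"
        using n by (intro nn_integral_cong) (auto simp: indicator_def g[of _ n])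
      then show "energy {a..b} g < \<infinity>"
        using locG[of n] by (simp add: loc_L2_def)
    qed
    show "g t = g0 t" if "t < 0" for t
      using g[of t 0] that by (simp add: G_def)
    show "g t = A *v g (t - d) + f t" if "0 \<le> t" for t
    proof -
      obtain n where n: "t < real n * d" using ex by blast
      have "t < real (Suc n) * d" "t - d < real n * d" using n \<open>0 < d\<close> by (auto simp: algebra_simps)
      then show ?thesis using g[of t "Suc n"] g[of "t - d" n] that by (simp add: G_def)
    qed
  qed
qed

subsection \<open>Solutions for given initial state\<close>

lemma integral_cong_AE_interval:
  fixes f g :: "real \<Rightarrow> 'a::euclidean_space"
  assumes "AE x in lborel. x \<in> S \<longrightarrow> f x = g x" "T \<subseteq> S"
  shows "integral T f = integral T g"
proof -
  have "AE x in lborel. x \<in> T \<longrightarrow> f x = g x"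
    using assms by (auto elim: eventually_mono)
  then show ?thesis unfolding integral_def integrable_on_def by (simp only: has_integral_AE)
qed

lemma transport_mild_initial_cong:
  assumes "transport_mild l z0 z w" "AE \<zeta> in lborel. \<zeta> \<in> {0..1} \<longrightarrow> z0 \<zeta> = z1 \<zeta>" "z1 \<in> L2_on {0..1}"
  shows "transport_mild l z1 z w"
proof -
  have "H1_derivative F (\<lambda>\<zeta>. - (z t \<zeta> - z1 \<zeta>)) W"
    if "0 \<le> t" and H: "H1_derivative F (\<lambda>\<zeta>. - (z t \<zeta> - z0 \<zeta>)) W" for t F W
  proof -
    have "z t \<in> L2_on {0..1}" using assms(1) that by (simp add: transport_mild_def X_continuous_def)
    then have "(\<lambda>\<zeta>. - (z t \<zeta> - z1 \<zeta>)) \<in> L2_on {0..1}"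
      using assms(3) by (intro L2_on_minus L2_on_diff)
    moreover have eq: "integral {0..\<zeta>} (\<lambda>\<zeta>. - (z t \<zeta> - z0 \<zeta>)) = integral {0..\<zeta>} (\<lambda>\<zeta>. - (z t \<zeta> - z1 \<zeta>))"
      if "\<zeta> \<in> {0..1}" for \<zeta>
      using that assms(2) by (intro integral_cong_AE_interval[of "{0..1}"]) (auto elim: eventually_mono)
    moreover have "W \<zeta> = W 0 + integral {0..\<zeta>} (\<lambda>\<zeta>. - (z t \<zeta> - z1 \<zeta>))" if "\<zeta> \<in> {0..1}" for \<zeta>
      using H that unfolding H1_derivative_def eq[OF that, symmetric] by blast
    ultimately show ?thesis using H unfolding H1_derivative_def by blast
  qed
  then show ?thesis using assms(1) unfolding transport_mild_def by blast
qed

text \<open>Lets \<open>lam0\<close> be exchanged for its pointwise bounded representative and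
  back.\<close>

lemma transport_mild_speed_cong:
  assumes eq: "AE \<zeta> in lborel. \<zeta> \<in> {0..1} \<longrightarrow> l \<zeta> = l' \<zeta>"
    and m: "l' \<in> borel_measurable (lebesgue_on {0..1})"
    and sol: "transport_mild l z0 z w"
  shows "transport_mild l' z0 z w"
proof -
  have ae: "AE \<zeta> in lebesgue_on {0..1}. l \<zeta> = l' \<zeta>"
    using eq by (subst AE_lebesgue_on_iff) auto
  have "H1_derivative (\<lambda>\<zeta>. l' \<zeta> *\<^sub>R Z \<zeta>) h W"
    if "X_integral z t Z" and H: "H1_derivative (\<lambda>\<zeta>. l \<zeta> *\<^sub>R Z \<zeta>) h W" for t Z h W
  proof -
    have [measurable]: "Z \<in> borel_measurable (lebesgue_on {0..1})"
      using that by (simp add: X_integral_def L2_on_def)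
    note [measurable] = m
    have "(\<lambda>\<zeta>. l' \<zeta> *\<^sub>R Z \<zeta>) \<in> L2_on {0..1}"
    proof (rule L2_on_cong_AE)
      show "(\<lambda>\<zeta>. l \<zeta> *\<^sub>R Z \<zeta>) \<in> L2_on {0..1}" using H by (simp add: H1_derivative_def)
      show "AE \<zeta> in lebesgue_on {0..1}. l \<zeta> *\<^sub>R Z \<zeta> = l' \<zeta> *\<^sub>R Z \<zeta>"
        using ae by eventually_elim simp
    qed measurable
    moreover have "AE \<zeta> in lebesgue_on {0..1}. l \<zeta> *\<^sub>R Z \<zeta> = W \<zeta>"
      using H unfolding H1_derivative_def by blast
    then have "AE \<zeta> in lebesgue_on {0..1}. l' \<zeta> *\<^sub>R Z \<zeta> = W \<zeta>"
      using ae by eventually_elim simp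
    ultimately show ?thesis using H unfolding H1_derivative_def by blast
  qed
  then show ?thesis using sol unfolding transport_mild_def by blast
qed

lemma speed_representative:
  assumes lam: "lam0 \<in> Linfty_on {0..1}" and "0 < \<epsilon>" and lower: "AE \<zeta> in lebesgue_on {0..1}. lam0 \<zeta> \<ge> \<epsilon>"
  obtains l hi where "transport l \<epsilon> hi" "AE \<zeta> in lborel. \<zeta> \<in> {0..1} \<longrightarrow> l \<zeta> = lam0 \<zeta>"
proof -
  have m: "lam0 \<in> borel_measurable (lebesgue_on {0..1})"
    using lam by (simp add: Linfty_on_def)
  obtain b where b: "AE \<zeta> in lebesgue_on {0..1}. norm (lam0 \<zeta>) \<le> b"
    using lam by (auto simp: Linfty_on_def)
  obtain l' where l' [measurable]: "l' \<in> borel_measurable borel" and eq: "AE \<zeta> in lborel. \<zeta> \<in> {0..1} \<longrightarrow> lam0 \<zeta> = l' \<zeta>"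
    by (rule borel_representative[OF m]) auto
  \<comment> \<open>The maximum with \<open>\<epsilon>\<close> keeps the clamping range
    nonempty.\<close>
  define hi where "hi = max b \<epsilon>"
  define l where "l \<zeta> = max \<epsilon> (min hi (l' \<zeta>))" for \<zeta>
  have "transport l \<epsilon> hi"
    using \<open>0 < \<epsilon>\<close> by unfold_locales (auto simp: l_def[abs_def] hi_def)
  moreover have "AE \<zeta> in lborel. \<zeta> \<in> {0..1} \<longrightarrow> l \<zeta> = lam0 \<zeta>"
  proof -
    have "AE \<zeta> in lborel. \<zeta> \<in> {0..1} \<longrightarrow> lam0 \<zeta> \<ge> \<epsilon>" "AE \<zeta> in lborel. \<zeta> \<in> {0..1} \<longrightarrow> norm (lam0 \<zeta>) \<le> b"
      using lower b by (subst (asm) AE_lebesgue_on_iff; simp)+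
    with eq show ?thesis
      by eventually_elim (auto simp: l_def hi_def)
  qed
  ultimately show thesis by (rule that)
qed

lemma AE_shift:
  assumes "AE x in lborel. P (x :: real)"
  shows "AE x in lborel. P (x - s)"
proof -
  have "AE x in distr lborel borel ((+) (- s)). P x"
    unfolding lborel_distr_plus by (rule assms)
  then have "AE x in lborel. P (- s + x)"
    by (rule AE_distrD[rotated]) simp
  then show ?thesis by simp
qed

text \<open>Half-open cells tile the half-line without overlap; each is moved to the first one, and
  nonnegativity allows sum and integral to be exchanged.\<close>

lemma nn_integral_fold_period:
  fixes \<phi> :: "real \<Rightarrow> ennreal"
  assumes [measurable]: "\<phi> \<in> borel_measurable borel" and "0 < d"
  shows "(\<integral>\<^sup>+t\<in>{0..}. \<phi> t \<partial>lborel) = (\<integral>\<^sup>+s\<in>{0..<d}. (\<Sum>k. \<phi> (s + real k * d)) \<partial>lborel)"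
proof -
  define A where "A k = {real k * d..<real (Suc k) * d}" for k
  have disj: "disjoint_family A"
  proof -
    have "A i \<inter> A j = {}" if "i < j" for i j
    proof -
      have "real (Suc i) * d \<le> real j * d" using that \<open>0 < d\<close> by (intro mult_right_mono) auto
      then show ?thesis by (auto simp: A_def)
    qed
    then show ?thesis unfolding disjoint_family_on_def by (metis Int_commute linorder_neqE_nat)
  qed
  have un: "(\<Union>k. A k) = {0..}"
  proof (intro equalityI subsetI)
    fix t :: real assume "t \<in> {0..}"
    then have t: "0 \<le> t" by simp
    define k where "k = nat \<lfloor>t / d\<rfloor>"
    have "real k \<le> t / d" "t / d < real k + 1"
      using t \<open>0 < d\<close> by (auto simp: k_def)
    then have "t \<in> A k" using \<open>0 < d\<close> by (auto simp: A_def field_simps)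
    then show "t \<in> (\<Union>k. A k)" by blast
  next
    fix t assume "t \<in> (\<Union>k. A k)"
    then obtain k where "real k * d \<le> t" by (auto simp: A_def)
    moreover have "0 \<le> real k * d" using \<open>0 < d\<close> by simp
    ultimately show "t \<in> {0..}" by simp
  qed
  have [measurable]: "A k \<in> sets borel" for k by (simp add: A_def)
  have "(\<integral>\<^sup>+t\<in>{0..}. \<phi> t \<partial>lborel) = (\<integral>\<^sup>+t. (\<Sum>k. \<phi> t * indicator (A k) t) \<partial>lborel)"
    by (simp add: suminf_indicator[OF disj] un)
  also have "\<dots> = (\<Sum>k. \<integral>\<^sup>+t. \<phi> t * indicator (A k) t \<partial>lborel)"
    by (rule nn_integral_suminf) measurable
  also have "\<dots> = (\<Sum>k. \<integral>\<^sup>+s. \<phi> (s + real k * d) * indicator {0..<d} s \<partial>lborel)"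
  proof (rule suminf_cong)
    fix k
    show "(\<integral>\<^sup>+t. \<phi> t * indicator (A k) t \<partial>lborel) = (\<integral>\<^sup>+s. \<phi> (s + real k * d) * indicator {0..<d} s \<partial>lborel)"
      by (subst nn_integral_real_affine[of _ 1 "real k * d"])
        (auto intro!: nn_integral_cong simp: A_def indicator_def algebra_simps)
  qed
  also have "\<dots> = (\<integral>\<^sup>+s. (\<Sum>k. \<phi> (s + real k * d) * indicator {0..<d} s) \<partial>lborel)"
    by (rule nn_integral_suminf[symmetric]) measurable
  also have "\<dots> = (\<integral>\<^sup>+s\<in>{0..<d}. (\<Sum>k. \<phi> (s + real k * d)) \<partial>lborel)"
    by simp
  finally show ?thesis .
qed

text \<open>Propagates period by period, shifting the null set each time, and unites countably many
  of them. Used to compare trajectories whose inputs agree only almost everywhere.\<close>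

lemma AE_recursion_zero:
  fixes M :: "complex ^ 'n ^ 'n" and d :: real
  assumes "0 < d" "\<And>t. t < 0 \<Longrightarrow> \<delta> t = 0"
    and rec: "AE t in lborel. 0 \<le> t \<longrightarrow> \<delta> t = M *v \<delta> (t - d)"
  shows "AE t in lborel. \<delta> t = 0"
proof -
  have "AE t in lborel. t < real n * d \<longrightarrow> \<delta> t = 0" for n
  proof (induction n)
    case 0
    then show ?case using assms(2) by simp
  next
    case (Suc n)
    from AE_shift[OF Suc, of d] rec show ?case
    proof eventually_elim
      case (elim t)
      then show ?case using assms(2)[of t] by (cases "t < 0") (auto simp: algebra_simps)
    qed
  qed
  then have "AE t in lborel. \<forall>n. t < real n * d \<longrightarrow> \<delta> t = 0"
    unfolding AE_all_countable by simp
  then show ?thesis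
  proof eventually_elim
    case (elim t)
    obtain n where "t < real n * d" using \<open>0 < d\<close> reals_Archimedean3 by blast
    with elim show ?case by blast
  qed
qed

context transport
begin

text \<open>The initial state is stored as the past of the flux over one travel time; the energy
  bound is the price of the change of variables.\<close>

lemma initial_trajectory:
  fixes z0 :: "real \<Rightarrow> 'a::euclidean_space"
  assumes z0: "z0 \<in> L2_on {0..1}"
  obtains g0 where "loc_L2 g0" "AE \<zeta> in lborel. \<zeta> \<in> {0..1} \<longrightarrow> rate \<zeta> *\<^sub>R g0 (- p \<zeta>) = z0 \<zeta>"
    "total_energy g0 \<le> ennreal (hi * (L2_norm_on {0..1} z0)\<^sup>2)"
proof -
  obtain z1 where z1 [measurable]: "z1 \<in> borel_measurable borel" and eq: "AE \<zeta> in lborel. \<zeta> \<in> {0..1} \<longrightarrow> z0 \<zeta> = z1 \<zeta>"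
    by (rule borel_representative[OF L2_onD(1)[OF z0]]) auto
  define h where "h x = l (q (- x)) *\<^sub>R z1 (q (- x))" for x
  \<comment> \<open>Time 0 is left out because the recursion already fixes the value there; this
    costs only the position 0.\<close>
  define g0 where "g0 x = (if x \<in> {-T..<0} then h x else 0)" for x
  have [measurable]: "h \<in> borel_measurable borel" unfolding h_def by measurable
  have g0m [measurable]: "g0 \<in> borel_measurable borel" unfolding g0_def by measurable
  have hp: "rate \<zeta> *\<^sub>R h (- p \<zeta>) = z1 \<zeta>" for \<zeta>
    by (simp add: h_def l_rate)
  have total: "total_energy g0 \<le> ennreal (hi * (L2_norm_on {0..1} z0)\<^sup>2)"
  proof -
    have "total_energy g0 = total_energy (\<lambda>x. g0 (- x))"
      by (subst nn_integral_real_affine[of _ "-1" 0]) auto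
    also have "\<dots> \<le> energy {0..T} (\<lambda>x. h (- x))"
      by (intro nn_integral_mono) (auto simp: g0_def indicator_def)
    also have "\<dots> \<le> ennreal hi * energy {0..1} (\<lambda>\<zeta>. rate \<zeta> *\<^sub>R h (- p \<zeta>))"
      by (rule nn_integral_rate_lower[of "\<lambda>x. h (- x)"]) measurable
    also have "energy {0..1} (\<lambda>\<zeta>. rate \<zeta> *\<^sub>R h (- p \<zeta>))
        = energy {0..1} z0"
      unfolding hp using eq by (intro nn_integral_cong_AE) (auto elim!: eventually_mono simp: indicator_def)
    also have "\<dots> = ennreal ((L2_norm_on {0..1} z0)\<^sup>2)"
      using nn_integral_L2_norm_on[OF z0] by (simp add: nn_integral_lebesgue_on)
    finally show ?thesis using hi_pos by (simp add: ennreal_mult)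
  qed
  show thesis
  proof (rule that[OF _ _ total])
    show "loc_L2 g0"
      unfolding loc_L2_def
    proof (intro conjI allI g0m)
      fix a b :: real
      have "energy {a..b} g0 \<le> total_energy g0"
        by (intro nn_integral_mono) (auto simp: indicator_def)
      also note total
      also have "ennreal (hi * (L2_norm_on {0..1} z0)\<^sup>2) < \<infinity>" by simp
      finally show "energy {a..b} g0 < \<infinity>" .
    qed
    have "AE \<zeta> in lborel. \<zeta> \<noteq> (0::real)" by (rule AE_lborel_singleton)
    with eq show "AE \<zeta> in lborel. \<zeta> \<in> {0..1} \<longrightarrow> rate \<zeta> *\<^sub>R g0 (- p \<zeta>) = z0 \<zeta>"
    proof eventually_elim
      case (elim \<zeta>)
      show ?case
      proof
        assume z: "\<zeta> \<in> {0..1}"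
        then have "- p \<zeta> \<in> {-T..<0}"
          using p_in_0T[OF z] p_less_iff[of 0 \<zeta>] elim by auto
        then show "rate \<zeta> *\<^sub>R g0 (- p \<zeta>) = z0 \<zeta>" using elim z by (simp add: g0_def hp)
      qed
    qed
  qed
qed

lemma wsol_0: "wsol g t 0 = prim g t" and wsol_1: "wsol g t 1 = prim g (t - T) - prim g (- T)"
  by (simp_all add: wsol_def T_def)

lemma wsol_1_integral:
  assumes g: "loc_L2 g" and "0 \<le> t"
  shows "wsol g t 1 = integral {0..t} (\<lambda>s. g (s - T))"
proof -
  have "integral {0..t} (\<lambda>s. g (s - T)) = integral {0 + - T..t + - T} g"
    using integral_shift_Icc_real[of 0 t g "- T"] by (simp add: comp_def)
  also have "\<dots> = prim g (t - T) - prim g (- T)"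
    using assms by (subst prim_diff[OF loc_L2_integrable_on[OF g]]) auto
  finally show ?thesis by (simp add: wsol_1)
qed

lemma matrix_integral:
  fixes A :: "complex ^ 'n ^ 'm"
  assumes "f integrable_on S"
  shows "integral S (\<lambda>x. A *v f x) = A *v integral S f"
  using integral_linear[OF assms matrix_vector_mul_bounded_linear[of A]] by (simp add: comp_def)

text \<open>Integrating the recursion in time gives the boundary condition, since the boundary
  values of \<open>wsol\<close> are the integrals of \<open>g\<close> and of the delayed
  \<open>g\<close>.\<close>

lemma trajectory_solution:
  fixes A :: "complex ^ 'n ^ 'n"
  assumes z0: "z0 \<in> L2_on {0..1}"
    and g: "loc_L2 g" and f: "loc_L2 f" and g_rec: "\<And>t. 0 \<le> t \<Longrightarrow> g t = A *v g (t - T) + f t"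
    and neg: "\<And>t. t < 0 \<Longrightarrow> g t = g0 t"
    and init: "AE \<zeta> in lborel. \<zeta> \<in> {0..1} \<longrightarrow> rate \<zeta> *\<^sub>R g0 (- p \<zeta>) = z0 \<zeta>"
  shows "transport_mild l z0 (zsol g) (wsol g)"
    and "\<And>t. 0 \<le> t \<Longrightarrow> wsol g t 0 = A *v wsol g t 1 + integral {0..t} f"
proof -
  have "AE \<zeta> in lborel. \<zeta> \<in> {0..1} \<longrightarrow> zsol g 0 \<zeta> = z0 \<zeta>"
    using init AE_lborel_singleton[of "0::real"]
  proof eventually_elim
    case (elim \<zeta>)
    then show ?case using p_less_iff[of 0 \<zeta>] neg[of "- p \<zeta>"] by (auto simp: zsol_def)
  qed
  then show "transport_mild l z0 (zsol g) (wsol g)"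
    by (rule transport_mild_initial_cong[OF zsol_mild[OF g] _ z0])
  fix t :: real assume "0 \<le> t"
  have gs: "(\<lambda>s. g (s - T)) integrable_on {0..t}"
    by (rule loc_L2_integrable_on[OF loc_L2_shift[OF g]])
  have "wsol g t 0 = integral {0..t} g" using \<open>0 \<le> t\<close> by (simp add: wsol_0 prim_def)
  also have "\<dots> = integral {0..t} (\<lambda>s. A *v g (s - T) + f s)"
    using g_rec by (intro integral_cong) auto
  also have "\<dots> = integral {0..t} (\<lambda>s. A *v g (s - T)) + integral {0..t} f"
    by (intro Henstock_Kurzweil_Integration.integral_add loc_L2_integrable_on loc_L2_matrix loc_L2_shift g f)
  also have "integral {0..t} (\<lambda>s. A *v g (s - T)) = A *v wsol g t 1"
    using \<open>0 \<le> t\<close> by (simp add: matrix_integral[OF gs] wsol_1_integral[OF g])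
  finally show "wsol g t 0 = A *v wsol g t 1 + integral {0..t} f" .
qed

end

subsection \<open>The cost in terms of trajectories\<close>

context transport
begin

text \<open>Evaluates \<open>cost_J\<close> along an explicit trajectory whose recursion holds at
  every nonnegative time; the input is changed only on a null set.\<close>

lemma open_loop_trajectory:
  fixes A :: "complex ^ 'n ^ 'n" and B :: "complex ^ 'p ^ 'n"
    and C :: "complex ^ 'n ^ 'm" and D :: "complex ^ 'p ^ 'm"
  assumes lam_m: "lam0 \<in> borel_measurable (lebesgue_on {0..1})"
    and lam: "AE \<zeta> in lborel. \<zeta> \<in> {0..1} \<longrightarrow> l \<zeta> = lam0 \<zeta>"
    and z0: "z0 \<in> L2_on {0..1}" and u: "u \<in> L2_on {0..}"
    and g0: "loc_L2 g0" and init: "AE \<zeta> in lborel. \<zeta> \<in> {0..1} \<longrightarrow> rate \<zeta> *\<^sub>R g0 (- p \<zeta>) = z0 \<zeta>"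
  obtains g v where "loc_L2 g" "v \<in> borel_measurable borel" "AE t in lborel. 0 \<le> t \<longrightarrow> u t = v t"
    "\<And>t. t < 0 \<Longrightarrow> g t = g0 t" "\<And>t. 0 \<le> t \<Longrightarrow> g t = A *v g (t - T) + B *v v t"
    "cost_J lam0 A B C D z0 u
      = (\<integral>\<^sup>+t\<in>{0..}. ennreal ((norm (C *v g (t - T) + D *v v t))\<^sup>2 + (norm (v t))\<^sup>2) \<partial>lborel)"
proof -
  obtain v1 where v1 [measurable]: "v1 \<in> borel_measurable borel" and uv1: "AE t in lborel. t \<in> {0..} \<longrightarrow> u t = v1 t"
    by (rule borel_representative[OF L2_onD(1)[OF u]]) auto
  \<comment> \<open>Zero in the past, so that \<open>v\<close> is locally square integrable on the
    whole line.\<close>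
  define v where "v t = (if 0 \<le> t then v1 t else 0)" for t
  have v [measurable]: "v \<in> borel_measurable borel" unfolding v_def by measurable
  have uv: "AE t in lborel. t \<in> {0..} \<longrightarrow> u t = v t"
    using uv1 by eventually_elim (auto simp: v_def)
  have "v \<in> L2_on {0..}"
    using uv by (intro L2_on_cong_AE[OF u] borel_measurable_lebesgue_onI v) (simp add: AE_lebesgue_on_iff)
  then have vfin: "energy {0..} v < \<infinity>"
    by (simp add: L2_on_borel_iff)
  have loc_v: "loc_L2 v"
    unfolding loc_L2_def
  proof (intro conjI allI v)
    fix a b :: real
    have "energy {a..b} v \<le> energy {0..} v"
      by (intro nn_integral_mono) (auto simp: v_def indicator_def)
    also note vfin
    finally show "energy {a..b} v < \<infinity>" .
  qed
  have Bv: "loc_L2 (\<lambda>t. B *v v t)" by (rule loc_L2_matrix[OF loc_v])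
  obtain g where g: "loc_L2 g" "\<And>t. t < 0 \<Longrightarrow> g t = g0 t" "\<And>t. 0 \<le> t \<Longrightarrow> g t = A *v g (t - T) + B *v v t"
    using trajectory_exists[OF T_pos g0 Bv] by blast
  have sol: "transport_mild l z0 (zsol g) (wsol g)"
    by (rule trajectory_solution(1)[OF z0 g(1) Bv _ g(2) init]) (rule g(3))
  have bc: "wsol g t 0 = A *v wsol g t 1 + integral {0..t} (\<lambda>t. B *v v t)" if "0 \<le> t" for t
    by (rule trajectory_solution(2)[OF z0 g(1) Bv _ g(2) init that]) (rule g(3))
  have gT: "loc_L2 (\<lambda>t. g (t - T))" by (rule loc_L2_shift[OF g(1)])
  define y where "y t = C *v g (t - T) + D *v v t" for t
  have loc_y: "loc_L2 y"
    unfolding y_def[abs_def] by (intro loc_L2_add loc_L2_matrix gT loc_v)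
  have int_u: "integral {0..t} u = integral {0..t} v" for t
    by (rule integral_cong_AE_interval[OF uv]) auto
  have int_B: "integral {0..t} (\<lambda>t. B *v v t) = B *v integral {0..t} u" for t
    unfolding int_u by (rule matrix_integral[OF loc_L2_integrable_on[OF loc_v]])
  have int_y: "integral {0..t} y = C *v wsol g t 1 + D *v integral {0..t} u" if "0 \<le> t" for t
  proof -
    have "integral {0..t} y = integral {0..t} (\<lambda>t. C *v g (t - T)) + integral {0..t} (\<lambda>t. D *v v t)"
      unfolding y_def[abs_def]
      by (intro Henstock_Kurzweil_Integration.integral_add loc_L2_integrable_on loc_L2_matrix gT loc_v)
    then show ?thesis
      using wsol_1_integral[OF g(1) that]
      by (simp add: int_u matrix_integral[OF loc_L2_integrable_on[OF loc_v]] matrix_integral[OF loc_L2_integrable_on[OF gT]])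
  qed
  have mild: "transport_mild lam0 z0 (zsol g) (wsol g)"
    by (rule transport_mild_speed_cong[OF lam lam_m sol])
  have "system_solution lam0 A B C D z0 u (zsol g) (wsol g) y"
    unfolding system_solution_def
  proof (intro conjI allI impI mild)
    show "u \<in> L2_loc" unfolding L2_loc_def using L2_on_subset[OF u] by auto
    show "y \<in> L2_loc" unfolding L2_loc_def using loc_L2_L2_on[OF loc_y] by auto
    show "B *v integral {0..t} u = wsol g t 0 - A *v wsol g t 1" if "0 \<le> t" for t
      using bc[OF that] int_B by simp
    show "integral {0..t} y = C *v wsol g t 1 + D *v integral {0..t} u" if "0 \<le> t" for t
      by (rule int_y[OF that])
  qed
  \<comment> \<open>Existence of one solution makes the chosen output an actual output.\<close>
  then have "\<exists>y z w. system_solution lam0 A B C D z0 u z w y" by blast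
  then have "\<exists>z w. system_solution lam0 A B C D z0 u z w (system_output lam0 A B C D z0 u)"
    unfolding system_output_def by (rule someI_ex)
  then obtain z' w' where out: "system_solution lam0 A B C D z0 u z' w' (system_output lam0 A B C D z0 u)"
    by blast
  define y' where "y' = system_output lam0 A B C D z0 u"
  have out': "y' \<in> L2_loc" "transport_mild lam0 z0 z' w'"
    "\<And>t. 0 \<le> t \<Longrightarrow> B *v integral {0..t} u = w' t 0 - A *v w' t 1"
    "\<And>t. 0 \<le> t \<Longrightarrow> integral {0..t} y' = C *v w' t 1 + D *v integral {0..t} u"
    using out unfolding system_solution_def y'_def by auto
  have "l \<in> borel_measurable (lebesgue_on {0..1})" by (rule borel_measurable_lebesgue_onI) measurable
  moreover have "AE \<zeta> in lborel. \<zeta> \<in> {0..1} \<longrightarrow> lam0 \<zeta> = l \<zeta>" using lam by eventually_elim auto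
  ultimately have mild': "transport_mild l z0 z' w'"
    using transport_mild_speed_cong out'(2) by blast
  \<comment> \<open>The chosen solution has the same integrated outflow, hence the same integrated
    output.\<close>
  have w1: "w' t 1 = wsol g t 1" if "0 \<le> t" for t
  proof (rule mild_unique(1)[OF z0 mild' sol, of "(*v) A" "\<lambda>t. B *v integral {0..t} u"])
    show "w' t 0 = A *v w' t 1 + B *v integral {0..t} u" if "0 \<le> t" for t
      using out'(3)[OF that] by simp
    show "wsol g t 0 = A *v wsol g t 1 + B *v integral {0..t} u" if "0 \<le> t" for t
      using bc[OF that] by (simp add: int_B)
  qed (use that in auto)
  have "AE t in lborel. 0 \<le> t \<longrightarrow> y' t = y t"
  proof (rule AE_eq_if_integral_eq)
    fix t :: real assume "0 \<le> t"
    have "y' \<in> L2_on {0..t + 1}" using out'(1) \<open>0 \<le> t\<close> by (simp add: L2_loc_def)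
    then show "y' integrable_on {0..t}" by (rule L2_on_integrable_on(1)) auto
    show "y integrable_on {0..t}" by (rule loc_L2_integrable_on[OF loc_y])
    show "integral {0..t} y' = integral {0..t} y"
      using out'(4)[OF \<open>0 \<le> t\<close>] int_y[OF \<open>0 \<le> t\<close>] w1[OF \<open>0 \<le> t\<close>] by simp
  qed
  then have "cost_J lam0 A B C D z0 u
      = (\<integral>\<^sup>+t\<in>{0..}. ennreal ((norm (C *v g (t - T) + D *v v t))\<^sup>2 + (norm (v t))\<^sup>2) \<partial>lborel)"
    unfolding cost_J_def y'_def[symmetric] using uv
    by (subst nn_integral_lebesgue_on) (auto intro!: nn_integral_cong_AE simp: y_def indicator_def elim!: eventually_elim2)
  moreover have "AE t in lborel. 0 \<le> t \<longrightarrow> u t = v t" using uv by simp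
  ultimately show thesis using that[of g v] g v by blast
qed

text \<open>Write \<open>t\<close> as \<open>j\<close> full periods plus a remainder
  \<open>r\<close>. The profile at \<open>t\<close> is the \<open>j\<close>-th power of
  \<open>M\<close> applied to the profile at \<open>r\<close>, which consists of initial data and of
  their images under \<open>M\<close>.\<close>

lemma trajectory_energy_decay:
  fixes M :: "complex ^ 'n ^ 'n"
  assumes g [measurable]: "g \<in> borel_measurable borel" and g0 [measurable]: "g0 \<in> borel_measurable borel"
    and neg: "\<And>t. t < 0 \<Longrightarrow> g t = g0 t" and rec: "\<And>t. 0 \<le> t \<Longrightarrow> g t = M *v g (t - T)"
    and "0 < c" "0 < \<rho>" "\<rho> < 1" and pow: "\<And>k x. norm (((*v) M ^^ k) x) \<le> c * \<rho> ^ k * norm x"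
    and "0 \<le> t"
  shows "energy {0..T} (\<lambda>x. g (t - x))
     \<le> ennreal ((c * \<rho> ^ nat \<lfloor>t / T\<rfloor>)\<^sup>2 * (1 + c\<^sup>2)) * total_energy g0"
proof -
  define j where "j = nat \<lfloor>t / T\<rfloor>"
  define r where "r = t - real j * T"
  have "real j \<le> t / T" "t / T < real j + 1"
    using \<open>0 \<le> t\<close> T_pos by (auto simp: j_def)
  then have r: "0 \<le> r" "r < T" using T_pos by (auto simp: r_def field_simps)
  have iter: "g (s + real k * T) = ((*v) M ^^ k) (g s)" if "- T \<le> s" for s k
  proof (induction k)
    case (Suc k)
    have "0 \<le> real k * T" "real (Suc k) * T = T + real k * T"
      using T_pos by (simp_all add: algebra_simps)
    then have "0 \<le> s + real (Suc k) * T" using that by linarith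
    then show ?case using rec[of "s + real (Suc k) * T"] Suc by (simp add: algebra_simps)
  qed simp
  have "(norm (g (t - x)))\<^sup>2 \<le> (c * \<rho> ^ j)\<^sup>2 * ((norm (g0 (r - x)))\<^sup>2 + c\<^sup>2 * (norm (g0 (r - x - T)))\<^sup>2)"
    if x: "x \<in> {0..T}" for x
  proof -
    have "g (t - x) = ((*v) M ^^ j) (g (r - x))"
      using iter[of "r - x" j] x r by (simp add: r_def algebra_simps)
    then have "(norm (g (t - x)))\<^sup>2 \<le> (c * \<rho> ^ j * norm (g (r - x)))\<^sup>2"
      using pow by (simp add: power_mono)
    also have "\<dots> = (c * \<rho> ^ j)\<^sup>2 * (norm (g (r - x)))\<^sup>2" by (simp add: power_mult_distrib)
    \<comment> \<open>One of the two summands applies, depending on the sign of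
      \<open>r - x\<close>; adding both spares splitting the integral.\<close>
    also have "(norm (g (r - x)))\<^sup>2 \<le> (norm (g0 (r - x)))\<^sup>2 + c\<^sup>2 * (norm (g0 (r - x - T)))\<^sup>2"
    proof (cases "r - x < 0")
      case True
      then show ?thesis by (simp add: neg)
    next
      case False
      then have "g (r - x) = M *v g0 (r - x - T)"
        using rec[of "r - x"] neg[of "r - x - T"] x r by simp
      moreover have "norm (M *v g0 (r - x - T)) \<le> c * \<rho> * norm (g0 (r - x - T))"
        using pow[of 1 "g0 (r - x - T)"] by simp
      moreover have "c * \<rho> * norm (g0 (r - x - T)) \<le> c * 1 * norm (g0 (r - x - T))"
        using \<open>0 < c\<close> \<open>\<rho> < 1\<close> by (intro mult_right_mono mult_left_mono) auto
      ultimately have "norm (g (r - x)) \<le> c * norm (g0 (r - x - T))" by simp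
      then have "(norm (g (r - x)))\<^sup>2 \<le> (c * norm (g0 (r - x - T)))\<^sup>2" by (rule power_mono) simp
      then show ?thesis by (simp add: power_mult_distrib add_increasing)
    qed
    finally show ?thesis by (simp add: mult_left_mono)
  qed
  then have "energy {0..T} (\<lambda>x. g (t - x))
     \<le> (\<integral>\<^sup>+x. ennreal ((c * \<rho> ^ j)\<^sup>2) * (ennreal ((norm (g0 (r - x)))\<^sup>2) + ennreal (c\<^sup>2) * ennreal ((norm (g0 (r - x - T)))\<^sup>2)) \<partial>lborel)"
    by (intro nn_integral_mono) (auto simp: indicator_def ennreal_leI simp flip: ennreal_mult' ennreal_plus)
  also have "\<dots> = ennreal ((c * \<rho> ^ j)\<^sup>2) * (total_energy (\<lambda>x. g0 (r - x))
      + ennreal (c\<^sup>2) * total_energy (\<lambda>x. g0 (r - x - T)))"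
    by (simp add: nn_integral_cmult nn_integral_add)
  also have "total_energy (\<lambda>x. g0 (r - x)) = total_energy g0"
    by (subst nn_integral_real_affine[of "\<lambda>x. ennreal ((norm (g0 x))\<^sup>2)" "-1" r]) auto
  also have "total_energy (\<lambda>x. g0 (r - x - T)) = total_energy g0"
    by (subst nn_integral_real_affine[of "\<lambda>x. ennreal ((norm (g0 x))\<^sup>2)" "-1" "r - T"]) (auto simp: algebra_simps)
  also have "ennreal ((c * \<rho> ^ j)\<^sup>2) * (total_energy g0 + ennreal (c\<^sup>2) * total_energy g0)
      = ennreal ((c * \<rho> ^ j)\<^sup>2 * (1 + c\<^sup>2)) * total_energy g0"
    by (simp add: ennreal_mult ennreal_plus distrib_left distrib_right mult.assoc)
  finally show ?thesis by (simp add: j_def)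
qed

end

lemma stable_matrix_power_bound:
  fixes A :: "complex ^ 'n ^ 'n"
  assumes "stable_matrix A"
  obtains c \<rho> where "0 < c" "0 < \<rho>" "\<rho> < 1" "\<And>k x. norm (((*v) A ^^ k) x) \<le> c * \<rho> ^ k * norm x"
proof (rule stable_matrix_adapted_norm[OF assms])
  fix \<nu> :: "complex ^ 'n \<Rightarrow> real" and \<rho> c :: real
  assume \<nu>: "0 < \<rho>" "\<rho> < 1" "0 < c" "\<And>x. norm x \<le> \<nu> x" "\<And>x. \<nu> x \<le> c * norm x"
    "\<And>x. \<nu> (A *v x) \<le> \<rho> * \<nu> x"
  have iter: "\<nu> (((*v) A ^^ k) x) \<le> \<rho> ^ k * \<nu> x" for k x
  proof (induction k)
    case (Suc k)
    have "\<nu> (((*v) A ^^ Suc k) x) \<le> \<rho> * \<nu> (((*v) A ^^ k) x)" using \<nu>(6) by simp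
    also have "\<dots> \<le> \<rho> * (\<rho> ^ k * \<nu> x)" using Suc \<nu>(1) by (intro mult_left_mono) auto
    finally show ?case by simp
  qed simp
  have "norm (((*v) A ^^ k) x) \<le> c * \<rho> ^ k * norm x" for k x
  proof -
    have "norm (((*v) A ^^ k) x) \<le> \<rho> ^ k * \<nu> x" using \<nu>(4) iter order_trans by blast
    also have "\<dots> \<le> \<rho> ^ k * (c * norm x)" using \<nu> by (intro mult_left_mono) auto
    finally show ?thesis by (simp add: mult_ac)
  qed
  then show thesis using that \<nu>(1-3) by blast
qed

context dual_riccati
begin

lemma V_measurable [measurable (raw)]:
  assumes "f \<in> borel_measurable M"
  shows "(\<lambda>x. V (f x)) \<in> borel_measurable M"
proof -
  have "continuous_on UNIV V"
    unfolding V_def[abs_def] cinner_def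
    by (intro continuous_intros linear_continuous_on matrix_vector_mul_bounded_linear
        continuous_on_component bounded_linear.continuous_on[OF matrix_vector_mul_bounded_linear])
  then have "V \<in> borel_measurable borel" by (rule borel_measurable_continuous_onI)
  then show ?thesis using assms by (rule measurable_compose[rotated])
qed

lemma V_le: obtains K where "0 \<le> K" "\<And>x. V x \<le> K * (norm x)\<^sup>2"
proof -
  obtain K where K: "\<And>x. norm (X *v x) \<le> K * norm x" "K \<ge> 0"
    using bounded_linear.nonneg_bounded[OF matrix_vector_mul_bounded_linear[of X]] by (metis mult.commute)
  have "V x \<le> (real CARD('n) * K) * (norm x)\<^sup>2" for x
  proof -
    have "V x \<le> norm (\<Sum>i\<in>UNIV. cnj (x $ i) * (X *v x) $ i)"
      unfolding V_def cinner_def by (rule complex_Re_le_cmod)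
    also have "\<dots> \<le> (\<Sum>i\<in>UNIV. norm (x $ i) * norm ((X *v x) $ i))"
      by (rule order_trans[OF norm_sum]) (simp add: norm_mult)
    also have "\<dots> \<le> (\<Sum>i\<in>(UNIV :: 'n set). norm x * (K * norm x))"
      using K by (intro sum_mono mult_mono Finite_Cartesian_Product.norm_nth_le)
        (auto intro: order_trans[OF Finite_Cartesian_Product.norm_nth_le])
    finally show ?thesis by (simp add: power2_eq_square mult_ac)
  qed
  then show thesis using that[of "real CARD('n) * K"] K(2) by simp
qed

text \<open>The discrete bound is applied at each phase. The first integral sees \<open>g\<close>
  only at negative times and so is the same for all inputs.\<close>

lemma cost_integral_lower_bound:
  fixes d :: real
  assumes g [measurable]: "g \<in> borel_measurable borel" and v [measurable]: "v \<in> borel_measurable borel"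
    and "0 < d" and rec: "\<And>t. 0 \<le> t \<Longrightarrow> g t = A *v g (t - d) + B *v v t"
  shows "(\<integral>\<^sup>+s\<in>{0..<d}. ennreal (V (g (s - d))) \<partial>lborel)
      + energy {0..} (\<lambda>t. v t - F *v g (t - d))
     \<le> (\<integral>\<^sup>+t\<in>{0..}. ennreal ((norm (C *v g (t - d) + D *v v t))\<^sup>2 + (norm (v t))\<^sup>2) \<partial>lborel)"
proof -
  have "(\<integral>\<^sup>+s\<in>{0..<d}. ennreal (V (g (s - d))) \<partial>lborel)
      + energy {0..} (\<lambda>t. v t - F *v g (t - d))
    = (\<integral>\<^sup>+s\<in>{0..<d}. ennreal (V (g (s - d))) \<partial>lborel)
      + (\<integral>\<^sup>+s\<in>{0..<d}. (\<Sum>k. ennreal ((norm (v (s + real k * d) - F *v g (s + real k * d - d)))\<^sup>2)) \<partial>lborel)"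
    using \<open>0 < d\<close> by (subst nn_integral_fold_period[of _ d]) auto
  also have "\<dots> = (\<integral>\<^sup>+s\<in>{0..<d}. ennreal (V (g (s - d)))
      + (\<Sum>k. ennreal ((norm (v (s + real k * d) - F *v g (s + real k * d - d)))\<^sup>2)) \<partial>lborel)"
    by (subst nn_integral_add[symmetric]) (auto simp: distrib_right)
  also have "\<dots> \<le> (\<integral>\<^sup>+s\<in>{0..<d}. (\<Sum>k. ennreal ((norm (C *v g (s + real k * d - d) + D *v v (s + real k * d)))\<^sup>2
      + (norm (v (s + real k * d)))\<^sup>2)) \<partial>lborel)"
  proof (rule nn_integral_mono)
    fix s
    show "(ennreal (V (g (s - d))) + (\<Sum>k. ennreal ((norm (v (s + real k * d) - F *v g (s + real k * d - d)))\<^sup>2))) * indicator {0..<d} s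
      \<le> (\<Sum>k. ennreal ((norm (C *v g (s + real k * d - d) + D *v v (s + real k * d)))\<^sup>2
        + (norm (v (s + real k * d)))\<^sup>2)) * indicator {0..<d} s"
    proof (cases "s \<in> {0..<d}")
      case True
      have "g (s + real (Suc k) * d - d) = A *v g (s + real k * d - d) + B *v v (s + real k * d)" for k
        using rec[of "s + real k * d"] True \<open>0 < d\<close> by (simp add: algebra_simps)
      from cost_lower_bound[of "\<lambda>k. g (s + real k * d - d)" "\<lambda>k. v (s + real k * d)", OF this]
      show ?thesis using True by simp
    qed simp
  qed
  also have "\<dots> = (\<integral>\<^sup>+t\<in>{0..}. ennreal ((norm (C *v g (t - d) + D *v v t))\<^sup>2 + (norm (v t))\<^sup>2) \<partial>lborel)"
    using \<open>0 < d\<close> by (subst nn_integral_fold_period[of _ d]) auto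
  finally show ?thesis .
qed

lemma cost_integral_feedback:
  fixes d :: real
  assumes g [measurable]: "g \<in> borel_measurable borel"
    and "0 < d" and rec: "\<And>t. 0 \<le> t \<Longrightarrow> g t = (A + B ** F) *v g (t - d)"
  shows "(\<integral>\<^sup>+t\<in>{0..}. ennreal ((norm (C *v g (t - d) + D *v (F *v g (t - d))))\<^sup>2 + (norm (F *v g (t - d)))\<^sup>2) \<partial>lborel)
    = (\<integral>\<^sup>+s\<in>{0..<d}. ennreal (V (g (s - d))) \<partial>lborel)"
proof -
  have "(\<integral>\<^sup>+t\<in>{0..}. ennreal ((norm (C *v g (t - d) + D *v (F *v g (t - d))))\<^sup>2 + (norm (F *v g (t - d)))\<^sup>2) \<partial>lborel)
    = (\<integral>\<^sup>+s\<in>{0..<d}. (\<Sum>k. ennreal ((norm (C *v g (s + real k * d - d) + D *v (F *v g (s + real k * d - d))))\<^sup>2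
       + (norm (F *v g (s + real k * d - d)))\<^sup>2)) \<partial>lborel)"
    using \<open>0 < d\<close> by (subst nn_integral_fold_period[of _ d]) auto
  also have "\<dots> = (\<integral>\<^sup>+s\<in>{0..<d}. ennreal (V (g (s - d))) \<partial>lborel)"
  proof (rule nn_integral_cong)
    fix s
    show "(\<Sum>k. ennreal ((norm (C *v g (s + real k * d - d) + D *v (F *v g (s + real k * d - d))))\<^sup>2
       + (norm (F *v g (s + real k * d - d)))\<^sup>2)) * indicator {0..<d} s
      = ennreal (V (g (s - d))) * indicator {0..<d} s"
    proof (cases "s \<in> {0..<d}")
      case True
      have "g (s + real (Suc k) * d - d) = (A + B ** F) *v g (s + real k * d - d)" for k
        using rec[of "s + real k * d"] True \<open>0 < d\<close> by (simp add: algebra_simps)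
      from cost_of_feedback[of "\<lambda>k. g (s + real k * d - d)", OF this]
      show ?thesis using True by simp
    qed simp
  qed
  finally show ?thesis .
qed

end

subsection \<open>The optimal control problem\<close>

text \<open>Local membership gives measurability on bounded intervals only; truncations carry it to
  the half-line, and integrability is inherited from \<open>v\<close>.\<close>

lemma L2_on_half_line_if_AE_eq:
  fixes u :: "real \<Rightarrow> 'a::euclidean_space"
  assumes "u \<in> L2_loc" and v: "v \<in> borel_measurable borel" "v \<in> L2_on {0..}"
    and eq: "AE t in lborel. 0 \<le> t \<longrightarrow> u t = v t"
  shows "u \<in> L2_on {0..}"
proof -
  have "(\<lambda>t. if t \<in> {0..real (Suc n)} then u t else 0) \<in> borel_measurable lebesgue" for n
    using assms(1) by (subst borel_measurable_if) (auto simp: L2_loc_def L2_on_def)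
  moreover have "(\<lambda>n. if t \<in> {0..real (Suc n)} then u t else 0) \<longlonglongrightarrow> (if t \<in> {0..} then u t else 0)" for t
  proof (rule tendsto_eventually)
    obtain N where N: "t \<le> real N" using real_arch_simple by blast
    show "\<forall>\<^sub>F n in sequentially. (if t \<in> {0..real (Suc n)} then u t else 0) = (if t \<in> {0..} then u t else 0)"
      using eventually_ge_at_top[of N] by eventually_elim (use N in auto)
  qed
  ultimately have "(\<lambda>t. if t \<in> {0..} then u t else 0) \<in> borel_measurable lebesgue"
    by (rule borel_measurable_LIMSEQ_metric)
  then have "u \<in> borel_measurable (lebesgue_on {0..})" by (rule borel_measurable_if_D)
  then show ?thesis
    using eq by (intro L2_on_cong_AE[OF v(2)]) (auto simp: AE_lebesgue_on_iff elim: eventually_mono)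
qed

locale lq_problem = transport l lo hi + dual_riccati A B C D X Y
  for l lo hi and A :: "complex ^ 'n ^ 'n" and B :: "complex ^ 'p ^ 'n"
    and C :: "complex ^ 'n ^ 'm" and D :: "complex ^ 'p ^ 'm" and X Y +
  fixes lam0 :: "real \<Rightarrow> real"
  assumes lam_m: "lam0 \<in> borel_measurable (lebesgue_on {0..1})"
    and lam: "AE \<zeta> in lborel. \<zeta> \<in> {0..1} \<longrightarrow> l \<zeta> = lam0 \<zeta>"
begin

text \<open>The energy bound is included because exponential stability needs an estimate by the norm
  of the initial state.\<close>

definition closed_loop_trajectory :: "(real \<Rightarrow> complex ^ 'n) \<Rightarrow> (real \<Rightarrow> complex ^ 'n) \<Rightarrow> (real \<Rightarrow> complex ^ 'n) \<Rightarrow> bool" where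
  "closed_loop_trajectory z0 g0 g \<longleftrightarrow> loc_L2 g0 \<and>
     (AE \<zeta> in lborel. \<zeta> \<in> {0..1} \<longrightarrow> rate \<zeta> *\<^sub>R g0 (- p \<zeta>) = z0 \<zeta>) \<and>
     total_energy g0 \<le> ennreal (hi * (L2_norm_on {0..1} z0)\<^sup>2) \<and>
     loc_L2 g \<and> (\<forall>t<0. g t = g0 t) \<and> (\<forall>t\<ge>0. g t = (A + B ** F) *v g (t - T))"

lemma closed_loop_trajectory_exists:
  assumes "z0 \<in> L2_on {0..1}"
  obtains g0 g where "closed_loop_trajectory z0 g0 g"
proof -
  obtain g0 where g0: "loc_L2 g0" "AE \<zeta> in lborel. \<zeta> \<in> {0..1} \<longrightarrow> rate \<zeta> *\<^sub>R g0 (- p \<zeta>) = z0 \<zeta>"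
    "total_energy g0 \<le> ennreal (hi * (L2_norm_on {0..1} z0)\<^sup>2)"
    by (rule initial_trajectory[OF assms])
  have "loc_L2 (\<lambda>_ :: real. 0 :: complex ^ 'n)" by (simp add: loc_L2_def)
  from trajectory_exists[OF T_pos g0(1) this, of "A + B ** F"]
  obtain g where "loc_L2 g" "\<And>t. t < 0 \<Longrightarrow> g t = g0 t" "\<And>t. 0 \<le> t \<Longrightarrow> g t = (A + B ** F) *v g (t - T)"
    by auto
  then show thesis using that g0 unfolding closed_loop_trajectory_def by blast
qed

text \<open>Besides existence, every closed-loop solution must be identified with the explicit one,
  since optimality and stability are claimed for all of them.\<close>

lemma closed_loop:
  assumes z0: "z0 \<in> L2_on {0..1}" and traj: "closed_loop_trajectory z0 g0 g"
  shows "closed_loop_solution lam0 A B F z0 (zsol g) (wsol g)"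
    and "\<And>z w t. closed_loop_solution lam0 A B F z0 z w \<Longrightarrow> 0 \<le> t \<Longrightarrow> w t 1 = wsol g t 1"
    and "\<And>z w t. closed_loop_solution lam0 A B F z0 z w \<Longrightarrow> 0 \<le> t \<Longrightarrow>
      AE \<zeta> in lborel. \<zeta> \<in> {0..1} \<longrightarrow> z t \<zeta> = zsol g t \<zeta>"
proof -
  have g: "loc_L2 g" "\<And>t. t < 0 \<Longrightarrow> g t = g0 t" "\<And>t. 0 \<le> t \<Longrightarrow> g t = (A + B ** F) *v g (t - T) + 0"
    and init: "AE \<zeta> in lborel. \<zeta> \<in> {0..1} \<longrightarrow> rate \<zeta> *\<^sub>R g0 (- p \<zeta>) = z0 \<zeta>"
    using traj by (auto simp: closed_loop_trajectory_def)
  have zero: "loc_L2 (\<lambda>_ :: real. 0 :: complex ^ 'n)" by (simp add: loc_L2_def)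
  have sol: "transport_mild l z0 (zsol g) (wsol g)"
    by (rule trajectory_solution(1)[OF z0 g(1) zero _ g(2) init]) (rule g(3))
  have sol_bc: "wsol g t 0 = (A + B ** F) *v wsol g t 1 + integral {0..t} (\<lambda>_. 0)" if "0 \<le> t" for t
    by (rule trajectory_solution(2)[OF z0 g(1) zero _ g(2) init that]) (rule g(3))
  show "closed_loop_solution lam0 A B F z0 (zsol g) (wsol g)"
    unfolding closed_loop_solution_def
    using transport_mild_speed_cong[OF lam lam_m sol] sol_bc by simp
  fix z w t assume cl: "closed_loop_solution lam0 A B F z0 z w" and t: "(0::real) \<le> t"
  have "l \<in> borel_measurable (lebesgue_on {0..1})" by (rule borel_measurable_lebesgue_onI) measurable
  moreover have "AE \<zeta> in lborel. \<zeta> \<in> {0..1} \<longrightarrow> lam0 \<zeta> = l \<zeta>" using lam by eventually_elim auto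
  ultimately have mild: "transport_mild l z0 z w"
    using transport_mild_speed_cong cl unfolding closed_loop_solution_def by blast
  have bc: "w t 0 = (A + B ** F) *v w t 1 + 0" "wsol g t 0 = (A + B ** F) *v wsol g t 1 + 0" if "0 \<le> t" for t
    using cl sol_bc[OF that] that by (auto simp: closed_loop_solution_def)
  note unique = mild_unique[OF z0 mild sol, of "(*v) (A + B ** F)" "\<lambda>_. 0", OF bc t]
  show "w t 1 = wsol g t 1" by (rule unique(1)) auto
  show "AE \<zeta> in lborel. \<zeta> \<in> {0..1} \<longrightarrow> z t \<zeta> = zsol g t \<zeta>" by (rule unique(2))
qed

lemma closed_loop_trace:
  assumes z0: "z0 \<in> L2_on {0..1}" and traj: "closed_loop_trajectory z0 g0 g"
  shows "boundary_trace (wsol g) 1 (\<lambda>t. g (t - T))"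
    and "\<And>z w \<tau>. closed_loop_solution lam0 A B F z0 z w \<Longrightarrow> boundary_trace w 1 \<tau> \<Longrightarrow>
      AE t in lborel. 0 \<le> t \<longrightarrow> \<tau> t = g (t - T)"
proof -
  have g: "loc_L2 g" using traj by (simp add: closed_loop_trajectory_def)
  have gT: "loc_L2 (\<lambda>t. g (t - T))" by (rule loc_L2_shift[OF g])
  have "AE t in lborel. 0 < t \<longrightarrow> ((\<lambda>t. integral {0..t} (\<lambda>t. g (t - T))) has_vector_derivative g (t - T)) (at t)"
    by (rule AE_has_vector_derivative_integral[OF loc_L2_integrable_on[OF gT]])
  then have deriv: "AE t in lborel. 0 < t \<longrightarrow> ((\<lambda>s. wsol g s 1) has_vector_derivative g (t - T)) (at t)"
  proof eventually_elim
    case (elim t)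
    show ?case
    proof
      assume "0 < t"
      with elim have d: "((\<lambda>t. integral {0..t} (\<lambda>t. g (t - T))) has_vector_derivative g (t - T)) (at t)"
        by blast
      \<comment> \<open>For negative \<open>s\<close> the integral is 0 and need not equal
        \<open>wsol g s 1\<close>; an open neighbourhood of a positive \<open>t\<close> is
        enough.\<close>
      have eq: "integral {0..s} (\<lambda>t. g (t - T)) = wsol g s 1" if "s \<in> {0<..}" for s
        using wsol_1_integral[OF g, of s] that by simp
      show "((\<lambda>s. wsol g s 1) has_vector_derivative g (t - T)) (at t)"
        by (rule has_vector_derivative_transform_within_open[OF d open_greaterThan _ eq]) (use \<open>0 < t\<close> in auto)
    qed
  qed
  have nz: "AE t in lborel. t \<noteq> (0::real)" by (rule AE_lborel_singleton)
  have "AE t in lborel. t \<in> {0..} \<longrightarrow> ((\<lambda>s. wsol g s 1) has_vector_derivative g (t - T)) (at t)"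
    using deriv nz by eventually_elim auto
  then show "boundary_trace (wsol g) 1 (\<lambda>t. g (t - T))"
    unfolding boundary_trace_def L2_loc_def using loc_L2_L2_on[OF gT] by (auto simp: AE_lebesgue_on_iff)
  fix z w \<tau> assume cl: "closed_loop_solution lam0 A B F z0 z w" and tr: "boundary_trace w 1 \<tau>"
  have "AE t in lborel. t \<in> {0..} \<longrightarrow> ((\<lambda>s. w s 1) has_vector_derivative \<tau> t) (at t)"
    using tr by (simp add: boundary_trace_def AE_lebesgue_on_iff)
  with deriv nz show "AE t in lborel. 0 \<le> t \<longrightarrow> \<tau> t = g (t - T)"
  proof eventually_elim
    case (elim t)
    show ?case
    proof
      assume "0 \<le> t"
      then have "0 < t" using elim by simp
      have "((\<lambda>s. wsol g s 1) has_vector_derivative \<tau> t) (at t)"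
        using elim \<open>0 < t\<close> closed_loop(2)[OF z0 traj cl]
        by (auto intro!: has_vector_derivative_transform_within_open[of "\<lambda>s. w s 1" _ t "{0<..}"])
      then show "\<tau> t = g (t - T)"
        using elim \<open>0 < t\<close> vector_derivative_unique_at by blast
    qed
  qed
qed

theorem closed_loop_exponentially_stable: "closed_loop_exp_stable lam0 A B F"
proof -
  obtain c \<rho> where c: "0 < c" "0 < \<rho>" "\<rho> < 1" "\<And>k x. norm (((*v) (A + B ** F) ^^ k) x) \<le> c * \<rho> ^ k * norm x"
    using stable_matrix_power_bound[OF stable] by blast
  \<comment> \<open>The root collects the norm equivalence (\<open>inverse lo\<close> and
    \<open>hi\<close>) and the partial first period (\<open>1 + c\<^sup>2\<close>);
    \<open>inverse \<rho>\<close> pays for rounding \<open>t / T\<close> down.\<close>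
  define K where "K = sqrt (inverse lo * (1 + c\<^sup>2) * hi) * c * inverse \<rho>"
  \<comment> \<open>Makes \<open>exp (- \<omega> * t)\<close> the power of \<open>\<rho>\<close>
    with exponent \<open>t / T\<close>.\<close>
  define \<omega> where "\<omega> = - ln \<rho> / T"
  have "0 < K" unfolding K_def using c lo_pos hi_pos by (simp add: add_pos_nonneg)
  have "0 < \<omega>" unfolding \<omega>_def using c T_pos by (simp add: divide_neg_pos ln_less_zero)
  have "L2_norm_on {0..1} (z t) \<le> K * exp (- \<omega> * t) * L2_norm_on {0..1} z0"
    if z0: "z0 \<in> L2_on {0..1}" and cl: "closed_loop_solution lam0 A B F z0 z w" and t: "0 \<le> t" for z0 z w t
  proof -
    obtain g0 g where traj: "closed_loop_trajectory z0 g0 g"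
      using closed_loop_trajectory_exists[OF z0] by blast
    then have g: "loc_L2 g" "loc_L2 g0" "\<And>t. t < 0 \<Longrightarrow> g t = g0 t" "\<And>t. 0 \<le> t \<Longrightarrow> g t = (A + B ** F) *v g (t - T)"
      and en: "total_energy g0 \<le> ennreal (hi * (L2_norm_on {0..1} z0)\<^sup>2)"
      by (auto simp: closed_loop_trajectory_def)
    note [measurable] = loc_L2_borel[OF g(1)] loc_L2_borel[OF g(2)]
    define j where "j = nat \<lfloor>t / T\<rfloor>"
    define n0 where "n0 = L2_norm_on {0..1} z0"
    have \<rho>j: "\<rho> ^ j \<le> inverse \<rho> * exp (- \<omega> * t)"
    proof -
      have "t / T \<le> real (Suc j)" using t T_pos unfolding j_def by linarith
      then have "real (Suc j) * ln \<rho> \<le> t / T * ln \<rho>"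
        using c by (intro mult_right_mono_neg) (auto simp: ln_le_zero_iff less_imp_le)
      then have "exp (real (Suc j) * ln \<rho>) \<le> exp (- \<omega> * t)" by (simp add: \<omega>_def mult.commute)
      moreover have "exp (real (Suc j) * ln \<rho>) = \<rho> * \<rho> ^ j"
        using c(2) by (simp only: exp_of_nat_mult exp_ln power_Suc)
      ultimately have "\<rho> * \<rho> ^ j \<le> exp (- \<omega> * t)" by (simp only:)
      then show ?thesis using c(2) by (simp add: inverse_eq_divide pos_le_divide_eq mult.commute)
    qed
    have "energy {0..1} (\<lambda>\<zeta>. zsol g t \<zeta>)
        \<le> ennreal (inverse lo) * energy {0..T} (\<lambda>x. g (t - x))"
      using nn_integral_rate_upper[of "\<lambda>x. g (t - x)"] by (simp add: zsol_def)
    also have "\<dots> \<le> ennreal (inverse lo) *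
        (ennreal ((c * \<rho> ^ j)\<^sup>2 * (1 + c\<^sup>2)) * total_energy g0)"
      unfolding j_def using g c t by (intro mult_left_mono trajectory_energy_decay[of g g0 "A + B ** F"]) auto
    also have "\<dots> \<le> ennreal (inverse lo) * (ennreal ((c * \<rho> ^ j)\<^sup>2 * (1 + c\<^sup>2)) * ennreal (hi * n0\<^sup>2))"
      using en unfolding n0_def by (intro mult_left_mono) auto
    also have "\<dots> = ennreal ((sqrt (inverse lo * (1 + c\<^sup>2) * hi) * c * \<rho> ^ j * n0)\<^sup>2)"
      using lo_pos hi_pos c by (simp add: power_mult_distrib mult_ac add_nonneg_nonneg flip: ennreal_mult')
    finally have "L2_norm_on {0..1} (zsol g t) \<le> sqrt (inverse lo * (1 + c\<^sup>2) * hi) * c * \<rho> ^ j * n0"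
      using zsol_borel[OF g(1)] lo_pos hi_pos c
      by (intro L2_norm_on_borel_le) (auto simp: n0_def intro!: mult_nonneg_nonneg add_nonneg_nonneg)
    also have "\<dots> \<le> sqrt (inverse lo * (1 + c\<^sup>2) * hi) * c * (inverse \<rho> * exp (- \<omega> * t)) * n0"
      using \<rho>j lo_pos hi_pos c
      by (intro mult_right_mono mult_left_mono) (auto simp: n0_def intro!: mult_nonneg_nonneg add_nonneg_nonneg)
    also have "\<dots> = K * exp (- \<omega> * t) * n0" by (simp add: K_def mult.assoc)
    finally have "L2_norm_on {0..1} (zsol g t) \<le> K * exp (- \<omega> * t) * n0" .
    moreover have "L2_norm_on {0..1} (z t) = L2_norm_on {0..1} (zsol g t)"
    proof (rule L2_norm_on_cong_AE)
      show "z t \<in> borel_measurable (lebesgue_on {0..1})"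
        using cl t by (auto simp: closed_loop_solution_def transport_mild_def X_continuous_def L2_on_def)
      show "zsol g t \<in> borel_measurable (lebesgue_on {0..1})"
        using zsol_L2[OF g(1)] by (simp add: L2_on_def)
      show "AE \<zeta> in lebesgue_on {0..1}. norm (z t \<zeta>) = norm (zsol g t \<zeta>)"
        using closed_loop(3)[OF z0 traj cl t] by (auto simp: AE_lebesgue_on_iff elim: eventually_mono)
    qed
    ultimately show ?thesis by (simp add: n0_def)
  qed
  then show ?thesis
    unfolding closed_loop_exp_stable_def using \<open>0 < K\<close> \<open>0 < \<omega>\<close> by blast
qed

text \<open>The value \<open>V0\<close> depends on the initial data alone. Every control costs at
  least \<open>V0\<close> plus the energy of its deviation from feedback along its own trajectory,
  and the closed loop attains \<open>V0\<close>.\<close>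

theorem feedback_optimal:
  assumes z0: "z0 \<in> L2_on {0..1}" and cl: "closed_loop_solution lam0 A B F z0 z w"
    and tr: "boundary_trace w 1 \<tau>" and "0 < c"
  shows "unique_L2_minimizer (\<lambda>u. ennreal c * cost_J lam0 A B C D z0 u) (\<lambda>t. F *v \<tau> t)"
proof -
  obtain g0 g where traj: "closed_loop_trajectory z0 g0 g"
    using closed_loop_trajectory_exists[OF z0] by blast
  then have g0: "loc_L2 g0" and init: "AE \<zeta> in lborel. \<zeta> \<in> {0..1} \<longrightarrow> rate \<zeta> *\<^sub>R g0 (- p \<zeta>) = z0 \<zeta>"
    and g: "loc_L2 g" "\<And>t. t < 0 \<Longrightarrow> g t = g0 t" "\<And>t. 0 \<le> t \<Longrightarrow> g t = (A + B ** F) *v g (t - T)"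
    and en: "total_energy g0 \<le> ennreal (hi * (L2_norm_on {0..1} z0)\<^sup>2)"
    by (auto simp: closed_loop_trajectory_def)
  have gm [measurable]: "g \<in> borel_measurable borel" "g0 \<in> borel_measurable borel"
    by (rule loc_L2_borel[OF g(1)] loc_L2_borel[OF g0])+
  define J where "J = cost_J lam0 A B C D z0"
  define V0 where "V0 = (\<integral>\<^sup>+s\<in>{0..<T}. ennreal (V (g0 (s - T))) \<partial>lborel)"
  have V0: "(\<integral>\<^sup>+s\<in>{0..<T}. ennreal (V (h (s - T))) \<partial>lborel) = V0" if "\<And>t. t < 0 \<Longrightarrow> h t = g0 t" for h
    unfolding V0_def using that by (intro nn_integral_cong) (auto simp: indicator_def)
  \<comment> \<open>Finiteness puts the feedback control into the admissible class and later allows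
    \<open>V0\<close> to be cancelled in \<open>ennreal\<close>.\<close>
  have V0_fin: "V0 < \<infinity>"
  proof -
    obtain K where K: "0 \<le> K" "\<And>x. V x \<le> K * (norm x)\<^sup>2" using V_le by blast
    have "V0 \<le> (\<integral>\<^sup>+s. ennreal K * ennreal ((norm (g0 (s - T)))\<^sup>2) \<partial>lborel)"
      unfolding V0_def using K
      by (intro nn_integral_mono) (auto simp: indicator_def ennreal_leI simp flip: ennreal_mult')
    also have "\<dots> = ennreal K * total_energy (\<lambda>s. g0 (s - T))"
      by (rule nn_integral_cmult) measurable
    also have "total_energy (\<lambda>s. g0 (s - T)) = total_energy g0"
      by (subst nn_integral_real_affine[of "\<lambda>x. ennreal ((norm (g0 x))\<^sup>2)" 1 "- T"]) auto
    also have "ennreal K * \<dots> \<le> ennreal K * ennreal (hi * (L2_norm_on {0..1} z0)\<^sup>2)"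
      using en by (rule mult_left_mono) simp
    also have "\<dots> < \<infinity>" by (simp add: ennreal_mult_less_top)
    finally show ?thesis .
  qed
  have uopt: "AE t in lborel. 0 \<le> t \<longrightarrow> F *v \<tau> t = F *v g (t - T)"
    using closed_loop_trace(2)[OF z0 traj cl tr] by eventually_elim auto
  have opt_cost: "(\<integral>\<^sup>+t\<in>{0..}. ennreal ((norm (C *v g (t - T) + D *v (F *v g (t - T))))\<^sup>2 + (norm (F *v g (t - T)))\<^sup>2) \<partial>lborel) = V0"
    using cost_integral_feedback[OF gm(1) T_pos g(3)] V0[OF g(2)] by simp
  have uopt_L2: "(\<lambda>t. F *v \<tau> t) \<in> L2_on {0..}"
  proof (rule L2_on_half_line_if_AE_eq[OF _ _ _ uopt])
    show "(\<lambda>t. F *v \<tau> t) \<in> L2_loc"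
      using tr L2_on_bounded_linear[OF matrix_vector_mul_bounded_linear] by (auto simp: boundary_trace_def L2_loc_def)
    show m: "(\<lambda>t. F *v g (t - T)) \<in> borel_measurable borel" by measurable
    have "energy {0..} (\<lambda>t. F *v g (t - T)) \<le> V0"
      unfolding opt_cost[symmetric] by (intro nn_integral_mono mult_right_mono ennreal_leI) auto
    then show "(\<lambda>t. F *v g (t - T)) \<in> L2_on {0..}"
      using V0_fin m by (simp add: L2_on_borel_iff)
  qed
  have lower: "\<exists>h v. h \<in> borel_measurable borel \<and> v \<in> borel_measurable borel \<and>
      (AE t in lborel. 0 \<le> t \<longrightarrow> u t = v t) \<and> (\<forall>t<0. h t = g0 t) \<and> (\<forall>t\<ge>0. h t = A *v h (t - T) + B *v v t) \<and>
      J u = (\<integral>\<^sup>+t\<in>{0..}. ennreal ((norm (C *v h (t - T) + D *v v t))\<^sup>2 + (norm (v t))\<^sup>2) \<partial>lborel) \<and>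
      V0 + energy {0..} (\<lambda>t. v t - F *v h (t - T)) \<le> J u" if u: "u \<in> L2_on {0..}" for u
  proof -
    obtain h v where h: "loc_L2 h" "v \<in> borel_measurable borel" "AE t in lborel. 0 \<le> t \<longrightarrow> u t = v t"
      "\<And>t. t < 0 \<Longrightarrow> h t = g0 t" "\<And>t. 0 \<le> t \<Longrightarrow> h t = A *v h (t - T) + B *v v t"
      "J u = (\<integral>\<^sup>+t\<in>{0..}. ennreal ((norm (C *v h (t - T) + D *v v t))\<^sup>2 + (norm (v t))\<^sup>2) \<partial>lborel)"
      using open_loop_trajectory[OF lam_m lam z0 u g0 init, of A B C D] unfolding J_def by blast
    have "V0 + energy {0..} (\<lambda>t. v t - F *v h (t - T)) \<le> J u"
      using cost_integral_lower_bound[OF loc_L2_borel[OF h(1)] h(2) T_pos h(5)] V0[OF h(4)] by (simp add: h(6))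
    then show ?thesis using h loc_L2_borel[OF h(1)] by blast
  qed
  \<comment> \<open>Used with \<open>M = A\<close> for trajectories with the same input and with
    \<open>M = A + B ** F\<close> for two that both follow the feedback law.\<close>
  have same: "AE t in lborel. h t = g t"
    if "\<And>t. t < 0 \<Longrightarrow> h t = g0 t" and rec: "AE t in lborel. 0 \<le> t \<longrightarrow> h t - g t = M *v (h (t - T) - g (t - T))" for h M
  proof -
    have "AE t in lborel. h t - g t = 0"
      using that g(2) by (intro AE_recursion_zero[OF T_pos _ rec]) simp
    then show ?thesis by eventually_elim simp
  qed
  have AF: "(A + B ** F) *v x = A *v x + B *v (F *v x)" for x
    by (simp add: matrix_vector_mult_add_rdistrib matrix_vector_mul_assoc)
  \<comment> \<open>The cost of the feedback control is defined by an open-loop trajectory, which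
    must first be identified with \<open>g\<close>.\<close>
  have J_opt: "J (\<lambda>t. F *v \<tau> t) \<le> V0"
  proof -
    obtain h v where h: "h \<in> borel_measurable borel" "v \<in> borel_measurable borel" "AE t in lborel. 0 \<le> t \<longrightarrow> F *v \<tau> t = v t"
      "\<And>t. t < 0 \<Longrightarrow> h t = g0 t" "\<And>t. 0 \<le> t \<Longrightarrow> h t = A *v h (t - T) + B *v v t"
      "J (\<lambda>t. F *v \<tau> t) = (\<integral>\<^sup>+t\<in>{0..}. ennreal ((norm (C *v h (t - T) + D *v v t))\<^sup>2 + (norm (v t))\<^sup>2) \<partial>lborel)"
      using lower[OF uopt_L2] by blast
    have v: "AE t in lborel. 0 \<le> t \<longrightarrow> v t = F *v g (t - T)"
      using h(3) uopt by eventually_elim auto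
    have "AE t in lborel. 0 \<le> t \<longrightarrow> h t - g t = A *v (h (t - T) - g (t - T))"
      using v by eventually_elim (auto simp: h(5) g(3) AF matrix_vector_mult_diff_distrib)
    then have "AE t in lborel. h (t - T) = g (t - T)"
      by (intro AE_shift same h(4))
    with v have "AE t in lborel. ennreal ((norm (C *v h (t - T) + D *v v t))\<^sup>2 + (norm (v t))\<^sup>2) * indicator {0..} t
      = ennreal ((norm (C *v g (t - T) + D *v (F *v g (t - T))))\<^sup>2 + (norm (F *v g (t - T)))\<^sup>2) * indicator {0..} t"
      by eventually_elim (auto simp: indicator_def)
    then show ?thesis
      unfolding h(6) opt_cost[symmetric] by (intro eq_refl nn_integral_cong_AE)
  qed
  have V0_le: "V0 \<le> J u" if u: "u \<in> L2_on {0..}" for u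
  proof -
    obtain N where "V0 + N \<le> J u" using lower[OF u] by blast
    moreover have "V0 \<le> V0 + N" by simp
    ultimately show ?thesis by (rule order_trans[rotated])
  qed
  show ?thesis
    unfolding unique_L2_minimizer_def J_def[symmetric]
  proof (intro conjI ballI impI uopt_L2)
    show "ennreal c * J (\<lambda>t. F *v \<tau> t) \<le> ennreal c * J v" if "v \<in> L2_on {0..}" for v
      using order_trans[OF J_opt V0_le[OF that]] by (rule mult_left_mono) simp
    fix u assume u: "u \<in> L2_on {0..}" and "\<forall>v'\<in>L2_on {0..}. ennreal c * J u \<le> ennreal c * J v'"
    then have "ennreal c * J u \<le> ennreal c * J (\<lambda>t. F *v \<tau> t)" using uopt_L2 by blast
    then have "J u \<le> J (\<lambda>t. F *v \<tau> t)"
      using \<open>0 < c\<close> by (simp add: ennreal_mult_le_mult_iff)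
    then have Ju: "J u \<le> V0" using J_opt by (rule order_trans)
    obtain h v where h: "h \<in> borel_measurable borel" "v \<in> borel_measurable borel" "AE t in lborel. 0 \<le> t \<longrightarrow> u t = v t"
      "\<And>t. t < 0 \<Longrightarrow> h t = g0 t" "\<And>t. 0 \<le> t \<Longrightarrow> h t = A *v h (t - T) + B *v v t"
      and le: "V0 + energy {0..} (\<lambda>t. v t - F *v h (t - T)) \<le> J u"
      using lower[OF u] by blast
    note [measurable] = h(1,2)
    \<comment> \<open>A minimizer leaves no room for a deviation: it follows the feedback law along
      its own trajectory, which therefore is the closed-loop one.\<close>
    have "V0 + energy {0..} (\<lambda>t. v t - F *v h (t - T)) \<le> V0 + 0"
      using order_trans[OF le Ju] by simp
    then have "energy {0..} (\<lambda>t. v t - F *v h (t - T)) = 0"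
      using V0_fin by (auto simp: ennreal_add_left_cancel_le)
    then have "AE t in lborel. ennreal ((norm (v t - F *v h (t - T)))\<^sup>2) * indicator {0..} t = 0"
      by (subst (asm) nn_integral_0_iff_AE) auto
    then have v: "AE t in lborel. 0 \<le> t \<longrightarrow> v t = F *v h (t - T)"
      by eventually_elim (auto simp: indicator_def split: if_splits)
    have "AE t in lborel. 0 \<le> t \<longrightarrow> h t - g t = (A + B ** F) *v (h (t - T) - g (t - T))"
      using v by eventually_elim (auto simp: h(5) g(3) AF matrix_vector_mult_diff_distrib)
    then have "AE t in lborel. h (t - T) = g (t - T)"
      by (intro AE_shift same h(4))
    with v h(3) uopt have "AE t in lborel. t \<in> {0..} \<longrightarrow> u t = F *v \<tau> t"
      by eventually_elim auto
    then show "AE t in lebesgue_on {0..}. u t = F *v \<tau> t"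
      by (simp add: AE_lebesgue_on_iff)
  qed
qed

end

theorem theorem3p1:
  fixes lam0 :: "real \<Rightarrow> real" and \<epsilon> :: real
    and M P :: "real \<Rightarrow> real ^ 'n::{finite, linorder} ^ 'n::{finite, linorder}"
    and K L :: "complex ^ 'n::{finite, linorder} ^ 'n::{finite, linorder}"
    and Ky Ly :: "complex ^ 'n::{finite, linorder} ^ 'm::finite"
    and Ad :: "complex ^ 'n::{finite, linorder} ^ 'n::{finite, linorder}" and Bd :: "complex ^ 'p::{finite, linorder} ^ 'n::{finite, linorder}"
    and Cd :: "complex ^ 'n::{finite, linorder} ^ 'm::finite" and Dd :: "complex ^ 'p::{finite, linorder} ^ 'm::finite"
    and Pi Pi_t A_Pi :: "complex ^ 'n::{finite, linorder} ^ 'n::{finite, linorder}" and Fd :: "complex ^ 'n::{finite, linorder} ^ 'p::{finite, linorder}"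
  assumes "CARD('p) \<le> CARD('n)"
    and "lam0 \<in> Linfty_on {0..1}"
    and "\<epsilon> > 0" and "AE \<zeta> in lebesgue_on {0..1}. lam0 \<zeta> \<ge> \<epsilon>"
    and "M \<in> Linfty_on {0..1}"
    and "invertible K"
    and "abs_continuous_on_interval 0 1 P"
    and "AE \<zeta> in lebesgue_on {0..1}.
           (P has_vector_derivative inverse (lam0 \<zeta>) *\<^sub>R (M \<zeta> ** P \<zeta>)) (at \<zeta>)"
    and "P 0 = mat 1"
    and "Ad = - (matrix_inv K ** L ** cmat (P 1))"
    and "Bd = - (matrix_inv K ** zero_id_block)"
    and "Cd = (Ky ** matrix_inv K ** L - Ly) ** cmat (P 1)"
    and "Dd = Ky ** matrix_inv K ** zero_id_block"
    and "nonneg_selfadjoint Pi" and "CARE Ad Bd Cd Dd Pi"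
    and "nonneg_selfadjoint Pi_t" and "FARE Ad Bd Cd Dd Pi_t"
    and "Fd = - (matrix_inv (mat 1 + adj Dd ** Dd + adj Bd ** Pi ** Bd)
                  ** (adj Dd ** Cd + adj Bd ** Pi ** Ad))"
    and "A_Pi = Ad + Bd ** Fd"
    and "spectral_radius A_Pi < 1"
  shows "(\<forall>z0\<in>L2_on {0..1}.
            (\<exists>z w \<tau>. closed_loop_solution lam0 Ad Bd Fd z0 z w \<and> boundary_trace w 1 \<tau>) \<and>
            (\<forall>z w \<tau>. closed_loop_solution lam0 Ad Bd Fd z0 z w \<and> boundary_trace w 1 \<tau> \<longrightarrow>
               unique_L2_minimizer
                 (\<lambda>u. ennreal (inverse (travel_time lam0 1)) * cost_J lam0 Ad Bd Cd Dd z0 u)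
                 (\<lambda>t. Fd *v \<tau> t)))
         \<and> closed_loop_exp_stable lam0 Ad Bd Fd"
proof -
  have lam_m: "lam0 \<in> borel_measurable (lebesgue_on {0..1})"
    using assms(2) by (simp add: Linfty_on_def)
  obtain l hi where "transport l \<epsilon> hi" and lam: "AE \<zeta> in lborel. \<zeta> \<in> {0..1} \<longrightarrow> l \<zeta> = lam0 \<zeta>"
    using speed_representative[OF assms(2-4)] by blast
  interpret transport l \<epsilon> hi by fact
  \<comment> \<open>Interpreted separately, so that \<open>F\<close> can be recognized as
    \<open>Fd\<close> before closed-loop stability is supplied.\<close>
  interpret riccati Ad Bd Cd Dd Pi
    using assms(14,15) by unfold_locales
  have F: "F = Fd"
    unfolding F_def S_def N_def assms(18) ..
  interpret lq_problem l \<epsilon> hi Ad Bd Cd Dd Pi Pi_t lam0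
    using assms(16,17) lam_m lam stable_matrix_if_spectral_radius[OF assms(20)]
    by unfold_locales (simp_all add: F assms(19))
  \<comment> \<open>Hence the factor in front of the cost is positive and does not affect the
    minimizers.\<close>
  have "travel_time lam0 1 = integral {0..1} rate"
    unfolding travel_time_def using lam
    by (intro integral_cong_AE_interval[of "{0..1}"]) (auto simp: rate_def elim!: eventually_mono)
  then have travel: "travel_time lam0 1 = T"
    using p_diff[of 0 1] by (simp add: T_def)
  have "\<exists>z w \<tau>. closed_loop_solution lam0 Ad Bd Fd z0 z w \<and> boundary_trace w 1 \<tau>" if z0: "z0 \<in> L2_on {0..1}" for z0
  proof -
    obtain g0 g where traj: "closed_loop_trajectory z0 g0 g"
      using closed_loop_trajectory_exists[OF z0] by blast
    then show ?thesis
      using closed_loop(1)[OF z0 traj] closed_loop_trace(1)[OF z0 traj] unfolding F by blast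
  qed
  moreover have "unique_L2_minimizer (\<lambda>u. ennreal (inverse (travel_time lam0 1)) * cost_J lam0 Ad Bd Cd Dd z0 u) (\<lambda>t. Fd *v \<tau> t)"
    if "z0 \<in> L2_on {0..1}" "closed_loop_solution lam0 Ad Bd Fd z0 z w" "boundary_trace w 1 \<tau>" for z0 z w \<tau>
    using feedback_optimal[of z0 z w \<tau> "inverse T"] that T_pos by (simp add: F travel)
  moreover have "closed_loop_exp_stable lam0 Ad Bd Fd"
    using closed_loop_exponentially_stable by (simp add: F)
  ultimately show ?thesis by blast
qed

end
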